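(* Let $X$ be an analytic normed space with only finitely many linear isometries, and let $G=(V,E)$ be a finite simple graph with $|V|\geq 2$ that is globally rigid in $X$. Then $G$ is redundantly rigid in $X$ and 2-connected.
   Context: An analytic normed space is a finite-dimensional real normed space that is non-Euclidean (its norm does not satisfy the parallelogram law) and whose norm is real analytic on $X\setminus\{0\}$. For a graph $G=(V,E)$ and $p\in X^V$, $(G,p)$ is a framework; $(G,p),(G,q)$ are equivalent if $\|p_v-p_w\|=\|q_v-q_w\|$ for all $vw\in E$ and congruent if $q_v=g(p_v)$ for all $v$ for some isometry $g$ of $X$; $(G,p)$ is globally rigid if every equivalent framework is congruent to it, and $G$ is globally rigid in $X$ if the set of such $p$ has non-empty interior in $X^V$. A support functional of $x$ is $f\in X^*$ with $f(x)=\|x\|^2$, $\|f\|^*=\|x\|$; non-zero $x$ is smooth if it has a unique one, $\varphi_x$. $(G,p)$ is well-positioned if $p_v-p_w$ is non-zero and smooth for all $vw\in E$; infinitesimal flexes are $u\in X^V$ with $\varphi_{p_v-p_w}(u_v-u_w)=0$ for all $vw\in E$; a flex is trivial if $u_v=T(p_v)+z$ for some linear $T:X\to X$ and $z\in X$ with $f(T(x))=0$ for all $x\in X$ and all support functionals $f$ of $x$; $(G,p)$ is infinitesimally rigid if all flexes are trivial. $G$ is redundantly rigid in $X$ if there is a well-positioned framework $(G,p)$ with $(G-e,p)$ infinitesimally rigid for every $e\in E$. *)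

theory Defs
  imports "HOL-Analysis.Analysis"
begin

(* Local expansion into an (unconditionally convergent) power series in linear coordinates with
   respect to a basis B of the space; multi-indices are the extensional functions from B to nat.
   The notion does not depend on the choice of B. *)
definition real_analytic_on :: "('a::real_normed_vector \<Rightarrow> real) \<Rightarrow> 'a set \<Rightarrow> bool" where
  "real_analytic_on f U \<longleftrightarrow>
    (\<exists>B. finite B \<and> independent B \<and> span B = UNIV \<and>
      (\<forall>a\<in>U. \<exists>r>0. \<exists>c :: ('a \<Rightarrow> nat) \<Rightarrow> real.
        \<forall>t :: 'a \<Rightarrow> real. (\<forall>b\<in>B. \<bar>t b\<bar> < r) \<longrightarrow>
          ((\<lambda>\<alpha>. c \<alpha> * (\<Prod>b\<in>B. t b ^ \<alpha> b)) has_sum f (a + (\<Sum>b\<in>B. t b *\<^sub>R b)))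
            (B \<rightarrow>\<^sub>E UNIV)))"

definition euclidean_norm :: "'a::real_normed_vector itself \<Rightarrow> bool" where
  "euclidean_norm _ \<longleftrightarrow>
    (\<forall>x y :: 'a. (norm (x + y))\<^sup>2 + (norm (x - y))\<^sup>2 = 2 * (norm x)\<^sup>2 + 2 * (norm y)\<^sup>2)"

definition analytic_normed_space :: "'a::real_normed_vector itself \<Rightarrow> bool" where
  "analytic_normed_space T \<longleftrightarrow>
    (\<exists>B :: 'a set. finite B \<and> span B = UNIV) \<and>
    \<not> euclidean_norm T \<and>
    real_analytic_on (norm :: 'a \<Rightarrow> real) (- {0})"

(* In a finite-dimensional space a distance-preserving self-map is automatically surjective. *)
definition isometry :: "('a::metric_space \<Rightarrow> 'a) \<Rightarrow> bool" where
  "isometry g \<longleftrightarrow> (\<forall>x y. dist (g x) (g y) = dist x y)"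

(* The vertex set of a graph is the whole finite type 'v; edges are two-element sets of vertices. *)
definition simple_graph :: "'v::finite set set \<Rightarrow> bool" where
  "simple_graph E \<longleftrightarrow> (\<forall>e\<in>E. card e = 2)"

definition connected_on :: "'v set set \<Rightarrow> 'v set \<Rightarrow> bool" where
  "connected_on E W \<longleftrightarrow>
    W \<noteq> {} \<and> (\<forall>v\<in>W. \<forall>w\<in>W. (v, w) \<in> {(x, y). x \<in> W \<and> y \<in> W \<and> {x, y} \<in> E}\<^sup>*)"

definition k_connected :: "nat \<Rightarrow> 'v::finite set set \<Rightarrow> bool" where
  "k_connected k E \<longleftrightarrow> CARD('v) > k \<and> (\<forall>S. card S < k \<longrightarrow> connected_on E (- S))"

definition equivalent_frameworks ::
    "'v::finite set set \<Rightarrow> ('a::real_normed_vector)^'v \<Rightarrow> 'a^'v \<Rightarrow> bool" where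
  "equivalent_frameworks E p q \<longleftrightarrow>
    (\<forall>v w. {v, w} \<in> E \<longrightarrow> norm (p $ v - p $ w) = norm (q $ v - q $ w))"

definition congruent_frameworks :: "('a::real_normed_vector)^'v::finite \<Rightarrow> 'a^'v \<Rightarrow> bool" where
  "congruent_frameworks p q \<longleftrightarrow> (\<exists>g. isometry g \<and> (\<forall>v. q $ v = g (p $ v)))"

definition globally_rigid_framework ::
    "'v::finite set set \<Rightarrow> ('a::real_normed_vector)^'v \<Rightarrow> bool" where
  "globally_rigid_framework E p \<longleftrightarrow>
    (\<forall>q. equivalent_frameworks E p q \<longrightarrow> congruent_frameworks p q)"

definition globally_rigid :: "'a::real_normed_vector itself \<Rightarrow> 'v::finite set set \<Rightarrow> bool" where
  "globally_rigid _ E \<longleftrightarrow> interior {p :: 'a^'v. globally_rigid_framework E p} \<noteq> {}"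

definition support_functional :: "'a::real_normed_vector \<Rightarrow> ('a \<Rightarrow>\<^sub>L real) \<Rightarrow> bool" where
  "support_functional x f \<longleftrightarrow> blinfun_apply f x = (norm x)\<^sup>2 \<and> norm f = norm x"

definition smooth_point :: "'a::real_normed_vector \<Rightarrow> bool" where
  "smooth_point x \<longleftrightarrow> x \<noteq> 0 \<and> (\<exists>!f. support_functional x f)"

definition the_support_functional :: "'a::real_normed_vector \<Rightarrow> ('a \<Rightarrow>\<^sub>L real)" where
  "the_support_functional x = (THE f. support_functional x f)"

definition well_positioned :: "'v::finite set set \<Rightarrow> ('a::real_normed_vector)^'v \<Rightarrow> bool" where
  "well_positioned E p \<longleftrightarrow> (\<forall>v w. {v, w} \<in> E \<longrightarrow> smooth_point (p $ v - p $ w))"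

definition infinitesimal_flex ::
    "'v::finite set set \<Rightarrow> ('a::real_normed_vector)^'v \<Rightarrow> 'a^'v \<Rightarrow> bool" where
  "infinitesimal_flex E p u \<longleftrightarrow>
    (\<forall>v w. {v, w} \<in> E \<longrightarrow>
      blinfun_apply (the_support_functional (p $ v - p $ w)) (u $ v - u $ w) = 0)"

definition trivial_flex :: "('a::real_normed_vector)^'v::finite \<Rightarrow> 'a^'v \<Rightarrow> bool" where
  "trivial_flex p u \<longleftrightarrow>
    (\<exists>T z. linear T \<and> (\<forall>x f. support_functional x f \<longrightarrow> blinfun_apply f (T x) = 0) \<and>
      (\<forall>v. u $ v = T (p $ v) + z))"

(* Only meaningful for well-positioned frameworks. *)
definition infinitesimally_rigid ::
    "'v::finite set set \<Rightarrow> ('a::real_normed_vector)^'v \<Rightarrow> bool" where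
  "infinitesimally_rigid E p \<longleftrightarrow> (\<forall>u. infinitesimal_flex E p u \<longrightarrow> trivial_flex p u)"

definition redundantly_rigid :: "'a::real_normed_vector itself \<Rightarrow> 'v::finite set set \<Rightarrow> bool" where
  "redundantly_rigid _ E \<longleftrightarrow>
    (\<exists>p :: 'a^'v. well_positioned E p \<and> (\<forall>e\<in>E. infinitesimally_rigid (E - {e}) p))"

end

theory Submission
  imports Defs "HOL-Complex_Analysis.Conformal_Mappings"
begin

text \<open>
  In linear coordinates the edge lengths are real analytic away from degenerate configurations; fixing the
  position of one vertex removes the translations, so that only finitely many equivalent frameworks are
  congruent to a given one.

  If the lengths of \<open>G\<close> had everywhere deficient rank on an open set of globally rigid frameworks, a flow
  along the kernel of their gradients would produce infinitely many equivalent frameworks.  Otherwise suppose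
  that \<open>G - e\<close> is flexible on an open set.  Then the lengths of \<open>G - e\<close> have rank one below the maximum, by
  analyticity everywhere, and a Sard argument yields a framework \<open>p\<close> all of whose fibre under these lengths
  is regular.  The fibre is a compact curve on which the length of \<open>e\<close> is not stationary at \<open>p\<close>, hence takes
  the value at \<open>p\<close> again, with the opposite direction of crossing, at some \<open>q\<close>.  Global rigidity makes \<open>q\<close>
  the image of \<open>p\<close> under an isometry; this isometry reverses the curve, so it fixes a point of it, and
  there the gradients have too large a kernel.

  A cut vertex would allow one side of the graph to be reflected in a point, and a disconnected graph one
  component to be translated; for generic \<open>p\<close> the result is not congruent to \<open>p\<close>.
\<close>

section \<open>Functions that are holomorphic along complex lines\<close>

text \<open>On the complex side one variable suffices: real analytic functions are extended to
  functions holomorphic along complex lines, and the two facts drawn from this, propagation of zeros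
  along a segment and finite order of vanishing, concern a single line. The obstacle is global: a
  fibre of the lengths of \<open>G - e\<close> may leave the open set where rigidity is known, yet
  the kernel field has to be tangent to it and non-zero at all of its points. Tangency spreads by
  the identity theorem: a non-Euclidean norm forces dim X >= 2, so the degenerate configurations
  have codimension at least 2 and separate nothing. Non-vanishing on a whole fibre is what the Sard
  argument buys. Connectivity is proved before redundant rigidity because it supplies a third
  vertex: a non-trivial isometry that keeps a pinned vertex then displaces two other vertices
  independently, which makes the kernel at the fixed point two-dimensional. Analyticity also gives
  strict convexity, hence isometries are affine, and congruence with one vertex pinned leaves only a
  linear isometry, of which there are finitely many.\<close>

definition complex_vec :: "real^'i \<Rightarrow> complex^'i" where
  "complex_vec x = (\<chi> i. of_real (x $ i))"

text \<open>Differentiability is asked only at parameter 0, but at every base point of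
  \<open>U\<close>; sliding the base point along a line gives holomorphy on the whole part of the
  line inside \<open>U\<close>. Joint continuity is included so that Cauchy integrals depend
  continuously on the base point.\<close>

definition line_holomorphic :: "(complex^'i) set \<Rightarrow> (complex^'i \<Rightarrow> complex) \<Rightarrow> bool" where
  "line_holomorphic U F \<longleftrightarrow> continuous_on U F \<and>
     (\<forall>z\<in>U. \<forall>u. (\<lambda>w. F (z + w *s u)) field_differentiable at 0)"

definition complex_dir_deriv :: "complex^'i \<Rightarrow> (complex^'i \<Rightarrow> complex) \<Rightarrow> complex^'i \<Rightarrow> complex" where
  "complex_dir_deriv u F z = deriv (\<lambda>w. F (z + w *s u)) 0"

lemma continuous_on_vector_smult [continuous_intros]:
  fixes f :: "'b::topological_space \<Rightarrow> complex" and g :: "'b \<Rightarrow> complex^'i"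
  assumes "continuous_on S f" "continuous_on S g"
  shows "continuous_on S (\<lambda>x. f x *s g x)"
  unfolding vector_scalar_mult_def by (intro continuous_intros assms)

lemma line_holomorphic_has_field_derivative:
  assumes "line_holomorphic U F" "z + w *s u \<in> U"
  shows "((\<lambda>w. F (z + w *s u)) has_field_derivative complex_dir_deriv u F (z + w *s u)) (at w)"
proof -
  have "(\<lambda>h. F ((z + w *s u) + h *s u)) field_differentiable at 0"
    using assms unfolding line_holomorphic_def by blast
  then have "((\<lambda>h. F ((z + w *s u) + h *s u)) has_field_derivative
      complex_dir_deriv u F (z + w *s u)) (at 0)"
    unfolding complex_dir_deriv_def by (simp add: field_differentiable_derivI)
  then have "((\<lambda>h. F (z + (h + w) *s u)) has_field_derivative
      complex_dir_deriv u F (z + w *s u)) (at 0)"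
    by (simp add: vector_sadd_rdistrib add.commute add.left_commute)
  then show ?thesis
    using DERIV_shift[of "\<lambda>w. F (z + w *s u)" _ 0 w] by simp
qed

lemma line_holomorphic_imp_holomorphic:
  assumes "line_holomorphic U F" "\<And>w. w \<in> D \<Longrightarrow> z + w *s u \<in> U"
  shows "(\<lambda>w. F (z + w *s u)) holomorphic_on D"
  using assms line_holomorphic_has_field_derivative
  by (metis holomorphic_onI field_differentiable_at_within field_differentiable_def)

lemma open_line_preimage:
  fixes U :: "(complex^'i) set"
  assumes "open U"
  shows "open {w. z + w *s u \<in> U}"
  using open_vimage[OF assms, of "\<lambda>w. z + w *s u"]
  by (simp add: vimage_def continuous_intros)

text \<open>Cauchy's formula with the circle parametrised over \<open>{0..1}\<close>: the velocity
  of the circle is 2 pi i times its position, which cancels one factor of the denominator. A fixed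
  interval of integration allows the theorems on parameter integrals to be applied.\<close>

lemma deriv_eq_circle_average:
  assumes "h holomorphic_on ball 0 R" "0 < r" "r < R"
  shows "deriv h 0 = integral {0..1} (\<lambda>t. h (of_real r * exp (2 * of_real pi * \<i> * of_real t))
           / (of_real r * exp (2 * of_real pi * \<i> * of_real t)))"
proof -
  let ?c = "\<lambda>t. of_real r * exp (2 * of_real pi * \<i> * of_real t)"
  have "((\<lambda>u. h u / (u - 0)^2) has_contour_integral 2 * of_real pi * \<i> * deriv h 0) (circlepath 0 r)"
  proof -
    have "((\<lambda>u. h u / (u - 0) ^ Suc 1) has_contour_integral
            (2 * pi * \<i>) / (fact 1) * (deriv ^^ 1) h 0) (circlepath 0 r)"
      by (rule Cauchy_has_contour_integral_higher_derivative_circlepath)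
         (use assms in \<open>auto intro!: holomorphic_on_imp_continuous_on intro: holomorphic_on_subset\<close>)
    then show ?thesis by (simp add: power2_eq_square)
  qed
  then have "((\<lambda>t. h (circlepath 0 r t) / (circlepath 0 r t)^2 *
       vector_derivative (circlepath 0 r) (at t within {0..1}))
       has_integral 2 * of_real pi * \<i> * deriv h 0) {0..1}"
    by (simp add: has_contour_integral_def)
  moreover have "h (circlepath 0 r t) / (circlepath 0 r t)^2 *
       vector_derivative (circlepath 0 r) (at t within {0..1}) =
       2 * of_real pi * \<i> * (h (?c t) / ?c t)" if "t \<in> {0..1}" for t
    using that assms(2)
    by (subst vector_derivative_circlepath01, simp_all add: circlepath power2_eq_square field_simps)
  ultimately have "((\<lambda>t. 2 * of_real pi * \<i> * (h (?c t) / ?c t))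
       has_integral 2 * of_real pi * \<i> * deriv h 0) {0..1}"
    by (metis (no_types, lifting) has_integral_cong)
  then have "((\<lambda>t. (h (?c t) / ?c t)) has_integral deriv h 0) {0..1}"
    using has_integral_mult_right[of _ _ "{0..1}" "1 / (2 * of_real pi * \<i>)"] by fastforce
  then show ?thesis
    by (metis integral_unique)
qed

text \<open>One radius serves all base points near \<open>z0\<close>, because a neighbourhood of
  \<open>(z0, 0)\<close> contains a product. This uniformity turns the directional derivative into a
  parameter integral.\<close>

lemma complex_dir_deriv_eq_integral:
  fixes U :: "(complex^'i) set"
  assumes F: "line_holomorphic U F" and U: "open U" and z0: "z0 \<in> U"
  shows "\<exists>d>0. \<exists>r>0. \<forall>z\<in>ball z0 d.
     (\<forall>t. z + (of_real r * exp (2 * of_real pi * \<i> * of_real t)) *s u \<in> U) \<and>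
     complex_dir_deriv u F z =
       integral {0..1} (\<lambda>t. F (z + (of_real r * exp (2 * of_real pi * \<i> * of_real t)) *s u)
         / (of_real r * exp (2 * of_real pi * \<i> * of_real t)))"
proof -
  have "continuous_on UNIV (\<lambda>p :: (complex^'i) \<times> complex. fst p + snd p *s u)"
    by (intro continuous_intros)
  then have "open ((\<lambda>p :: (complex^'i) \<times> complex. fst p + snd p *s u) -` U)"
    using U by (simp add: open_vimage)
  moreover have "(z0, 0) \<in> (\<lambda>p :: (complex^'i) \<times> complex. fst p + snd p *s u) -` U"
    using z0 by simp
  ultimately obtain A B where AB: "open A" "open B" "(z0, 0) \<in> A \<times> B"
     "A \<times> B \<subseteq> (\<lambda>p :: (complex^'i) \<times> complex. fst p + snd p *s u) -` U"
    by (rule open_prod_elim)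
  then obtain d R where d: "d > 0" "ball z0 d \<subseteq> A" and R: "R > 0" "ball 0 R \<subseteq> B"
    by (metis mem_Sigma_iff open_contains_ball)
  have sub: "z + w *s u \<in> U" if "z \<in> ball z0 d" "w \<in> ball 0 R" for z w
    using that AB(4) d R by (auto simp: subset_iff)
  show ?thesis
  proof (rule exI[of _ d], intro conjI, rule d(1), rule exI[of _ "R/2"], intro conjI ballI allI)
    show "R/2 > 0" using R by auto
    show "z + (of_real (R/2) * exp (2 * of_real pi * \<i> * of_real t)) *s u \<in> U"
      if "z \<in> ball z0 d" for z t
      by (rule sub[OF that]) (use R in \<open>simp add: norm_mult\<close>)
    show "complex_dir_deriv u F z =
       integral {0..1} (\<lambda>t. F (z + (of_real (R/2) * exp (2 * of_real pi * \<i> * of_real t)) *s u)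
         / (of_real (R/2) * exp (2 * of_real pi * \<i> * of_real t)))" if "z \<in> ball z0 d" for z
      unfolding complex_dir_deriv_def
      by (rule deriv_eq_circle_average[of _ R])
         (use R that in \<open>auto intro!: line_holomorphic_imp_holomorphic[OF F] sub\<close>)
  qed
qed

lemma continuous_on_circle_quotient:
  fixes F :: "complex^'i \<Rightarrow> complex" and h :: "'b::topological_space \<Rightarrow> real"
  assumes F: "continuous_on U F" and r: "r > 0" and g: "continuous_on A g" and h: "continuous_on A h"
    and sub: "\<And>p. p \<in> A \<Longrightarrow>
      g p + (of_real r * exp (2 * of_real pi * \<i> * of_real (h p))) *s u \<in> U"
  shows "continuous_on A (\<lambda>p. F (g p + (of_real r * exp (2 * of_real pi * \<i> * of_real (h p))) *s u)
     / (of_real r * exp (2 * of_real pi * \<i> * of_real (h p))))"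
proof -
  let ?c = "\<lambda>p. of_real r * exp (2 * of_real pi * \<i> * of_real (h p))"
  have c: "continuous_on A ?c"
    using h by (intro continuous_intros)
  have "continuous_on A (\<lambda>p. g p + ?c p *s u)"
    by (intro continuous_on_add g continuous_on_vector_smult c continuous_on_const)
  then have "continuous_on A (\<lambda>p. F (g p + ?c p *s u))"
    by (rule continuous_on_compose2[OF F]) (use sub in blast)
  then show ?thesis
    by (rule continuous_on_divide[OF _ c]) (use r in simp)
qed

lemma continuous_on_complex_dir_deriv:
  fixes U :: "(complex^'i) set"
  assumes F: "line_holomorphic U F" and U: "open U"
  shows "continuous_on U (complex_dir_deriv u F)"
proof -
  have "continuous (at z0) (complex_dir_deriv u F)" if z0: "z0 \<in> U" for z0
  proof -
    obtain d r where d: "d > 0" and r: "r > 0" and *: "\<forall>z\<in>ball z0 d.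
     (\<forall>t. z + (of_real r * exp (2 * of_real pi * \<i> * of_real t)) *s u \<in> U) \<and>
     complex_dir_deriv u F z =
       integral {0..1} (\<lambda>t. F (z + (of_real r * exp (2 * of_real pi * \<i> * of_real t)) *s u)
         / (of_real r * exp (2 * of_real pi * \<i> * of_real t)))"
    using complex_dir_deriv_eq_integral[OF F U z0, of u] by blast
  have sub: "z + (of_real r * exp (2 * of_real pi * \<i> * of_real t)) *s u \<in> U"
    if "z \<in> ball z0 d" for z t using * that by blast
  have eq: "complex_dir_deriv u F z =
       integral {0..1} (\<lambda>t. F (z + (of_real r * exp (2 * of_real pi * \<i> * of_real t)) *s u)
         / (of_real r * exp (2 * of_real pi * \<i> * of_real t)))" if "z \<in> ball z0 d" for z
    using * that by blast
    let ?c = "\<lambda>t. of_real r * exp (2 * of_real pi * \<i> * of_real t)"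
    have "continuous_on (ball z0 d \<times> cbox 0 (1::real)) (\<lambda>p. F (fst p + ?c (snd p) *s u) / ?c (snd p))"
      by (rule continuous_on_circle_quotient[of U F r _ fst snd])
         (use F r sub in \<open>auto simp: line_holomorphic_def intro!: continuous_intros\<close>)
    then have "continuous_on (ball z0 d) (\<lambda>z. integral (cbox 0 1) (\<lambda>t. F (z + ?c t *s u) / ?c t))"
      by (intro integral_continuous_on_param) (simp add: case_prod_beta)
    then have "continuous_on (ball z0 d) (complex_dir_deriv u F)"
      by (rule continuous_on_eq) (simp add: eq)
    then show ?thesis
      using d by (simp add: continuous_on_eq_continuous_at)
  qed
  then show ?thesis
    by (simp add: continuous_at_imp_continuous_on)
qed

text \<open>Cauchy's integral for the direction \<open>u\<close> is differentiated under the
  integral sign in a second direction \<open>v\<close>; the differentiated integrand is continuous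
  by the previous lemma. Directional derivatives can therefore be iterated.\<close>

lemma line_holomorphic_complex_dir_deriv:
  fixes U :: "(complex^'i) set"
  assumes F: "line_holomorphic U F" and U: "open U"
  shows "line_holomorphic U (complex_dir_deriv u F)"
  unfolding line_holomorphic_def
proof (intro conjI ballI allI continuous_on_complex_dir_deriv[OF F U])
  fix z0 v assume z0: "z0 \<in> U"
  obtain d r where d: "d > 0" and r: "r > 0" and *: "\<forall>z\<in>ball z0 d.
     (\<forall>t. z + (of_real r * exp (2 * of_real pi * \<i> * of_real t)) *s u \<in> U) \<and>
     complex_dir_deriv u F z =
       integral {0..1} (\<lambda>t. F (z + (of_real r * exp (2 * of_real pi * \<i> * of_real t)) *s u)
         / (of_real r * exp (2 * of_real pi * \<i> * of_real t)))"
    using complex_dir_deriv_eq_integral[OF F U z0, of u] by blast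
  have sub: "z + (of_real r * exp (2 * of_real pi * \<i> * of_real t)) *s u \<in> U"
    if "z \<in> ball z0 d" for z t using * that by blast
  have eq: "complex_dir_deriv u F z =
       integral {0..1} (\<lambda>t. F (z + (of_real r * exp (2 * of_real pi * \<i> * of_real t)) *s u)
         / (of_real r * exp (2 * of_real pi * \<i> * of_real t)))" if "z \<in> ball z0 d" for z
    using * that by blast
  let ?c = "\<lambda>t. of_real r * exp (2 * of_real pi * \<i> * of_real t)"
  have "0 \<in> {w. z0 + w *s v \<in> ball z0 d}"
    using d by simp
  then obtain e where e: "e > 0" "ball 0 e \<subseteq> {w. z0 + w *s v \<in> ball z0 d}"
    using open_line_preimage[of "ball z0 d" z0 v] by (metis open_ball open_contains_ball)
  have cF: "continuous_on U F" and cD: "continuous_on U (complex_dir_deriv v F)"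
    using F continuous_on_complex_dir_deriv[OF F U] by (auto simp: line_holomorphic_def)
  have "(\<lambda>w. integral (cbox 0 1) (\<lambda>t. F (z0 + w *s v + ?c t *s u) / ?c t)) holomorphic_on ball 0 e"
  proof (rule leibniz_rule_holomorphic[where fx = "\<lambda>w t. complex_dir_deriv v F (z0 + w *s v + ?c t *s u) / ?c t"])
    show "((\<lambda>w. F (z0 + w *s v + ?c t *s u) / ?c t) has_field_derivative
        complex_dir_deriv v F (z0 + w *s v + ?c t *s u) / ?c t) (at w within ball 0 e)"
      if "w \<in> ball 0 e" for w and t :: real
    proof -
      have "z0 + ?c t *s u + w *s v \<in> U"
        using sub[of "z0 + w *s v" t] e that by (auto simp: add_ac)
      from line_holomorphic_has_field_derivative[OF F this]
      have "((\<lambda>w. F (z0 + w *s v + ?c t *s u)) has_field_derivative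
        complex_dir_deriv v F (z0 + w *s v + ?c t *s u)) (at w)"
        by (simp add: add_ac)
      then show ?thesis
        using DERIV_cdivide has_field_derivative_at_within by blast
    qed
    have "continuous_on (ball 0 e \<times> cbox 0 1)
       (\<lambda>p. complex_dir_deriv v F (z0 + fst p *s v + ?c (snd p) *s u) / ?c (snd p))"
    proof (rule continuous_on_circle_quotient[OF cD r, of _ "\<lambda>p. z0 + fst p *s v" snd])
      show "continuous_on (ball 0 e \<times> cbox 0 1) (\<lambda>p. z0 + fst p *s v)"
        by (intro continuous_intros)
    qed (use e sub in \<open>auto intro!: continuous_intros\<close>)
    then show "continuous_on (ball 0 e \<times> cbox 0 1)
       (\<lambda>(w, t). complex_dir_deriv v F (z0 + w *s v + ?c t *s u) / ?c t)"
      by (simp add: case_prod_beta)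
    show "(\<lambda>t. F (z0 + w *s v + ?c t *s u) / ?c t) integrable_on cbox 0 1" if "w \<in> ball 0 e" for w
      by (rule integrable_continuous, rule continuous_on_circle_quotient[OF cF r, of _ "\<lambda>t. z0 + w *s v" "\<lambda>t. t"])
         (use e that sub in auto)
  qed auto
  then have "(\<lambda>w. complex_dir_deriv u F (z0 + w *s v)) holomorphic_on ball 0 e"
    by (rule holomorphic_transform) (use eq e in auto)
  then show "(\<lambda>w. complex_dir_deriv u F (z0 + w *s v)) field_differentiable at 0"
    using e(1) by (meson centre_in_ball holomorphic_on_imp_differentiable_at open_ball)
qed

section \<open>Real analytic functions of several variables\<close>

text \<open>Analyticity as local extension to a complex neighbourhood of the real point. In this
  form sums, products, determinants and derivatives need no handling of coefficients; power series
  enter only once, for the norm itself.\<close>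

definition analytic_vec_on :: "(real^'i) set \<Rightarrow> (real^'i \<Rightarrow> real) \<Rightarrow> bool" where
  "analytic_vec_on S f \<longleftrightarrow> (\<forall>a\<in>S. \<exists>U F. open U \<and> complex_vec a \<in> U \<and> line_holomorphic U F \<and>
     (\<forall>x. complex_vec x \<in> U \<longrightarrow> F (complex_vec x) = of_real (f x)))"

definition dir_deriv :: "real^'i \<Rightarrow> (real^'i \<Rightarrow> real) \<Rightarrow> real^'i \<Rightarrow> real" where
  "dir_deriv v f x = deriv (\<lambda>t. f (x + t *\<^sub>R v)) 0"

section \<open>Closure properties of real analytic functions\<close>

lemma complex_vec_add [simp]: "complex_vec (x + y) = complex_vec x + complex_vec y"
  by (simp add: complex_vec_def vec_eq_iff)

lemma complex_vec_scaleR [simp]: "complex_vec (t *\<^sub>R x) = of_real t *s complex_vec x"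
  by (simp add: complex_vec_def vec_eq_iff)

lemma continuous_on_complex_vec [continuous_intros]:
  "continuous_on S f \<Longrightarrow> continuous_on S (\<lambda>x. complex_vec (f x))"
  unfolding complex_vec_def by (intro continuous_intros)

lemma open_complex_vec_preimage:
  assumes "open U" shows "open {x. complex_vec x \<in> U}"
  using open_vimage[OF assms continuous_on_complex_vec[OF continuous_on_id]]
  by (simp add: vimage_def)

lemma analytic_vec_on_subset: "analytic_vec_on S f \<Longrightarrow> T \<subseteq> S \<Longrightarrow> analytic_vec_on T f"
  unfolding analytic_vec_on_def by blast

lemma line_holomorphic_const: "line_holomorphic U (\<lambda>z. c)"
  unfolding line_holomorphic_def by auto

lemma line_holomorphic_nth: "line_holomorphic U (\<lambda>z. z $ i)"
  unfolding line_holomorphic_def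
proof (intro conjI ballI allI)
  show "(\<lambda>w. (z + w *s u) $ i) field_differentiable at 0" for z u :: "complex^'a"
    by (simp add: field_differentiable_add field_differentiable_mult)
qed (intro continuous_intros)

lemma analytic_vec_on_const: "analytic_vec_on S (\<lambda>x. c)"
  unfolding analytic_vec_on_def
  by (intro ballI exI[of _ UNIV] exI[of _ "\<lambda>x. of_real c"]) (auto intro: line_holomorphic_const)

lemma analytic_vec_on_nth: "analytic_vec_on S (\<lambda>x. x $ i)"
  unfolding analytic_vec_on_def
  by (intro ballI exI[of _ UNIV] exI[of _ "\<lambda>x. x $ i"]) (auto simp: complex_vec_def intro: line_holomorphic_nth)

lemma line_holomorphic_subset: "line_holomorphic U F \<Longrightarrow> V \<subseteq> U \<Longrightarrow> line_holomorphic V F"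
  unfolding line_holomorphic_def using continuous_on_subset by blast

lemma line_holomorphic_add:
  assumes "line_holomorphic U F" "line_holomorphic U G"
  shows "line_holomorphic U (\<lambda>z. F z + G z)"
  using assms unfolding line_holomorphic_def
  by (metis (no_types) continuous_on_add field_differentiable_add)

lemma line_holomorphic_mult:
  assumes "line_holomorphic U F" "line_holomorphic U G"
  shows "line_holomorphic U (\<lambda>z. F z * G z)"
  using assms unfolding line_holomorphic_def
  by (metis (no_types) continuous_on_mult field_differentiable_mult)

lemma analytic_vec_on_add:
  assumes "analytic_vec_on S f" "analytic_vec_on S g"
  shows "analytic_vec_on S (\<lambda>x. f x + g x)"
  unfolding analytic_vec_on_def
proof
  fix a assume "a \<in> S"
  then obtain U F V G where "open U" "complex_vec a \<in> U" "line_holomorphic U F"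
     "\<forall>x. complex_vec x \<in> U \<longrightarrow> F (complex_vec x) = of_real (f x)"
     "open V" "complex_vec a \<in> V" "line_holomorphic V G"
     "\<forall>x. complex_vec x \<in> V \<longrightarrow> G (complex_vec x) = of_real (g x)"
    using assms unfolding analytic_vec_on_def by metis
  then show "\<exists>U F. open U \<and> complex_vec a \<in> U \<and> line_holomorphic U F \<and>
     (\<forall>x. complex_vec x \<in> U \<longrightarrow> F (complex_vec x) = of_real (f x + g x))"
    using line_holomorphic_add[of "U \<inter> V" F G] line_holomorphic_subset[of _ _ "U \<inter> V"]
    by (intro exI[of _ "U \<inter> V"] exI[of _ "\<lambda>z. F z + G z"]) auto
qed

lemma analytic_vec_on_mult:
  assumes "analytic_vec_on S f" "analytic_vec_on S g"
  shows "analytic_vec_on S (\<lambda>x. f x * g x)"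
  unfolding analytic_vec_on_def
proof
  fix a assume "a \<in> S"
  then obtain U F V G where "open U" "complex_vec a \<in> U" "line_holomorphic U F"
     "\<forall>x. complex_vec x \<in> U \<longrightarrow> F (complex_vec x) = of_real (f x)"
     "open V" "complex_vec a \<in> V" "line_holomorphic V G"
     "\<forall>x. complex_vec x \<in> V \<longrightarrow> G (complex_vec x) = of_real (g x)"
    using assms unfolding analytic_vec_on_def by metis
  then show "\<exists>U F. open U \<and> complex_vec a \<in> U \<and> line_holomorphic U F \<and>
     (\<forall>x. complex_vec x \<in> U \<longrightarrow> F (complex_vec x) = of_real (f x * g x))"
    using line_holomorphic_mult[of "U \<inter> V" F G] line_holomorphic_subset[of _ _ "U \<inter> V"]
    by (intro exI[of _ "U \<inter> V"] exI[of _ "\<lambda>z. F z * G z"]) auto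
qed

lemma analytic_vec_on_sum:
  assumes "\<And>k. k \<in> A \<Longrightarrow> analytic_vec_on S (f k)"
  shows "analytic_vec_on S (\<lambda>x. \<Sum>k\<in>A. f k x)"
  using assms by (induction A rule: infinite_finite_induct)
     (auto intro: analytic_vec_on_const analytic_vec_on_add)

lemma analytic_vec_on_prod:
  assumes "\<And>k. k \<in> A \<Longrightarrow> analytic_vec_on S (f k)"
  shows "analytic_vec_on S (\<lambda>x. \<Prod>k\<in>A. f k x)"
  using assms by (induction A rule: infinite_finite_induct)
     (auto intro: analytic_vec_on_const analytic_vec_on_mult)

lemma analytic_vec_on_det:
  fixes A :: "real^'i \<Rightarrow> real^'n^'n"
  assumes "\<And>i j. analytic_vec_on S (\<lambda>x. A x $ i $ j)"
  shows "analytic_vec_on S (\<lambda>x. det (A x))"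
  unfolding det_def
  by (intro analytic_vec_on_sum analytic_vec_on_mult analytic_vec_on_const analytic_vec_on_prod assms)

lemma continuous_on_analytic_vec:
  assumes "analytic_vec_on S f"
  shows "continuous_on S f"
proof (rule continuous_at_imp_continuous_on, rule ballI)
  fix a assume "a \<in> S"
  then obtain U F where U: "open U" "complex_vec a \<in> U" "line_holomorphic U F"
     "\<And>x. complex_vec x \<in> U \<Longrightarrow> F (complex_vec x) = of_real (f x)"
    using assms unfolding analytic_vec_on_def by metis
  let ?V = "{x. complex_vec x \<in> U}"
  have "continuous_on U F"
    using U(3) unfolding line_holomorphic_def by blast
  then have "continuous_on ?V (\<lambda>x. F (complex_vec x))"
    by (rule continuous_on_compose2) (auto intro: continuous_on_complex_vec continuous_on_id)
  then have "continuous_on ?V (\<lambda>x. Re (F (complex_vec x)))"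
    by (rule continuous_on_Re)
  then have "continuous_on ?V f"
    by (rule continuous_on_eq) (simp add: U(4))
  then show "isCont f a"
    using U(1,2) open_complex_vec_preimage continuous_on_eq_continuous_at by blast
qed

text \<open>Along a real direction the extension takes real values at real parameters, so its
  derivative has imaginary part 0. Hence the complex directional derivative extends the real one,
  and analyticity passes to derivatives.\<close>

lemma line_holomorphic_real_dir_deriv:
  assumes U: "open U" "line_holomorphic U F"
    and eq: "\<And>x. complex_vec x \<in> U \<Longrightarrow> F (complex_vec x) = of_real (f x)"
    and x: "complex_vec x \<in> U"
  shows "((\<lambda>t. f (x + t *\<^sub>R v)) has_real_derivative dir_deriv v f x) (at 0)"
    and "complex_dir_deriv (complex_vec v) F (complex_vec x) = of_real (dir_deriv v f x)"
proof -
  let ?D = "complex_dir_deriv (complex_vec v) F (complex_vec x)"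
  have "((\<lambda>w. F (complex_vec x + w *s complex_vec v)) has_field_derivative ?D) (at (of_real 0))"
    using line_holomorphic_has_field_derivative[OF U(2), of "complex_vec x" 0 "complex_vec v"] x
    by simp
  then have "((\<lambda>t. F (complex_vec x + of_real t *s complex_vec v)) has_vector_derivative ?D) (at 0)"
    by (rule has_vector_derivative_real_field)
  moreover have "\<forall>\<^sub>F t in nhds 0. complex_vec (x + t *\<^sub>R v) \<in> U"
  proof -
    have "open ((\<lambda>t. complex_vec (x + t *\<^sub>R v)) -` U)"
      by (intro open_vimage U continuous_intros)
    then have "\<forall>\<^sub>F t in nhds 0. t \<in> (\<lambda>t. complex_vec (x + t *\<^sub>R v)) -` U"
      by (rule eventually_nhds_in_open) (use x in auto)
    then show ?thesis by simp
  qed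
  then have "\<forall>\<^sub>F t in nhds 0. F (complex_vec x + of_real t *s complex_vec v) = of_real (f (x + t *\<^sub>R v))"
    by eventually_elim (metis complex_vec_add complex_vec_scaleR eq)
  ultimately have *: "((\<lambda>t. of_real (f (x + t *\<^sub>R v))) has_vector_derivative ?D) (at 0)"
    by (subst (asm) has_vector_derivative_cong_ev) (auto dest: eventually_nhds_x_imp_x)
  have re: "((\<lambda>t. f (x + t *\<^sub>R v)) has_vector_derivative Re ?D) (at 0)"
    using bounded_linear.has_vector_derivative[OF bounded_linear_Re *] by simp
  have "((\<lambda>t::real. 0::real) has_vector_derivative Im ?D) (at 0)"
    using bounded_linear.has_vector_derivative[OF bounded_linear_Im *] by simp
  then have im: "Im ?D = 0"
    using has_vector_derivative_const vector_derivative_unique_at by blast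
  show 1: "((\<lambda>t. f (x + t *\<^sub>R v)) has_real_derivative dir_deriv v f x) (at 0)"
    unfolding dir_deriv_def
    using re DERIV_deriv_iff_field_differentiable field_differentiable_def
      has_real_derivative_iff_has_vector_derivative by blast
  then have "Re ?D = dir_deriv v f x"
    using re DERIV_unique has_real_derivative_iff_has_vector_derivative by blast
  then show "?D = of_real (dir_deriv v f x)"
    using im by (simp add: complex_eq_iff)
qed

lemma analytic_vec_on_dir_deriv:
  assumes "analytic_vec_on S f"
  shows "analytic_vec_on S (dir_deriv v f)"
  unfolding analytic_vec_on_def
proof
  fix a assume "a \<in> S"
  then obtain U F where U: "open U" "complex_vec a \<in> U" "line_holomorphic U F"
     "\<And>x. complex_vec x \<in> U \<Longrightarrow> F (complex_vec x) = of_real (f x)"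
    using assms unfolding analytic_vec_on_def by metis
  then show "\<exists>U F. open U \<and> complex_vec a \<in> U \<and> line_holomorphic U F \<and>
     (\<forall>x. complex_vec x \<in> U \<longrightarrow> F (complex_vec x) = of_real (dir_deriv v f x))"
    using line_holomorphic_real_dir_deriv(2)[OF U(1,3,4)] line_holomorphic_complex_dir_deriv[OF U(3,1)]
    by (intro exI[of _ U] exI[of _ "complex_dir_deriv (complex_vec v) F"]) auto
qed

lemma analytic_vec_has_real_derivative_0:
  assumes "analytic_vec_on S f" "x \<in> S"
  shows "((\<lambda>t. f (x + t *\<^sub>R v)) has_real_derivative dir_deriv v f x) (at 0)"
  using assms line_holomorphic_real_dir_deriv(1) unfolding analytic_vec_on_def by metis

lemma analytic_vec_has_real_derivative:
  assumes "analytic_vec_on S f" "x + s *\<^sub>R v \<in> S"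
  shows "((\<lambda>t. f (x + t *\<^sub>R v)) has_real_derivative dir_deriv v f (x + s *\<^sub>R v)) (at s)"
proof -
  have "((\<lambda>t. f (x + (t + s) *\<^sub>R v)) has_real_derivative dir_deriv v f (x + s *\<^sub>R v)) (at 0)"
    using analytic_vec_has_real_derivative_0[OF assms, of v] by (simp add: algebra_simps)
  then show ?thesis
    using DERIV_shift[of "\<lambda>t. f (x + t *\<^sub>R v)" _ 0 s] by simp
qed

section \<open>Gradients and the total derivative\<close>

definition grad :: "(real^'i \<Rightarrow> real) \<Rightarrow> real^'i \<Rightarrow> real^'i" where
  "grad f x = (\<chi> i. dir_deriv (axis i 1) f x)"

text \<open>Change one coordinate at a time and apply the mean value theorem to each change.\<close>

lemma analytic_vec_has_derivative:
  fixes f :: "real^'i \<Rightarrow> real"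
  assumes f: "analytic_vec_on S f" and S: "open S" "x \<in> S"
  shows "(f has_derivative (\<lambda>u. grad f x \<bullet> u)) (at x)"
proof (rule has_derivativeI)
  show "bounded_linear ((\<bullet>) (grad f x))"
    by (rule bounded_linear_inner_right)
next
  have key: "\<exists>d>0. \<forall>u. norm u < d \<longrightarrow>
      \<bar>f (x + (\<chi> i. if i \<in> J then u $ i else 0)) - f x - (\<Sum>j\<in>J. grad f x $ j * u $ j)\<bar>
        \<le> real (card J) * (e * norm u)" if e: "e > 0" and J: "finite J" for e and J :: "'i set"
    using J
  proof (induction J)
    case empty
    have "(\<chi> i. 0) = (0 :: real^'i)" by (simp add: vec_eq_iff)
    then show ?case by (auto intro: exI[of _ 1])
  next
    case (insert k J)
    then obtain d1 where d1: "d1 > 0" and h1: "\<And>u. norm u < d1 \<Longrightarrow>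
      \<bar>f (x + (\<chi> i. if i \<in> J then u $ i else 0)) - f x - (\<Sum>j\<in>J. grad f x $ j * u $ j)\<bar>
        \<le> real (card J) * (e * norm u)" by blast
    have "continuous_on S (dir_deriv (axis k 1) f)"
      using f analytic_vec_on_dir_deriv continuous_on_analytic_vec by blast
    then have "continuous (at x) (dir_deriv (axis k 1) f)"
      using S continuous_on_eq_continuous_at by blast
    then obtain d2 where d2: "d2 > 0" "\<And>y. dist y x < d2 \<Longrightarrow>
        \<bar>dir_deriv (axis k 1) f y - dir_deriv (axis k 1) f x\<bar> < e"
      using e unfolding continuous_at_eps_delta dist_real_def by blast
    obtain d3 where d3: "d3 > 0" "ball x d3 \<subseteq> S"
      using S open_contains_ball by blast
    show ?case
    proof (intro exI[of _ "min d1 (min d2 d3)"] conjI allI impI)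
      show "0 < min d1 (min d2 d3)" using d1 d2 d3 by simp
      fix u :: "real^'i" assume u: "norm u < min d1 (min d2 d3)"
      define uJ where "uJ = (\<chi> i. if i \<in> J then u $ i else 0)"
      have upd: "(\<chi> i. if i \<in> insert k J then u $ i else 0) = uJ + (u $ k) *\<^sub>R axis k 1"
        using insert by (auto simp: vec_eq_iff uJ_def axis_def)
      have small: "norm (uJ + s *\<^sub>R axis k 1) \<le> norm u" if "\<bar>s\<bar> \<le> \<bar>u $ k\<bar>" for s
        by (rule norm_le_componentwise_cart) (use that insert in \<open>auto simp: uJ_def axis_def\<close>)
      \<comment> \<open>Subtracting the linear term leaves a function whose derivative is at most
        \<open>e\<close>, so the mean value theorem bounds the error of this coordinate step
        directly.\<close>
      let ?\<phi> = "\<lambda>s. f ((x + uJ) + s *\<^sub>R axis k 1) - s * grad f x $ k"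
      have der: "(?\<phi> has_real_derivative
          (dir_deriv (axis k 1) f ((x + uJ) + s *\<^sub>R axis k 1) - grad f x $ k)) (at s)"
        and bd: "\<bar>dir_deriv (axis k 1) f ((x + uJ) + s *\<^sub>R axis k 1) - grad f x $ k\<bar> \<le> e"
        if "\<bar>s\<bar> \<le> \<bar>u $ k\<bar>" for s
      proof -
        have n: "norm (uJ + s *\<^sub>R axis k 1) < min d1 (min d2 d3)"
          using small[OF that] u by linarith
        then have "(x + uJ) + s *\<^sub>R axis k 1 \<in> S"
          using d3 by (auto simp: subset_iff dist_norm norm_minus_commute add.assoc)
        from analytic_vec_has_real_derivative[OF f this]
        show "(?\<phi> has_real_derivative
          (dir_deriv (axis k 1) f ((x + uJ) + s *\<^sub>R axis k 1) - grad f x $ k)) (at s)"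
          by (auto intro!: derivative_eq_intros)
        show "\<bar>dir_deriv (axis k 1) f ((x + uJ) + s *\<^sub>R axis k 1) - grad f x $ k\<bar> \<le> e"
          using d2(2)[of "(x + uJ) + s *\<^sub>R axis k 1"] n
          by (simp add: grad_def dist_norm add.assoc less_imp_le)
      qed
      have "\<bar>?\<phi> (u $ k) - ?\<phi> 0\<bar> \<le> e * \<bar>u $ k\<bar>"
      proof -
        have "norm (?\<phi> (u $ k) - ?\<phi> 0) \<le> e * norm (u $ k - 0)"
          by (rule field_differentiable_bound[of "{- \<bar>u $ k\<bar>..\<bar>u $ k\<bar>}" ?\<phi>
                "\<lambda>s. dir_deriv (axis k 1) f ((x + uJ) + s *\<^sub>R axis k 1) - grad f x $ k"])
            (use der bd in \<open>auto intro: has_field_derivative_at_within\<close>)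
        then show ?thesis by simp
      qed
      also have "\<dots> \<le> e * norm u"
        using e component_le_norm_cart by (simp add: mult_left_mono)
      finally have 2: "\<bar>f (x + uJ + (u $ k) *\<^sub>R axis k 1) - f (x + uJ) - grad f x $ k * u $ k\<bar> \<le> e * norm u"
        by (simp add: algebra_simps)
      have "\<bar>f (x + uJ) - f x - (\<Sum>j\<in>J. grad f x $ j * u $ j)\<bar> \<le> real (card J) * (e * norm u)"
        using h1[of u] u unfolding uJ_def by simp
      then show "\<bar>f (x + (\<chi> i. if i \<in> insert k J then u $ i else 0)) - f x
          - (\<Sum>j\<in>insert k J. grad f x $ j * u $ j)\<bar> \<le> real (card (insert k J)) * (e * norm u)"
        unfolding upd using 2 insert by (simp add: algebra_simps)
    qed
  qed
  have key': "\<exists>d>0. \<forall>u. norm u < d \<longrightarrow> norm (f (x + u) - f x - grad f x \<bullet> u) \<le> e * norm u"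
    if e: "e > 0" for e
  proof -
    have ch: "(\<chi> i. u $ i) = u" for u :: "real^'i" by simp
    obtain d where "d > 0" and d: "\<forall>u. norm u < d \<longrightarrow>
      \<bar>f (x + u) - f x - (\<Sum>j\<in>UNIV. grad f x $ j * u $ j)\<bar> \<le> real CARD('i) * ((e / CARD('i)) * norm u)"
      using key[of "e / CARD('i)" UNIV] e by (auto simp: ch)
    then show ?thesis
      by (intro exI[of _ d]) (auto simp: inner_vec_def)
  qed
  show "(\<lambda>y. ((f y - f x) - grad f x \<bullet> (y - x)) /\<^sub>R norm (y - x)) \<midarrow>x\<rightarrow> 0"
  proof (rule LIM_I)
    fix r :: real assume "r > 0"
    then obtain d where d: "d > 0" "\<And>u. norm u < d \<Longrightarrow> norm (f (x + u) - f x - grad f x \<bullet> u) \<le> r/2 * norm u"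
      using key'[of "r/2"] by auto
    show "\<exists>s>0. \<forall>y. y \<noteq> x \<and> norm (y - x) < s \<longrightarrow>
       norm (((f y - f x) - grad f x \<bullet> (y - x)) /\<^sub>R norm (y - x) - 0) < r"
    proof (intro exI[of _ d] conjI allI impI d(1))
      fix y assume y: "y \<noteq> x \<and> norm (y - x) < d"
      have "norm (f y - f x - grad f x \<bullet> (y - x)) \<le> r/2 * norm (y - x)"
        using d(2)[of "y - x"] y by simp
      also have "\<dots> < r * norm (y - x)"
        using y \<open>r > 0\<close> by simp
      finally show "norm (((f y - f x) - grad f x \<bullet> (y - x)) /\<^sub>R norm (y - x) - 0) < r"
        using y by (simp add: divide_simps mult.commute)
    qed
  qed
qed

lemma dir_deriv_eq_grad:
  assumes f: "analytic_vec_on S f" and S: "open S" "x \<in> S"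
  shows "dir_deriv v f x = grad f x \<bullet> v"
proof -
  have "((\<lambda>t. f (x + t *\<^sub>R v)) has_derivative (\<lambda>t. grad f x \<bullet> (t *\<^sub>R v))) (at 0)"
  proof (rule has_derivative_compose[of "\<lambda>t. x + t *\<^sub>R v" "\<lambda>t. t *\<^sub>R v" 0 UNIV f])
    show "((\<lambda>t. x + t *\<^sub>R v) has_derivative (\<lambda>t. t *\<^sub>R v)) (at 0)"
      by (auto intro!: derivative_eq_intros)
  qed (use analytic_vec_has_derivative[OF assms] in simp)
  then have "((\<lambda>t. f (x + t *\<^sub>R v)) has_real_derivative (grad f x \<bullet> v)) (at 0)"
    by (simp add: has_field_derivative_def mult.commute[of _ "grad f x \<bullet> v"])
  then show ?thesis
    using analytic_vec_has_real_derivative_0[OF f S(2)] DERIV_unique by blast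
qed

lemma grad_coordinate: "grad (\<lambda>x. x $ i) x \<bullet> u = u $ i"
proof -
  have "((\<lambda>x. x $ i) has_derivative (\<lambda>u. u $ i)) (at x)"
    by (rule bounded_linear_imp_has_derivative[OF bounded_linear_vec_nth])
  then have "(\<lambda>u. grad (\<lambda>x. x $ i) x \<bullet> u) = (\<lambda>u. u $ i)"
    using analytic_vec_has_derivative[OF analytic_vec_on_nth[of UNIV]] has_derivative_unique by blast
  then show ?thesis by metis
qed

lemma analytic_vec_on_grad_nth:
  "analytic_vec_on S f \<Longrightarrow> analytic_vec_on S (\<lambda>x. grad f x $ i)"
  by (simp add: grad_def analytic_vec_on_dir_deriv)

section \<open>The identity theorem along a real line\<close>

lemma analytic_vec_line_extension:
  assumes f: "analytic_vec_on S f" and x: "x + t *\<^sub>R v \<in> S"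
  obtains r H where "r > 0" "H holomorphic_on ball (of_real t) r"
    "\<And>s. \<bar>s - t\<bar> < r \<Longrightarrow> H (of_real s) = of_real (f (x + s *\<^sub>R v))"
proof -
  obtain U F where U: "open U" "complex_vec (x + t *\<^sub>R v) \<in> U" "line_holomorphic U F"
     "\<And>x. complex_vec x \<in> U \<Longrightarrow> F (complex_vec x) = of_real (f x)"
    using assms unfolding analytic_vec_on_def by metis
  let ?D = "{w. complex_vec x + w *s complex_vec v \<in> U}"
  have "open ?D" "of_real t \<in> ?D"
    using U(1,2) by (simp_all add: open_line_preimage)
  then obtain r where r: "r > 0" "ball (of_real t) r \<subseteq> ?D"
    by (meson open_contains_ball)
  show thesis
  proof (rule that[OF r(1)])
    show "(\<lambda>w. F (complex_vec x + w *s complex_vec v)) holomorphic_on ball (of_real t) r"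
      by (rule line_holomorphic_imp_holomorphic[OF U(3)]) (use r in auto)
    show "F (complex_vec x + of_real s *s complex_vec v) = of_real (f (x + s *\<^sub>R v))"
      if "\<bar>s - t\<bar> < r" for s
    proof -
      have "of_real s \<in> ball (of_real t :: complex) r"
        using that by (simp add: dist_real_def abs_minus_commute flip: of_real_diff)
      then have "complex_vec (x + s *\<^sub>R v) \<in> U"
        using r(2) unfolding complex_vec_add complex_vec_scaleR by blast
      from U(4)[OF this] show ?thesis by simp
    qed
  qed
qed

lemma holomorphic_zero_if_zero_on_reals:
  assumes H: "H holomorphic_on ball (of_real t) r" and s: "\<bar>s - t\<bar> < r" and e: "e > 0"
    and z: "\<And>s'. \<bar>s' - s\<bar> < e \<Longrightarrow> H (of_real s') = 0"
    and w: "w \<in> ball (of_real t) r"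
  shows "H w = 0"
proof -
  have sb: "of_real s' \<in> ball (of_real t :: complex) r \<longleftrightarrow> \<bar>s' - t\<bar> < r" for s'
    by (simp add: dist_real_def abs_minus_commute flip: of_real_diff)
  define e' where "e' = min e (r - \<bar>s - t\<bar>)"
  have e': "e' > 0" using e s by (simp add: e'_def)
  let ?U = "of_real ` {s'. \<bar>s' - s\<bar> < e'} :: complex set"
  have "of_real s islimpt ?U"
    unfolding islimpt_approachable
  proof (intro allI impI)
    fix d :: real assume "d > 0"
    then show "\<exists>x'\<in>?U. x' \<noteq> of_real s \<and> dist x' (of_real s) < d"
      using e' by (intro bexI[of _ "of_real (s + min d e' / 2)"] imageI)
        (auto simp: min_def dist_norm)
  qed
  moreover have "?U \<subseteq> ball (of_real t) r"
    using sb by (auto simp: e'_def)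
  ultimately show ?thesis
    using analytic_continuation[OF H _ _ _ _ _ _ w, of ?U "of_real s"] sb s z
    by (auto simp: e'_def)
qed

text \<open>Connected induction over \<open>{0..1}\<close>. The property carried along is vanishing
  near a parameter, since zeros on an interval accumulate and so spread over the disc of a local
  extension. Only the segment has to lie in \<open>S\<close>, which permits routes around a singular
  set.\<close>

lemma analytic_vec_zero_on_segment:
  assumes f: "analytic_vec_on S f" and S: "\<And>t. 0 \<le> t \<Longrightarrow> t \<le> 1 \<Longrightarrow> x + t *\<^sub>R v \<in> S"
    and e: "e > 0" and z: "\<And>t. \<bar>t\<bar> < e \<Longrightarrow> f (x + t *\<^sub>R v) = 0"
  shows "f (x + v) = 0"
proof -
  define P where "P t \<longleftrightarrow> (\<exists>e>0. \<forall>s. \<bar>s - t\<bar> < e \<longrightarrow> f (x + s *\<^sub>R v) = 0)" for t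
  have "P 1"
  proof (rule connected_induction_simple[of "{0..1::real}" 0 1 P])
    show "P 0" unfolding P_def using e z by auto
    fix t :: real assume t: "t \<in> {0..1}"
    obtain r H where r: "r > 0" "H holomorphic_on ball (of_real t) r"
        and H: "\<And>s. \<bar>s - t\<bar> < r \<Longrightarrow> H (of_real s) = of_real (f (x + s *\<^sub>R v))"
      using analytic_vec_line_extension[OF f S[of t]] t by auto
    have "P s'" if "\<bar>s - t\<bar> < r" "\<bar>s' - t\<bar> < r" "P s" for s s'
    proof -
      obtain d where d: "d > 0" "\<And>u. \<bar>u - s\<bar> < d \<Longrightarrow> f (x + u *\<^sub>R v) = 0"
        using \<open>P s\<close> unfolding P_def by blast
      have "H w = 0" if "w \<in> ball (of_real t) r" for w
        by (rule holomorphic_zero_if_zero_on_reals[OF r(2) \<open>\<bar>s - t\<bar> < r\<close> _ _ that,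
              of "min d (r - \<bar>s - t\<bar>)"])
           (use d H \<open>\<bar>s - t\<bar> < r\<close> in auto)
      then have "f (x + u *\<^sub>R v) = 0" if "\<bar>u - t\<bar> < r" for u
        using H[OF that] that
        by (simp add: dist_real_def abs_minus_commute flip: of_real_diff)
      then show "P s'" unfolding P_def
        using that(2) by (intro exI[of _ "r - \<bar>s' - t\<bar>"]) auto
    qed
    then show "\<exists>T. openin (top_of_set {0..1}) T \<and> t \<in> T \<and> (\<forall>x\<in>T. \<forall>y\<in>T. P x \<longrightarrow> P y)"
      using t r(1)
      by (intro exI[of _ "{0..1} \<inter> ball t r"]) (auto simp: dist_real_def abs_minus_commute)
  qed auto
  then show ?thesis
    unfolding P_def by (metis abs_zero diff_self scaleR_one)
qed

text \<open>On the real line the derivatives of the one-variable extension are the iterated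
  directional derivatives. If all of them were 0 at \<open>x\<close>, the Taylor series would
  vanish, and with it \<open>f\<close> along the segment.\<close>

lemma analytic_vec_finite_order:
  assumes f: "analytic_vec_on S f" and S: "\<And>t. 0 \<le> t \<Longrightarrow> t \<le> 1 \<Longrightarrow> x + t *\<^sub>R v \<in> S"
    and "open S" and nz: "f (x + v) \<noteq> 0"
  shows "\<exists>k. (dir_deriv v ^^ k) f x \<noteq> 0"
proof (rule ccontr)
  assume "\<not> ?thesis"
  then have all0: "(dir_deriv v ^^ k) f x = 0" for k by blast
  have "x \<in> S" using S[of 0] by simp
  then obtain r0 H where r0: "r0 > 0" "H holomorphic_on ball (of_real 0) r0"
      and H0: "\<And>s. \<bar>s - 0\<bar> < r0 \<Longrightarrow> H (of_real s) = of_real (f (x + s *\<^sub>R v))"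
    using analytic_vec_line_extension[OF f, of x 0 v] by auto
  have "open ((\<lambda>s. x + s *\<^sub>R v) -` S)"
    by (intro open_vimage \<open>open S\<close> continuous_intros)
  moreover have "0 \<in> (\<lambda>s. x + s *\<^sub>R v) -` S" using \<open>x \<in> S\<close> by simp
  ultimately obtain r1 where r1: "r1 > 0" "ball 0 r1 \<subseteq> (\<lambda>s. x + s *\<^sub>R v) -` S"
    by (meson open_contains_ball)
  define r where "r = min r0 r1"
  have r: "r > 0" "H holomorphic_on ball 0 r"
    using r0 r1 by (auto simp: r_def intro: holomorphic_on_subset)
  have H: "H (of_real s) = of_real (f (x + s *\<^sub>R v))" "x + s *\<^sub>R v \<in> S" if "\<bar>s\<bar> < r" for s
    using H0[of s] r1 that by (auto simp: r_def subset_iff)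
  have an: "analytic_vec_on S ((dir_deriv v ^^ k) f)" for k
    by (induction k) (auto simp: f analytic_vec_on_dir_deriv)
  have hd: "(deriv ^^ k) H (of_real s) = of_real ((dir_deriv v ^^ k) f (x + s *\<^sub>R v))"
    if "\<bar>s\<bar> < r" for k s
    using that
  proof (induction k arbitrary: s)
    case 0 then show ?case by (simp add: H)
  next
    case (Suc k)
    let ?G = "(deriv ^^ k) H" and ?g = "(dir_deriv v ^^ k) f"
    have "?G holomorphic_on ball 0 r"
      using r holomorphic_higher_deriv by blast
    then have "(?G has_field_derivative deriv ?G (of_real s)) (at (of_real s))"
      using Suc.prems by (intro holomorphic_derivI[of _ "ball 0 r"]) auto
    then have "((\<lambda>t. ?G (of_real t)) has_vector_derivative deriv ?G (of_real s)) (at s)"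
      by (rule has_vector_derivative_real_field)
    moreover have "\<forall>\<^sub>F t in nhds s. ?G (of_real t) = of_real (?g (x + t *\<^sub>R v))"
    proof (rule eventually_mono)
      show "\<forall>\<^sub>F t in nhds s. t \<in> ball 0 r"
        using Suc.prems by (intro eventually_nhds_in_open) auto
    qed (use Suc.IH in auto)
    ultimately have 1: "((\<lambda>t. complex_of_real (?g (x + t *\<^sub>R v))) has_vector_derivative deriv ?G (of_real s)) (at s)"
      by (subst (asm) has_vector_derivative_cong_ev) (auto dest: eventually_nhds_x_imp_x)
    have "((\<lambda>t. ?g (x + t *\<^sub>R v)) has_vector_derivative dir_deriv v ?g (x + s *\<^sub>R v)) (at s)"
      using analytic_vec_has_real_derivative[OF an[of k] H(2)[OF Suc.prems]]
      by (simp add: has_real_derivative_iff_has_vector_derivative)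
    then have "((\<lambda>t. complex_of_real (?g (x + t *\<^sub>R v))) has_vector_derivative
        of_real (dir_deriv v ?g (x + s *\<^sub>R v))) (at s)"
      using bounded_linear.has_vector_derivative[OF bounded_linear_of_real] by blast
    then show ?case
      using vector_derivative_unique_at[OF 1] by simp
  qed
  have "H w = 0" if "w \<in> ball 0 r" for w
    by (rule holomorphic_fun_eq_0_on_ball[OF r(2) that]) (use hd[of 0] r all0 in simp)
  then have "f (x + t *\<^sub>R v) = 0" if "\<bar>t\<bar> < r" for t
    using H(1)[OF that] that by simp
  then show False
    using analytic_vec_zero_on_segment[OF f S r(1)] nz by blast
qed

section \<open>Flows of Lipschitz vector fields\<close>

text \<open>The oriented integral from 0 to \<open>t\<close>; the interval \<open>{0..t}\<close> is
  empty for negative \<open>t\<close>, hence the case distinction.\<close>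

definition integral_from_0 :: "(real \<Rightarrow> 'a::euclidean_space) \<Rightarrow> real \<Rightarrow> 'a" where
  "integral_from_0 f t = (if 0 \<le> t then integral {0..t} f else - integral {t..0} f)"

lemma integral_from_0_has_vector_derivative:
  assumes f: "continuous_on UNIV f"
  shows "(integral_from_0 f has_vector_derivative f t) (at t)"
proof -
  \<comment> \<open>\<open>- R\<close> lies to the left of both 0 and \<open>t\<close>, so near
    \<open>t\<close> the oriented integral differs by a constant from an integral with a fixed left
    end.\<close>
  define R where "R = \<bar>t\<bar> + 1"
  have fi: "f integrable_on {a..b}" for a b
    using f by (intro integrable_continuous_interval) (auto intro: continuous_on_subset)
  have eq: "integral {-R..s} f - integral {-R..0} f = integral_from_0 f s" if "s \<in> {-R<..<R}" for s
    using that Henstock_Kurzweil_Integration.integral_combine[of "-R" 0 s f]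
      Henstock_Kurzweil_Integration.integral_combine[of "-R" s 0 f] fi
    by (auto simp: integral_from_0_def R_def algebra_simps split: if_splits)
  have "((\<lambda>s. integral {-R..s} f) has_vector_derivative f t) (at t within {-R..R})"
    by (rule integral_has_vector_derivative)
       (use f in \<open>auto intro: continuous_on_subset simp: R_def\<close>)
  then have "((\<lambda>s. integral {-R..s} f) has_vector_derivative f t) (at t)"
    by (subst (asm) at_within_interior) (auto simp: R_def)
  then have "((\<lambda>s. integral {-R..s} f - integral {-R..0} f) has_vector_derivative f t) (at t)"
    by (auto intro!: derivative_eq_intros)
  then show ?thesis
    by (rule has_vector_derivative_transform_within_open[of _ _ _ "{-R<..<R}"])
       (use eq in \<open>auto simp: R_def\<close>)
qed

text \<open>A mean value inequality with majorant \<phi>, in both time directions; negative times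
  are reduced to positive ones by reflection. It is applied with a linear and with an exponential
  majorant.\<close>

lemma norm_le_of_derivative_from_0:
  fixes G :: "real \<Rightarrow> 'a::euclidean_space"
  assumes G0: "G 0 = 0" and G: "\<And>s. (G has_vector_derivative g s) (at s)"
    and \<phi>: "\<And>s. (\<phi> has_real_derivative \<phi>' s) (at s)"
    and bd: "\<And>s. norm (g s) \<le> \<phi>' \<bar>s\<bar>"
  shows "norm (G t) \<le> \<phi> \<bar>t\<bar> - \<phi> 0"
proof -
  have pos: "norm (H t) \<le> \<phi> t - \<phi> 0"
    if H0: "H 0 = 0" and H: "\<And>s. (H has_vector_derivative h s) (at s)"
      and bd: "\<And>s. s \<ge> 0 \<Longrightarrow> norm (h s) \<le> \<phi>' s" and t: "t \<ge> 0" for H h and t :: real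
  proof (cases "t = 0")
    case False
    have cH: "continuous_on A H" for A
      using H has_vector_derivative_continuous continuous_at_imp_continuous_on by metis
    have c\<phi>: "continuous_on A \<phi>" for A
      using \<phi> DERIV_isCont continuous_at_imp_continuous_on by metis
    have "norm (H t - H 0) \<le> \<phi> t - \<phi> 0"
      by (rule differentiable_bound_general[where f' = h and \<phi>' = \<phi>'])
         (use False t H \<phi> bd cH c\<phi> in \<open>auto simp: has_real_derivative_iff_has_vector_derivative[symmetric]\<close>)
    then show ?thesis using H0 by simp
  qed (use H0 in simp)
  show ?thesis
  proof (cases "t \<ge> 0")
    case True
    then show ?thesis using pos[of G g t] G0 G bd by (metis abs_of_nonneg)
  next
    case False
    have "((\<lambda>s. G (- s)) has_vector_derivative - g (- s)) (at s)" for s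
    proof -
      have "(uminus has_vector_derivative (-1)) (at s)"
        unfolding has_real_derivative_iff_has_vector_derivative[symmetric]
        by (auto intro!: derivative_eq_intros)
      from vector_diff_chain_at[OF this, of G "g (-s)"] G
      show ?thesis by (simp add: o_def)
    qed
    moreover have "norm (- g (- s)) \<le> \<phi>' s" if "s \<ge> 0" for s
      using bd[of "-s"] that by simp
    ultimately have "norm (G (- (- t))) \<le> \<phi> (-t) - \<phi> 0"
      using pos[of "\<lambda>s. G (- s)" "\<lambda>s. - g (- s)" "-t"] G0 False by simp
    then show ?thesis using False by simp
  qed
qed

text \<open>The Picard operator is a contraction for the sup norm weighted by \<open>exp (- 2 L \<bar>t\<bar>)\<close>,
  which gives a solution on the whole line at once.\<close>

lemma lipschitz_ode_global_solution:
  fixes W :: "'a::euclidean_space \<Rightarrow> 'a"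
  assumes lip: "\<And>x y. norm (W x - W y) \<le> L * norm (x - y)" and L: "L > 0"
    and bdd: "\<And>x. norm (W x) \<le> M"
  shows "\<exists>\<gamma>. \<gamma> 0 = p \<and> (\<forall>t. (\<gamma> has_vector_derivative W (\<gamma> t)) (at t))"
proof -
  have cW: "continuous_on UNIV W"
    by (rule lipschitz_on_continuous_on[of L]) (use lip L in \<open>auto simp: lipschitz_on_def dist_norm\<close>)
  have M: "M \<ge> 0" using bdd[of 0] norm_ge_zero order_trans by blast
  \<comment> \<open>The unknown is \<open>v t = exp (- 2 L \<bar>t\<bar>) (\<gamma> t - p)\<close>
    for the sought solution \<gamma>. It is bounded because \<open>W\<close> is, so it belongs to
    the Banach space of bounded continuous functions.\<close>
  define f where "f v s = W (p + exp (2 * L * \<bar>s\<bar>) *\<^sub>R apply_bcontfun v s)"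
    for v :: "real \<Rightarrow>\<^sub>C 'a" and s
  define \<Phi> where "\<Phi> v t = exp (- (2 * L * \<bar>t\<bar>)) *\<^sub>R integral_from_0 (f v) t" for v t
  have cf: "continuous_on UNIV (f v)" for v
    unfolding f_def by (rule continuous_on_compose2[OF cW]) (auto intro!: continuous_intros)
  note J = integral_from_0_has_vector_derivative[OF cf]
  have J0: "integral_from_0 h 0 = 0" for h :: "real \<Rightarrow> 'a"
    by (simp add: integral_from_0_def)
  have cont: "continuous_on UNIV (\<Phi> v)" for v
  proof -
    have "continuous_on UNIV (integral_from_0 (f v))"
      using J[of v] has_vector_derivative_continuous continuous_at_imp_continuous_on by blast
    then show ?thesis unfolding \<Phi>_def by (intro continuous_intros)
  qed
  have fM: "norm (f v s) \<le> M" for v s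
    using bdd by (simp add: f_def)
  have bound: "norm (\<Phi> v t) \<le> M / (2 * L)" for v t
  proof -
    have "norm (integral_from_0 (f v) t) \<le> M * \<bar>t\<bar> - M * 0"
      by (rule norm_le_of_derivative_from_0[where g = "f v" and \<phi>' = "\<lambda>_. M"])
         (use J0 J in \<open>auto simp: fM intro!: derivative_eq_intros\<close>)
    moreover have "2 * L * \<bar>t\<bar> \<le> exp (2 * L * \<bar>t\<bar>)"
      using exp_ge_add_one_self[of "2 * L * \<bar>t\<bar>"] by linarith
    then have "M / (2 * L) * (2 * L * \<bar>t\<bar>) \<le> M / (2 * L) * exp (2 * L * \<bar>t\<bar>)"
      using L M by (intro mult_left_mono) auto
    then have "M * \<bar>t\<bar> \<le> M / (2 * L) * exp (2 * L * \<bar>t\<bar>)"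
      using L by simp
    ultimately have "norm (integral_from_0 (f v) t) \<le> M / (2 * L) * exp (2 * L * \<bar>t\<bar>)"
      by simp
    then show ?thesis
      by (simp add: \<Phi>_def exp_minus field_simps)
  qed
  have in_bc: "\<Phi> v \<in> bcontfun" for v
    using cont bound by (rule bcontfun_normI)
  have "\<exists>!v. Bcontfun (\<Phi> v) = v"
  proof (rule banach_fix_type[of "1/2"]; (intro allI)?)
    fix v w :: "real \<Rightarrow>\<^sub>C 'a"
    show "dist (Bcontfun (\<Phi> v)) (Bcontfun (\<Phi> w)) \<le> 1/2 * dist v w"
    proof (rule dist_bound)
      fix t
      define d where "d = dist v w"
      have d: "norm (apply_bcontfun v s - apply_bcontfun w s) \<le> d" for s
        unfolding d_def using dist_bounded[of v s w] by (simp add: dist_norm)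
      have d0: "d \<ge> 0" by (simp add: d_def)
      \<comment> \<open>Integrating this bound from 0 to \<open>t\<close> gives at most
        \<open>d / 2 * exp (2 * L * \<bar>t\<bar>)\<close>: the 2 in the exponent is the origin of
        the contraction factor 1/2.\<close>
      have fd: "norm (f v s - f w s) \<le> L * d * exp (2 * L * \<bar>s\<bar>)" for s
      proof -
        have "norm (f v s - f w s) \<le> L * norm (exp (2 * L * \<bar>s\<bar>) *\<^sub>R (apply_bcontfun v s - apply_bcontfun w s))"
          unfolding f_def using lip by (metis add_diff_cancel_left scaleR_diff_right)
        also have "\<dots> \<le> L * (exp (2 * L * \<bar>s\<bar>) * d)"
          using L d[of s] by simp
        finally show ?thesis by (simp add: mult_ac)
      qed
      have "norm (integral_from_0 (f v) t - integral_from_0 (f w) t)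
          \<le> d / 2 * exp (2 * L * \<bar>t\<bar>) - d / 2 * exp (2 * L * 0)"
      proof (rule norm_le_of_derivative_from_0[where g = "\<lambda>s. f v s - f w s"
            and \<phi>' = "\<lambda>s. L * d * exp (2 * L * s)" and \<phi> = "\<lambda>s. d / 2 * exp (2 * L * s)"])
        show "((\<lambda>s. d / 2 * exp (2 * L * s)) has_real_derivative L * d * exp (2 * L * s)) (at s)" for s
          by (auto intro!: derivative_eq_intros)
      qed (use J J0 fd in \<open>auto intro!: derivative_intros\<close>)
      also have "\<dots> \<le> d / 2 * exp (2 * L * \<bar>t\<bar>)" using d0 by simp
      finally have "norm (exp (- (2 * L * \<bar>t\<bar>)) *\<^sub>R (integral_from_0 (f v) t - integral_from_0 (f w) t)) \<le> d / 2"
        by (subst norm_scaleR) (simp add: exp_minus field_simps)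
      then show "dist (apply_bcontfun (Bcontfun (\<Phi> v)) t) (apply_bcontfun (Bcontfun (\<Phi> w)) t) \<le> 1/2 * dist v w"
        by (simp add: Bcontfun_inverse in_bc dist_norm \<Phi>_def d_def scaleR_diff_right)
    qed
  qed auto
  then obtain v where v: "Bcontfun (\<Phi> v) = v" by blast
  then have v': "apply_bcontfun v t = exp (- (2 * L * \<bar>t\<bar>)) *\<^sub>R integral_from_0 (f v) t" for t
    by (metis Bcontfun_inverse in_bc \<Phi>_def)
  define \<gamma> where "\<gamma> t = p + integral_from_0 (f v) t" for t
  have "\<gamma> t = p + exp (2 * L * \<bar>t\<bar>) *\<^sub>R apply_bcontfun v t" for t
    by (simp add: \<gamma>_def v' flip: exp_add)
  then have "f v t = W (\<gamma> t)" for t by (simp add: f_def)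
  then have "(\<gamma> has_vector_derivative W (\<gamma> t)) (at t)" for t
    using J[of v t] unfolding \<gamma>_def by (auto intro!: derivative_eq_intros)
  then show ?thesis
    by (intro exI[of _ \<gamma>]) (simp add: \<gamma>_def J0)
qed

text \<open>Gronwall's argument: the squared distance of the two solutions, weighted by
  \<open>exp (- 2 L s)\<close>, does not increase.\<close>

lemma lipschitz_ode_unique_forward:
  fixes W :: "'a::euclidean_space \<Rightarrow> 'a"
  assumes lip: "\<And>s. norm (W (\<gamma> s) - W (\<eta> s)) \<le> L * norm (\<gamma> s - \<eta> s)"
    and \<gamma>: "\<And>t. (\<gamma> has_vector_derivative W (\<gamma> t)) (at t)"
    and \<eta>: "\<And>t. (\<eta> has_vector_derivative W (\<eta> t)) (at t)"
    and eq: "\<gamma> a = \<eta> a" and t: "a \<le> t"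
  shows "\<gamma> t = \<eta> t"
proof -
  define d where "d s = \<gamma> s - \<eta> s" for s
  have d: "(d has_vector_derivative (W (\<gamma> s) - W (\<eta> s))) (at s)" for s
    unfolding d_def by (intro derivative_intros \<gamma> \<eta>)
  define h where "h s = exp (- (2 * L * s)) * (d s \<bullet> d s)" for s
  have h': "(h has_real_derivative exp (- (2 * L * s)) *
      (2 * (d s \<bullet> (W (\<gamma> s) - W (\<eta> s))) - 2 * L * (d s \<bullet> d s))) (at s)" for s
  proof -
    have "((\<lambda>s. d s \<bullet> d s) has_real_derivative 2 * (d s \<bullet> (W (\<gamma> s) - W (\<eta> s)))) (at s)"
      using has_derivative_inner[OF d[of s, unfolded has_vector_derivative_def] d[of s, unfolded has_vector_derivative_def]]
      by (auto simp: has_field_derivative_def inner_commute algebra_simps fun_eq_iff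
          elim!: has_derivative_eq_rhs)
    then show ?thesis
      unfolding h_def by (auto intro!: derivative_eq_intros simp: algebra_simps)
  qed
  have "h t \<le> h a"
  proof (rule DERIV_nonpos_imp_nonincreasing[OF t])
    fix s
    have "d s \<bullet> (W (\<gamma> s) - W (\<eta> s)) \<le> norm (d s) * (L * norm (d s))"
      using lip[of s] norm_cauchy_schwarz[of "d s" "W (\<gamma> s) - W (\<eta> s)"]
      unfolding d_def by (meson mult_left_mono norm_ge_zero order_trans)
    then have "2 * (d s \<bullet> (W (\<gamma> s) - W (\<eta> s))) - 2 * L * (d s \<bullet> d s) \<le> 0"
      by (simp add: power2_eq_square dot_square_norm mult_ac)
    then show "\<exists>y. (h has_real_derivative y) (at s) \<and> y \<le> 0"
      using h'[of s] by (metis exp_ge_zero mult_nonneg_nonpos)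
  qed
  also have "h a = 0" by (simp add: h_def d_def eq)
  finally have "d t \<bullet> d t \<le> 0" by (simp add: h_def mult_le_0_iff)
  then have "d t = 0" by (metis inner_eq_zero_iff inner_ge_zero order_antisym)
  then show ?thesis by (simp add: d_def)
qed

lemma has_vector_derivative_affine_reparam:
  assumes "\<And>t. (\<gamma> has_vector_derivative W (\<gamma> t)) (at t)"
  shows "((\<lambda>t. \<gamma> (c * t + b)) has_vector_derivative c *\<^sub>R W (\<gamma> (c * t + b))) (at t)"
proof -
  have "((\<lambda>t. c * t + b) has_vector_derivative c) (at t)"
    unfolding has_real_derivative_iff_has_vector_derivative[symmetric]
    by (auto intro!: derivative_eq_intros)
  from vector_diff_chain_at[OF this, of \<gamma>] assms show ?thesis
    by (simp add: o_def)
qed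

lemma lipschitz_ode_unique:
  fixes W :: "'a::euclidean_space \<Rightarrow> 'a"
  assumes lip: "\<And>x y. norm (W x - W y) \<le> L * norm (x - y)"
    and \<gamma>: "\<And>t. (\<gamma> has_vector_derivative W (\<gamma> t)) (at t)"
    and \<eta>: "\<And>t. (\<eta> has_vector_derivative W (\<eta> t)) (at t)"
    and eq: "\<gamma> a = \<eta> a"
  shows "\<gamma> t = \<eta> t"
proof (cases "a \<le> t")
  case True
  then show ?thesis
    using lipschitz_ode_unique_forward[of W \<gamma> \<eta> L a t] assms by blast
next
  case False
  have "(\<lambda>s. \<gamma> (-1 * s + 0)) (-t) = (\<lambda>s. \<eta> (-1 * s + 0)) (-t)"
  proof (rule lipschitz_ode_unique_forward[where W = "\<lambda>x. - W x" and a = "- a" and L = L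
        and \<gamma> = "\<lambda>s. \<gamma> (-1 * s + 0)" and \<eta> = "\<lambda>s. \<eta> (-1 * s + 0)" and t = "- t"])
    show "norm (- W (\<gamma> (-1 * s + 0)) - - W (\<eta> (-1 * s + 0))) \<le> L * norm (\<gamma> (-1 * s + 0) - \<eta> (-1 * s + 0))" for s
      using lip by (metis minus_diff_minus norm_minus_cancel)
    show "((\<lambda>s. \<gamma> (-1 * s + 0)) has_vector_derivative - W (\<gamma> (-1 * s + 0))) (at s)" for s
      using has_vector_derivative_affine_reparam[of \<gamma> W "-1" 0] \<gamma> by simp
    show "((\<lambda>s. \<eta> (-1 * s + 0)) has_vector_derivative - W (\<eta> (-1 * s + 0))) (at s)" for s
      using has_vector_derivative_affine_reparam[of \<eta> W "-1" 0] \<eta> by simp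
  qed (use eq False in auto)
  then show ?thesis by simp
qed

text \<open>\<open>W\<close> is multiplied by a tent function of the distance to \<open>K\<close>,
  supported in a compact neighbourhood on which \<open>W\<close> is Lipschitz. The result has a
  global flow. The last clause keeps it parallel to \<open>W\<close>, so it stays orthogonal to
  every gradient that \<open>W\<close> is orthogonal to.\<close>

lemma lipschitz_cutoff:
  fixes W :: "'a::euclidean_space \<Rightarrow> 'a"
  assumes \<Omega>: "open \<Omega>" and K: "compact K" "K \<noteq> {}" "K \<subseteq> \<Omega>"
    and W: "\<And>x. x \<in> \<Omega> \<Longrightarrow> (W has_derivative blinfun_apply (W' x)) (at x)"
    and W': "continuous_on \<Omega> W'"
  obtains V L M where "L > 0" "\<And>x y. norm (V x - V y) \<le> L * norm (x - y)" "\<And>x. norm (V x) \<le> M"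
    "\<And>x. x \<in> K \<Longrightarrow> V x = W x" "\<And>x. \<exists>c. V x = c *\<^sub>R W x"
proof -
  obtain r where r: "r > 0" "{x. infdist x K \<le> r} \<subseteq> \<Omega>"
    using compact_in_open_separated[OF K(2,1) \<Omega> K(3)] by blast
  define A where "A = {x. infdist x K \<le> r}"
  have A: "compact A"
    unfolding A_def by (rule compact_infdist_le[OF K(2,1) r(1)])
  have "local_lipschitz (UNIV :: real set) \<Omega> (\<lambda>t. W)"
  proof (rule c1_implies_local_lipschitz[where f' = "\<lambda>(t, x). W' x"])
    have "continuous_on (UNIV \<times> \<Omega>) (\<lambda>p. W' (snd p))"
      by (rule continuous_on_compose2[OF W']) (auto intro: continuous_intros)
    then show "continuous_on ((UNIV :: real set) \<times> \<Omega>) (\<lambda>(t, x). W' x)"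
      by (simp add: case_prod_beta)
  qed (use W \<Omega> in auto)
  then have "local_lipschitz {0 :: real} A (\<lambda>t. W)"
    by (rule local_lipschitz_subset) (use r in \<open>auto simp: A_def\<close>)
  then obtain L where L: "L-lipschitz_on A W"
    using local_lipschitz_compact_implies_lipschitz[of "{0 :: real}" A "\<lambda>t. W"] A
    by (metis compact_sing continuous_on_const singletonI)
  have L0: "L \<ge> 0" using L by (rule lipschitz_on_nonneg)
  have "continuous_on A W" using L by (rule lipschitz_on_continuous_on)
  then have "bounded (W ` A)"
    using A compact_continuous_image compact_imp_bounded by blast
  then obtain M where M: "M > 0" "\<And>x. x \<in> A \<Longrightarrow> norm (W x) \<le> M"
    by (metis bounded_pos image_eqI)
  define \<theta> where "\<theta> x = max 0 (1 - infdist x K / r)" for x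
  define V where "V x = \<theta> x *\<^sub>R W x" for x
  have \<theta>1: "0 \<le> \<theta> x" "\<theta> x \<le> 1" for x
    using r by (auto simp: \<theta>_def infdist_nonneg)
  have \<theta>0: "\<theta> x = 0" if "x \<notin> A" for x
    using that r by (auto simp: \<theta>_def A_def field_simps)
  have \<theta>L: "\<bar>\<theta> x - \<theta> y\<bar> \<le> norm (x - y) / r" for x y
  proof -
    have "\<bar>infdist x K - infdist y K\<bar> \<le> norm (x - y)"
      using infdist_triangle_abs[of x K y] by (simp add: dist_norm)
    then have "\<bar>infdist x K / r - infdist y K / r\<bar> \<le> norm (x - y) / r"
      using r by (simp add: divide_right_mono flip: diff_divide_distrib)
    then show ?thesis unfolding \<theta>_def by linarith
  qed
  \<comment> \<open>One endpoint in \<open>A\<close> suffices, as \<open>V\<close> vanishes outside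
    \<open>A\<close>. In the constant, \<open>M / r\<close> comes from the slope
    \<open>1 / r\<close> of the cutoff and \<open>L\<close> from \<open>W\<close>.\<close>
  have one: "norm (V x - V y) \<le> (M / r + L + 1) * norm (x - y)" if x: "x \<in> A" for x y
  proof (cases "y \<in> A")
    case True
    have "V x - V y = (\<theta> x - \<theta> y) *\<^sub>R W x + \<theta> y *\<^sub>R (W x - W y)"
      by (simp add: V_def algebra_simps)
    then have "norm (V x - V y) \<le> \<bar>\<theta> x - \<theta> y\<bar> * norm (W x) + \<theta> y * norm (W x - W y)"
      using norm_triangle_ineq[of "(\<theta> x - \<theta> y) *\<^sub>R W x" "\<theta> y *\<^sub>R (W x - W y)"] \<theta>1[of y] by simp
    also have "\<dots> \<le> norm (x - y) / r * M + 1 * (L * norm (x - y))"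
      using \<theta>L[of x y] \<theta>1[of y] M(2)[OF x] lipschitz_onD[OF L x True] r
      by (intro add_mono mult_mono) (auto simp: dist_norm)
    also have "\<dots> \<le> (M / r + L + 1) * norm (x - y)"
      by (simp add: algebra_simps)
    finally show ?thesis .
  next
    case False
    have "norm (V x - V y) = \<bar>\<theta> x - \<theta> y\<bar> * norm (W x)"
      using \<theta>0[OF False] by (simp add: V_def)
    also have "\<dots> \<le> norm (x - y) / r * M"
      using \<theta>L[of x y] M(2)[OF x] r by (intro mult_mono) auto
    also have "\<dots> \<le> (M / r + L + 1) * norm (x - y)"
      using L0 by (simp add: algebra_simps)
    finally show ?thesis .
  qed
  show thesis
  proof (rule that[of "M / r + L + 1" V M])
    show "M / r + L + 1 > 0" using M r L0 by (simp add: add_nonneg_pos)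
    show "norm (V x - V y) \<le> (M / r + L + 1) * norm (x - y)" for x y
    proof (cases "x \<in> A \<or> y \<in> A")
      case True then show ?thesis using one by (metis norm_minus_commute)
    next
      case False
      then show ?thesis using \<theta>0 M r L0 by (simp add: V_def)
    qed
    show "norm (V x) \<le> M" for x
    proof (cases "x \<in> A")
      case True
      then show ?thesis using \<theta>1[of x] M mult_mono[of "\<theta> x" 1 "norm (W x)" M] by (simp add: V_def)
    qed (use \<theta>0 M in \<open>simp add: V_def\<close>)
    show "V x = W x" if "x \<in> K" for x
      using that by (simp add: V_def \<theta>_def)
    show "\<exists>c. V x = c *\<^sub>R W x" for x
      by (auto simp: V_def)
  qed
qed

section \<open>Motion inside a compact fibre and periodic orbits\<close>

lemma has_vector_derivative_grad_compose:
  fixes \<gamma> :: "real \<Rightarrow> 'a::euclidean_space"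
  assumes "(g has_derivative (\<lambda>u. G \<bullet> u)) (at (\<gamma> t))" "(\<gamma> has_vector_derivative v) (at t)"
  shows "((\<lambda>t. g (\<gamma> t)) has_real_derivative G \<bullet> v) (at t)"
  using has_derivative_compose[OF assms(2)[unfolded has_vector_derivative_def] assms(1)]
  by (simp add: has_field_derivative_def mult_commute_abs)

text \<open>The functions are known to be conserved only inside \<Omega>, so the set of times spent
  in \<open>K\<close> is shown to be open and closed: open because \<open>K\<close> lies in the open
  set \<Omega>, closed because \<open>K\<close> is.\<close>

lemma flow_stays_in_fibre:
  fixes \<gamma> :: "real \<Rightarrow> 'a::euclidean_space"
  assumes \<Omega>: "open \<Omega>" "K \<subseteq> \<Omega>" "closed K" and K: "K = {x. \<forall>s\<in>S. g s x = c s}"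
    and g: "\<And>s x. s \<in> S \<Longrightarrow> x \<in> \<Omega> \<Longrightarrow> (g s has_derivative (\<lambda>u. G s x \<bullet> u)) (at x)"
    and V: "\<And>s x. s \<in> S \<Longrightarrow> x \<in> \<Omega> \<Longrightarrow> G s x \<bullet> V x = 0"
    and \<gamma>: "\<And>t. (\<gamma> has_vector_derivative V (\<gamma> t)) (at t)" and \<gamma>0: "\<gamma> 0 \<in> K"
  shows "\<gamma> t \<in> K"
proof -
  have cont: "continuous_on UNIV \<gamma>"
    using \<gamma> has_vector_derivative_continuous continuous_at_imp_continuous_on by metis
  define T where "T = \<gamma> -` K"
  have "closed T" unfolding T_def using cont \<Omega>(3) by (simp add: closed_vimage)
  moreover have "open T"
    unfolding open_contains_ball
  proof
    fix t assume "t \<in> T"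
    then have "t \<in> \<gamma> -` \<Omega>" using \<Omega> by (auto simp: T_def)
    moreover have "open (\<gamma> -` \<Omega>)" using cont \<Omega>(1) by (simp add: open_vimage)
    ultimately obtain e where e: "e > 0" "ball t e \<subseteq> \<gamma> -` \<Omega>"
      by (meson open_contains_ball)
    have "s' \<in> T" if s': "s' \<in> ball t e" for s'
    proof -
      have "g s (\<gamma> s') = c s" if "s \<in> S" for s
      proof -
        have "((\<lambda>t. g s (\<gamma> t)) has_real_derivative 0) (at u within ball t e)" if u: "u \<in> ball t e" for u
        proof -
          have "\<gamma> u \<in> \<Omega>" using u e by auto
          then show ?thesis
            using has_vector_derivative_grad_compose[OF g[OF \<open>s \<in> S\<close>] \<gamma>[of u]] V[OF \<open>s \<in> S\<close>]
            by (auto intro: has_field_derivative_at_within)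
        qed
        then obtain k where "\<And>u. u \<in> ball t e \<Longrightarrow> g s (\<gamma> u) = k"
          using has_field_derivative_zero_constant[of "ball t e"] by (metis convex_ball)
        then show ?thesis
          using \<open>t \<in> T\<close> that s' e(1) K by (auto simp: T_def)
      qed
      then show ?thesis using K by (simp add: T_def)
    qed
    then show "\<exists>e>0. ball t e \<subseteq> T" using e(1) by blast
  qed
  ultimately have "T = {} \<or> T = UNIV"
    using connected_UNIV clopen by blast
  then show ?thesis using \<gamma>0 by (auto simp: T_def)
qed

text \<open>The points \<open>\<gamma> n\<close> accumulate at some \<open>q\<close> in
  \<open>K\<close>. Near \<open>q\<close> a point of \<open>K\<close> is determined by its height in
  the direction \<open>W q\<close>, so a short arc of the orbit through \<open>q\<close> contains
  all points of \<open>K\<close> close to \<open>q\<close>. Two late points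
  \<open>\<gamma> n\<close> therefore lie on this arc, and uniqueness of solutions makes \<gamma>
  return to itself.\<close>

lemma periodic_orbit_of_locally_injective:
  fixes W :: "'a::euclidean_space \<Rightarrow> 'a"
  assumes K: "compact K"
    and ex: "\<And>p. p \<in> K \<Longrightarrow> \<exists>\<gamma>. \<gamma> 0 = p \<and> (\<forall>t. \<gamma> t \<in> K) \<and> (\<forall>t. (\<gamma> has_vector_derivative W (\<gamma> t)) (at t))"
    and uniq: "\<And>\<gamma> \<eta> a t. (\<And>t. \<gamma> t \<in> K) \<Longrightarrow> (\<And>t. \<eta> t \<in> K) \<Longrightarrow>
        (\<And>t. (\<gamma> has_vector_derivative W (\<gamma> t)) (at t)) \<Longrightarrow>
        (\<And>t. (\<eta> has_vector_derivative W (\<eta> t)) (at t)) \<Longrightarrow> \<gamma> a = \<eta> a \<Longrightarrow> \<gamma> t = \<eta> t"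
    and inj: "\<And>q. q \<in> K \<Longrightarrow> \<exists>r>0. \<forall>x\<in>K \<inter> ball q r. \<forall>y\<in>K \<inter> ball q r. W q \<bullet> x = W q \<bullet> y \<longrightarrow> x = y"
    and nz: "\<And>q. q \<in> K \<Longrightarrow> W q \<noteq> 0"
    and \<gamma>K: "\<And>t. \<gamma> t \<in> K" and \<gamma>: "\<And>t. (\<gamma> has_vector_derivative W (\<gamma> t)) (at t)"
  shows "\<exists>P>0. \<forall>t. \<gamma> (t + P) = \<gamma> t"
proof -
  obtain q r where q: "q \<in> K" and r: "strict_mono (r :: nat \<Rightarrow> nat)"
    and lim: "((\<lambda>n. \<gamma> (real n)) \<circ> r) \<longlonglongrightarrow> q"
    using K \<gamma>K unfolding compact_def by (metis (no_types, lifting))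
  obtain \<eta> where \<eta>0: "\<eta> 0 = q" and \<eta>K: "\<And>t. \<eta> t \<in> K"
    and \<eta>: "\<And>t. (\<eta> has_vector_derivative W (\<eta> t)) (at t)"
    using ex[OF q] by blast
  obtain \<rho> where \<rho>: "\<rho> > 0" and inj': "\<And>x y. x \<in> K \<inter> ball q \<rho> \<Longrightarrow> y \<in> K \<inter> ball q \<rho> \<Longrightarrow>
      W q \<bullet> x = W q \<bullet> y \<Longrightarrow> x = y"
    using inj[OF q] by blast
  have c\<eta>: "continuous_on UNIV \<eta>"
    using \<eta> has_vector_derivative_continuous continuous_at_imp_continuous_on by metis
  have "open (\<eta> -` ball q \<rho>)" using c\<eta> by (simp add: open_vimage)
  moreover have "0 \<in> \<eta> -` ball q \<rho>" using \<eta>0 \<rho> by simp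
  ultimately obtain d1 where d1: "d1 > 0" "ball 0 d1 \<subseteq> \<eta> -` ball q \<rho>"
    by (meson open_contains_ball)
  \<comment> \<open>The height of the orbit of \<open>q\<close>. It increases strictly through time
    0, so by the intermediate value theorem the short arc attains every height close to that of
    \<open>q\<close>.\<close>
  define \<psi> where "\<psi> s = W q \<bullet> \<eta> s" for s
  have c\<psi>: "continuous_on A \<psi>" for A
    unfolding \<psi>_def using c\<eta> by (auto intro!: continuous_intros intro: continuous_on_subset)
  have "(\<psi> has_real_derivative W q \<bullet> W q) (at 0)"
    using has_vector_derivative_grad_compose[of "\<lambda>x. W q \<bullet> x" "W q" \<eta> 0] \<eta>[of 0] \<eta>0
    unfolding \<psi>_def
    by (simp add: bounded_linear_imp_has_derivative[OF bounded_linear_inner_right])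
  moreover have pos: "W q \<bullet> W q > 0" using nz[OF q] by simp
  ultimately obtain d2 d3 where d2: "d2 > 0" "\<And>h. 0 < h \<Longrightarrow> h < d2 \<Longrightarrow> \<psi> 0 < \<psi> (0 + h)"
    and d3: "d3 > 0" "\<And>h. 0 < h \<Longrightarrow> h < d3 \<Longrightarrow> \<psi> (0 - h) < \<psi> 0"
    using DERIV_pos_inc_right DERIV_pos_inc_left by metis
  \<comment> \<open>The bound 1/2 makes two parameters on the arc differ by less than 1, whereas the
    two times along \<gamma> differ by at least 1; this gives a positive period
    \<open>P\<close>.\<close>
  define \<delta> where "\<delta> = min (min d1 (1/2)) (min d2 d3) / 2"
  have \<delta>: "\<delta> > 0" "\<delta> < d1" "\<delta> < 1/2" "\<psi> 0 < \<psi> \<delta>" "\<psi> (-\<delta>) < \<psi> 0"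
    using d1 d2(1) d3(1) d2(2)[of \<delta>] d3(2)[of \<delta>] by (auto simp: \<delta>_def min_def)
  have "((\<lambda>n. W q \<bullet> \<gamma> (real (r n))) \<longlongrightarrow> W q \<bullet> q) sequentially"
    using lim by (intro tendsto_intros) (simp add: o_def)
  then have "\<forall>\<^sub>F n in sequentially. \<psi> (-\<delta>) < W q \<bullet> \<gamma> (real (r n)) \<and> W q \<bullet> \<gamma> (real (r n)) < \<psi> \<delta>"
    using \<delta> \<eta>0 by (intro eventually_conj order_tendstoD) (auto simp: \<psi>_def)
  moreover have "\<forall>\<^sub>F n in sequentially. \<gamma> (real (r n)) \<in> ball q \<rho>"
    using topological_tendstoD[OF lim, of "ball q \<rho>"] \<rho> by (simp add: o_def)
  ultimately have "\<forall>\<^sub>F n in sequentially. \<exists>s. \<bar>s\<bar> \<le> \<delta> \<and> \<gamma> (real (r n)) = \<eta> s"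
  proof eventually_elim
    case (elim n)
    then obtain s where s: "-\<delta> \<le> s" "s \<le> \<delta>" "\<psi> s = W q \<bullet> \<gamma> (real (r n))"
      using IVT'[of \<psi> "-\<delta>" "W q \<bullet> \<gamma> (real (r n))" \<delta>] c\<psi> \<delta> by auto
    have "s \<in> ball 0 d1" using s \<delta> by (simp add: abs_less_iff)
    then have "\<eta> s \<in> K \<inter> ball q \<rho>"
      using \<eta>K d1(2) by blast
    moreover have "\<gamma> (real (r n)) \<in> K \<inter> ball q \<rho>"
      using \<gamma>K elim by blast
    moreover have "W q \<bullet> \<gamma> (real (r n)) = W q \<bullet> \<eta> s"
      using s(3) unfolding \<psi>_def by (rule sym)
    ultimately have "\<gamma> (real (r n)) = \<eta> s"
      by (intro inj')
    then show ?case using s by (intro exI[of _ s]) auto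
  qed
  then obtain N where N: "\<And>n. n \<ge> N \<Longrightarrow> \<exists>s. \<bar>s\<bar> \<le> \<delta> \<and> \<gamma> (real (r n)) = \<eta> s"
    unfolding eventually_sequentially by blast
  obtain s1 s2 where s: "\<bar>s1\<bar> \<le> \<delta>" "\<gamma> (real (r N)) = \<eta> s1" "\<bar>s2\<bar> \<le> \<delta>" "\<gamma> (real (r (Suc N))) = \<eta> s2"
    using N[of N] N[of "Suc N"] by auto
  have shift: "((\<lambda>t. \<gamma> (t + b)) has_vector_derivative W (\<gamma> (t + b))) (at t)" for t b
    using has_vector_derivative_affine_reparam[of \<gamma> W 1 b t] \<gamma> by simp
  have "(\<lambda>t. \<gamma> (t + (r N - s1))) s2 = \<eta> s2"
    by (rule uniq[of _ _ s1]) (use \<gamma>K \<eta>K shift \<eta> s in auto)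
  then have "\<gamma> (s2 + (r N - s1)) = \<gamma> (real (r (Suc N)))" using s by simp
  moreover define P where "P = real (r (Suc N)) - (s2 + (r N - s1))"
  ultimately have eq: "\<gamma> (s2 + (r N - s1) + P) = \<gamma> (s2 + (r N - s1))" by simp
  have "real (r (Suc N)) \<ge> real (r N) + 1"
    using strict_monoD[OF r, of N "Suc N"] by simp
  then have "P > 0" using s \<delta> unfolding P_def by linarith
  moreover have "\<gamma> (t + P) = \<gamma> t" for t
    by (rule uniq[of "\<lambda>t. \<gamma> (t + P)" \<gamma> "s2 + (r N - s1)"]) (use \<gamma>K \<gamma> shift eq in auto)
  ultimately show ?thesis by blast
qed

text \<open>If \<phi> leaves its initial value upwards, then by periodicity it is below that value
  just before time \<open>P\<close>. At the first time when it is no longer above, it arrives from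
  above, so its derivative there cannot be positive. The other sign follows by negation.\<close>

lemma periodic_function_first_return:
  fixes \<phi> :: "real \<Rightarrow> real"
  assumes cont: "continuous_on UNIV \<phi>" and per: "P > 0" "\<And>t. \<phi> (t + P) = \<phi> t"
    and der: "(\<phi> has_real_derivative c) (at 0)" "c \<noteq> 0"
  obtains t where "0 < t" "\<phi> t = \<phi> 0" "\<And>d. (\<phi> has_real_derivative d) (at t) \<Longrightarrow> c * d \<le> 0"
proof -
  have main: "\<exists>t>0. \<phi> t = \<phi> 0 \<and> (\<forall>d. (\<phi> has_real_derivative d) (at t) \<longrightarrow> d \<le> 0)"
    if cont: "continuous_on UNIV \<phi>" and per: "\<And>t. \<phi> (t + P) = \<phi> t"
     and der: "(\<phi> has_real_derivative c) (at 0)" and c: "c > 0" for \<phi> :: "real \<Rightarrow> real" and c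
  proof -
    obtain d2 d3 where d2: "d2 > 0" "\<And>h. 0 < h \<Longrightarrow> h < d2 \<Longrightarrow> \<phi> 0 < \<phi> (0 + h)"
      and d3: "d3 > 0" "\<And>h. 0 < h \<Longrightarrow> h < d3 \<Longrightarrow> \<phi> (0 - h) < \<phi> 0"
      using DERIV_pos_inc_right[OF der c] DERIV_pos_inc_left[OF der c] by metis
    define \<delta> where "\<delta> = min P (min d2 d3) / 2"
    have \<delta>: "\<delta> > 0" "\<delta> < P" "\<delta> < d2" "\<delta> < d3"
      using d2(1) d3(1) \<open>P > 0\<close> by (auto simp: \<delta>_def min_def)
    have \<delta>P: "\<delta> \<le> P - \<delta>"
      using \<open>P > 0\<close> by (simp add: \<delta>_def)
    \<comment> \<open>Starting at \<delta> instead of 0 excludes the initial time;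
      \<open>P - \<delta>\<close> shows that the set is not empty, and its minimum is the first
      return.\<close>
    define A where "A = {\<delta>..P} \<inter> {t. \<phi> t \<le> \<phi> 0}"
    have "closed {t. \<phi> t \<le> \<phi> 0}"
      using cont by (intro closed_Collect_le) auto
    then have A: "compact A" unfolding A_def by (simp add: compact_Int_closed)
    have PA: "P - \<delta> \<in> A"
    proof -
      have "\<phi> (P - \<delta>) = \<phi> (0 - \<delta>)" using per[of "- \<delta>"] by (simp add: algebra_simps)
      then show ?thesis using d3(2)[of \<delta>] \<delta> \<delta>P by (simp add: A_def)
    qed
    then obtain t where t: "t \<in> A" "\<And>s. s \<in> A \<Longrightarrow> t \<le> s"
      using compact_attains_inf[OF A] by blast
    have td: "t > \<delta>"
      using t(1) d2(2)[of \<delta>] \<delta> by (cases "t = \<delta>") (auto simp: A_def)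
    have gt: "\<phi> s > \<phi> 0" if "\<delta> \<le> s" "s < t" for s
      using t that PA by (force simp: A_def)
    have "\<phi> t \<ge> \<phi> 0"
    proof (rule ccontr)
      assume "\<not> \<phi> t \<ge> \<phi> 0"
      then obtain s where "\<delta> \<le> s" "s \<le> t" "\<phi> s = \<phi> 0"
        using IVT2'[of \<phi> t "\<phi> 0" \<delta>] gt[of \<delta>] td cont by (auto intro: continuous_on_subset)
      then show False using gt[of s] \<open>\<not> \<phi> t \<ge> \<phi> 0\<close> by (cases "s = t") auto
    qed
    then have eq: "\<phi> t = \<phi> 0" using t(1) by (simp add: A_def)
    have "d \<le> 0" if dd: "(\<phi> has_real_derivative d) (at t)" for d
    proof (rule ccontr)
      assume "\<not> d \<le> 0"
      then obtain e where e: "e > 0" "\<And>h. 0 < h \<Longrightarrow> h < e \<Longrightarrow> \<phi> (t - h) < \<phi> t"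
        using DERIV_pos_inc_left[OF dd] by auto
      define h where "h = min e (t - \<delta>) / 2"
      have "0 < h" "h < e" "\<delta> \<le> t - h" "t - h < t"
        using e td by (auto simp: h_def min_def field_simps)
      then show False using e(2)[of h] gt[of "t - h"] eq by simp
    qed
    then show ?thesis using td \<delta> eq by (intro exI[of _ t]) auto
  qed
  show thesis
  proof (cases "c > 0")
    case True
    then obtain t where "t > 0" "\<phi> t = \<phi> 0" "\<And>d. (\<phi> has_real_derivative d) (at t) \<Longrightarrow> d \<le> 0"
      using main[OF cont per(2) der(1)] by blast
    then show thesis using that[of t] True by (simp add: mult_nonneg_nonpos)
  next
    case False
    have "((\<lambda>t. - \<phi> t) has_real_derivative - c) (at 0)"
      using der(1) by (rule DERIV_minus)
    then obtain t where t: "t > 0" "- \<phi> t = - \<phi> 0"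
        "\<And>d. ((\<lambda>t. - \<phi> t) has_real_derivative d) (at t) \<Longrightarrow> d \<le> 0"
      using main[of "\<lambda>t. - \<phi> t" "- c"] cont per(2) False der(2)
      by (auto intro: continuous_intros)
    have "c * d \<le> 0" if "(\<phi> has_real_derivative d) (at t)" for d
      using t(3)[OF DERIV_minus[OF that]] False by (simp add: mult_nonpos_nonneg)
    then show thesis using that[of t] t by auto
  qed
qed

section \<open>Kernel fields of gradient systems\<close>

lemma has_derivative_vec_componentwise:
  fixes f :: "'a::real_normed_vector \<Rightarrow> real^'n"
  assumes "\<And>i. ((\<lambda>x. f x $ i) has_derivative (\<lambda>u. f' u $ i)) (at x within S)"
  shows "(f has_derivative f') (at x within S)"
  using assms by (subst has_derivative_componentwise_within) (auto simp: Basis_vec_def inner_axis)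

lemma vector_eqI_inner:
  fixes x y :: "'a::real_inner"
  assumes "\<And>l. l \<bullet> x = l \<bullet> y"
  shows "x = y"
  using assms[of "x - y"] by (metis inner_diff_right inner_eq_zero_iff right_minus_eq)

lemma det_nonzero_kernel:
  fixes A :: "real^'n^'n"
  shows "det A \<noteq> 0 \<longleftrightarrow> (\<forall>u. A *v u = 0 \<longrightarrow> u = 0)"
  using invertible_det_nz[of A] invertible_left_inverse[of A] matrix_left_invertible_ker[of A] by blast

lemma det_nonzero_rows:
  fixes r :: "'n::finite \<Rightarrow> real^'n"
  shows "det (\<chi> i. r i) \<noteq> 0 \<longleftrightarrow> (\<forall>u. (\<forall>i. r i \<bullet> u = 0) \<longrightarrow> u = 0)"
proof -
  have "((\<chi> i. r i) *v u = 0) \<longleftrightarrow> (\<forall>i. r i \<bullet> u = 0)" for u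
    by (simp add: vec_eq_iff matrix_vector_mult_def inner_vec_def)
  then show ?thesis by (simp add: det_nonzero_kernel)
qed

definition grad_det :: "('i \<Rightarrow> real^'i \<Rightarrow> real) \<Rightarrow> real^'i \<Rightarrow> real" where
  "grad_det g x = det (\<chi> i. grad (g i) x)"

text \<open>The generalised cross product of the gradients with index other than \<open>k\<close>,
  written through the cofactors of row \<open>k\<close>. It is orthogonal to these gradients and is
  zero exactly when they are dependent; as a polynomial in their entries it is analytic.\<close>

definition kernel_field :: "('i \<Rightarrow> real^'i \<Rightarrow> real) \<Rightarrow> 'i \<Rightarrow> real^'i \<Rightarrow> real^'i" where
  "kernel_field g k x = (\<chi> j. det (\<chi> i. if i = k then axis j 1 else grad (g i) x))"

lemma inner_kernel_field:
  fixes g :: "'i::finite \<Rightarrow> real^'i \<Rightarrow> real"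
  shows "l \<bullet> kernel_field g k x = det (\<chi> i. if i = k then l else grad (g i) x)"
proof -
  have l: "l = (\<Sum>j\<in>UNIV. l $ j *s axis j 1)"
    by (simp add: vec_eq_iff axis_def if_distrib cong: if_cong)
  have "det (\<chi> i. if i = k then l else grad (g i) x) =
      det (\<chi> i. if i = k then (\<Sum>j\<in>UNIV. l $ j *s axis j 1) else grad (g i) x)"
    using l by metis
  also have "\<dots> = (\<Sum>j\<in>UNIV. det (\<chi> i. if i = k then l $ j *s axis j 1 else grad (g i) x))"
    by (rule det_linear_row_sum) simp
  also have "\<dots> = (\<Sum>j\<in>UNIV. l $ j * det (\<chi> i. if i = k then axis j 1 else grad (g i) x))"
    by (simp add: det_row_mul)
  finally show ?thesis
    by (simp add: kernel_field_def inner_vec_def)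
qed

lemma grad_inner_kernel_field:
  fixes g :: "'i::finite \<Rightarrow> real^'i \<Rightarrow> real"
  shows "grad h x \<bullet> kernel_field g k x = grad_det (g(k := h)) x"
  unfolding inner_kernel_field grad_det_def by (rule arg_cong[of _ _ det]) (simp add: vec_eq_iff)

text \<open>Fewer gradients than dimensions leave a non-zero \<open>l\<close> orthogonal to all of
  them. With \<open>l\<close> in row \<open>k\<close> the determinant is
  \<open>l \<bullet> kernel_field g k x = 0\<close>, so the rows are dependent, and pairing the
  relation with \<open>l\<close> removes the coefficient of \<open>l\<close>.\<close>

lemma kernel_field_eq_0_dependent:
  fixes g :: "'i::finite \<Rightarrow> real^'i \<Rightarrow> real"
  assumes "kernel_field g k x = 0"
  obtains c where "c \<noteq> 0" "c $ k = 0" "(\<Sum>i\<in>-{k}. c $ i *\<^sub>R grad (g i) x) = 0"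
proof -
  have "dim ((\<lambda>i. grad (g i) x) ` (-{k})) \<le> card ((\<lambda>i. grad (g i) x) ` (-{k}))"
    by (simp add: dim_le_card')
  also have "\<dots> \<le> card (-{k} :: 'i set)" by (simp add: card_image_le)
  also have "\<dots> < DIM(real^'i)" by (simp add: Compl_eq_Diff_UNIV card_Diff_singleton)
  finally obtain l where l: "l \<noteq> 0" "\<And>y. y \<in> span ((\<lambda>i. grad (g i) x) ` (-{k})) \<Longrightarrow> orthogonal l y"
    using orthogonal_to_subspace_exists by blast
  let ?A = "\<chi> i. if i = k then l else grad (g i) x"
  have "det (transpose ?A) = 0"
    using assms inner_kernel_field[of l g k x] by (simp add: det_transpose)
  then obtain c where c: "transpose ?A *v c = 0" "c \<noteq> 0"
    using det_nonzero_kernel by blast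
  have "transpose ?A *v c = (\<Sum>i\<in>UNIV. c $ i *\<^sub>R (?A $ i))"
    by (simp add: vec_eq_iff matrix_vector_mult_def transpose_def mult.commute)
  also have "\<dots> = c $ k *\<^sub>R l + (\<Sum>i\<in>-{k}. c $ i *\<^sub>R (?A $ i))"
    by (subst sum.remove[of UNIV k]) (auto simp: Compl_eq_Diff_UNIV)
  also have "(\<Sum>i\<in>-{k}. c $ i *\<^sub>R (?A $ i)) = (\<Sum>i\<in>-{k}. c $ i *\<^sub>R grad (g i) x)"
    by (rule sum.cong) auto
  finally have s: "c $ k *\<^sub>R l + (\<Sum>i\<in>-{k}. c $ i *\<^sub>R grad (g i) x) = 0"
    using c by simp
  have "l \<bullet> (\<Sum>i\<in>-{k}. c $ i *\<^sub>R grad (g i) x) = 0"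
    using l(2) by (simp add: inner_sum_right orthogonal_def span_base)
  moreover have "l \<bullet> (c $ k *\<^sub>R l + (\<Sum>i\<in>-{k}. c $ i *\<^sub>R grad (g i) x)) = 0"
    by (simp only: s inner_zero_right)
  ultimately have "l \<bullet> (c $ k *\<^sub>R l) = 0"
    unfolding inner_add_right by linarith
  then have "c $ k = 0" using l(1) by simp
  then show thesis using that[of c] s c(2) by simp
qed

lemma analytic_vec_on_grad_det:
  assumes "\<And>i. analytic_vec_on S (g i)"
  shows "analytic_vec_on S (grad_det g)"
  unfolding grad_det_def
  by (intro analytic_vec_on_det) (simp add: analytic_vec_on_grad_nth assms)

lemma analytic_vec_on_kernel_field:
  assumes "\<And>i. i \<noteq> k \<Longrightarrow> analytic_vec_on S (g i)"
  shows "analytic_vec_on S (\<lambda>x. kernel_field g k x $ j)"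
proof -
  have "analytic_vec_on S (\<lambda>x. (\<chi> i. if i = k then axis j 1 else grad (g i) x) $ i' $ j')" for i' j'
    using assms by (cases "i' = k") (auto simp: analytic_vec_on_const analytic_vec_on_grad_nth)
  then show ?thesis
    unfolding kernel_field_def by (simp add: analytic_vec_on_det)
qed

section \<open>Local charts from the inverse function theorem\<close>

definition jacobian :: "(real^'i \<Rightarrow> real^'i) \<Rightarrow> real^'i \<Rightarrow> (real^'i) \<Rightarrow>\<^sub>L (real^'i)" where
  "jacobian H x = Blinfun (\<lambda>u. (\<chi> i. grad (\<lambda>x. H x $ i) x) *v u)"

lemma jacobian_apply: "blinfun_apply (jacobian H x) u = (\<chi> i. grad (\<lambda>x. H x $ i) x \<bullet> u)"
proof -
  have "blinfun_apply (jacobian H x) u = (\<chi> i. grad (\<lambda>x. H x $ i) x) *v u"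
    unfolding jacobian_def
    by (simp add: bounded_linear_Blinfun_apply linear_conv_bounded_linear[symmetric])
  then show ?thesis
    by (simp add: vec_eq_iff matrix_vector_mult_def inner_vec_def)
qed

lemma analytic_vec_field_C1:
  fixes H :: "real^'i \<Rightarrow> real^'i"
  assumes H: "\<And>i. analytic_vec_on S (\<lambda>x. H x $ i)" and S: "open S"
  shows "\<And>x. x \<in> S \<Longrightarrow> (H has_derivative blinfun_apply (jacobian H x)) (at x)"
    and "continuous_on S (jacobian H)"
proof -
  show "(H has_derivative blinfun_apply (jacobian H x)) (at x)" if "x \<in> S" for x
    by (rule has_derivative_vec_componentwise)
       (simp add: jacobian_apply analytic_vec_has_derivative[OF H S that])
  have "continuous_on S (\<lambda>x. grad (\<lambda>x. H x $ i) x)" for i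
  proof -
    have "continuous_on S (\<lambda>x. \<chi> j. grad (\<lambda>x. H x $ i) x $ j)"
      by (intro continuous_on_vec_lambda continuous_on_analytic_vec analytic_vec_on_grad_nth H)
    then show ?thesis by simp
  qed
  then show "continuous_on S (jacobian H)"
    by (intro continuous_on_blinfun_componentwise) (auto simp: jacobian_apply intro!: continuous_intros)
qed

lemma inverse_function_analytic:
  fixes H :: "real^'i \<Rightarrow> real^'i"
  assumes H: "\<And>i. analytic_vec_on S (\<lambda>x. H x $ i)" and S: "open S" "q \<in> S"
    and det: "det (\<chi> i. grad (\<lambda>x. H x $ i) q) \<noteq> 0"
  obtains U V h h' where "open U" "U \<subseteq> S" "q \<in> U" "open V" "H q \<in> V" "homeomorphism U V H h"
    "\<And>y. y \<in> V \<Longrightarrow> (h has_derivative h' y) (at y)"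
proof -
  let ?A = "\<chi> i. grad (\<lambda>x. H x $ i) q"
  obtain B where B: "B ** ?A = mat 1"
    using det by (metis invertible_det_nz invertible_left_inverse)
  have "Blinfun ((*v) B) o\<^sub>L jacobian H q = id_blinfun"
  proof (rule blinfun_eqI)
    fix u
    have "blinfun_apply (jacobian H q) u = ?A *v u"
      unfolding jacobian_def
      by (simp add: bounded_linear_Blinfun_apply linear_conv_bounded_linear[symmetric])
    then have "blinfun_apply (Blinfun ((*v) B)) (blinfun_apply (jacobian H q) u) = B *v (?A *v u)"
      by (simp add: bounded_linear_Blinfun_apply linear_conv_bounded_linear[symmetric])
    then show "blinfun_apply (Blinfun ((*v) B) o\<^sub>L jacobian H q) u = blinfun_apply id_blinfun u"
      by (simp add: matrix_vector_mul_assoc B)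
  qed
  from inverse_function_theorem[OF S(1) analytic_vec_field_C1(1)[OF H S(1)]
      analytic_vec_field_C1(2)[OF H S(1)] S(2) this]
  obtain U V h h' where "open U" "U \<subseteq> S" "q \<in> U" "open V" "H q \<in> V" "homeomorphism U V H h"
    "\<And>y. y \<in> V \<Longrightarrow> (h has_derivative h' y) (at y)" by metis
  then show thesis by (rule that)
qed

text \<open>Put the linear function \<open>x \<mapsto> kernel_field g k q \<bullet> x\<close> into
  slot \<open>k\<close>. The Jacobian determinant at \<open>q\<close> becomes the squared norm of
  the kernel field, and the inverse function theorem applies.\<close>

lemma kernel_field_locally_injective:
  fixes g :: "'i::finite \<Rightarrow> real^'i \<Rightarrow> real"
  assumes g: "\<And>i. i \<noteq> k \<Longrightarrow> analytic_vec_on S (g i)" and S: "open S" "q \<in> S"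
    and nz: "kernel_field g k q \<noteq> 0"
  obtains r where "r > 0" "\<And>x y. x \<in> ball q r \<Longrightarrow> y \<in> ball q r \<Longrightarrow>
     (\<And>i. i \<noteq> k \<Longrightarrow> g i x = g i y) \<Longrightarrow> kernel_field g k q \<bullet> x = kernel_field g k q \<bullet> y \<Longrightarrow> x = y"
proof -
  let ?l = "kernel_field g k q"
  define H where "H x = (\<chi> i. if i = k then ?l \<bullet> x else g i x)" for x
  have lin: "analytic_vec_on S (\<lambda>x. ?l \<bullet> x)"
    unfolding inner_vec_def inner_real_def
    by (intro analytic_vec_on_sum analytic_vec_on_mult analytic_vec_on_const analytic_vec_on_nth)
  have Hi: "(\<lambda>x. H x $ i) = (if i = k then (\<lambda>x. ?l \<bullet> x) else g i)" for i
    by (auto simp: H_def)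
  have H: "analytic_vec_on S (\<lambda>x. H x $ i)" for i
    using g lin by (auto simp: Hi)
  have gl: "grad (\<lambda>x. ?l \<bullet> x) q = ?l"
  proof (rule vector_eqI_inner)
    fix u
    have "((\<lambda>x. ?l \<bullet> x) has_derivative (\<lambda>u. ?l \<bullet> u)) (at q)"
      by (rule bounded_linear_imp_has_derivative[OF bounded_linear_inner_right])
    then have "(\<lambda>u. grad (\<lambda>x. ?l \<bullet> x) q \<bullet> u) = (\<lambda>u. ?l \<bullet> u)"
      using analytic_vec_has_derivative[OF lin S] has_derivative_unique by blast
    then show "u \<bullet> grad (\<lambda>x. ?l \<bullet> x) q = u \<bullet> ?l" by (metis inner_commute)
  qed
  have "det (\<chi> i. grad (\<lambda>x. H x $ i) q) = det (\<chi> i. if i = k then ?l else grad (g i) q)"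
    by (rule arg_cong[of _ _ det]) (auto simp: vec_eq_iff Hi gl)
  also have "\<dots> = ?l \<bullet> ?l" by (simp add: inner_kernel_field)
  finally have "det (\<chi> i. grad (\<lambda>x. H x $ i) q) \<noteq> 0" using nz by simp
  then obtain U V h h' where "open U" "U \<subseteq> S" "q \<in> U" "open V" "H q \<in> V" "homeomorphism U V H h"
    "\<And>y. y \<in> V \<Longrightarrow> (h has_derivative h' y) (at y)"
    by (rule inverse_function_analytic[OF H S]) blast
  then obtain r where r: "r > 0" "ball q r \<subseteq> U" and inj: "\<And>x. x \<in> U \<Longrightarrow> h (H x) = x"
    by (metis homeomorphism_apply1 open_contains_ball)
  show thesis
  proof (rule that[OF r(1)])
    fix x y assume xy: "x \<in> ball q r" "y \<in> ball q r" "\<And>i. i \<noteq> k \<Longrightarrow> g i x = g i y" "?l \<bullet> x = ?l \<bullet> y"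
    then have "H x = H y" by (simp add: H_def vec_eq_iff)
    then show "x = y" using inj xy(1,2) r(2) by (metis subsetD)
  qed
qed

section \<open>Critical values\<close>

text \<open>Lindelof's theorem, stated for any set operation \<open>N\<close> that commutes with
  unions. In its application \<open>N S\<close> is the set of vectors whose coordinates other than
  \<open>k\<close> are values attained at one point of \<open>S\<close>.\<close>

lemma negligible_of_locally_negligible:
  fixes N :: "'a::second_countable_topology set \<Rightarrow> 'b::euclidean_space set"
  assumes loc: "\<And>x. x \<in> S \<Longrightarrow> \<exists>U. open U \<and> x \<in> U \<and> negligible (N (S \<inter> U))"
    and N: "\<And>\<F>. N (\<Union>\<F>) = \<Union>(N ` \<F>)"
  shows "negligible (N S)"
proof -
  let ?\<F> = "{U. open U \<and> negligible (N (S \<inter> U))}"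
  obtain \<F>' where \<F>': "\<F>' \<subseteq> ?\<F>" "countable \<F>'" "\<Union>\<F>' = \<Union>?\<F>"
    using Lindelof[of ?\<F>] by blast
  have "S = \<Union>((\<lambda>U. S \<inter> U) ` \<F>')"
    using loc \<F>'(3) by blast
  then have "N S = \<Union>(N ` ((\<lambda>U. S \<inter> U) ` \<F>'))"
    using N by metis
  also have "negligible \<dots>"
    by (rule negligible_countable_Union) (use \<F>' in auto)
  finally show ?thesis .
qed

lemma rank_less_of_dependent_rows:
  fixes f :: "real^'n \<Rightarrow> real^'n"
  assumes "linear f" "c \<noteq> 0" "\<And>u. c \<bullet> f u = 0"
  shows "rank (matrix f) < CARD('n)"
proof -
  have "rank (matrix f) = dim (range f)"
    using assms(1) by (simp add: rank_dim_range matrix_works[OF linear_matrix_vector_mul_eq[THEN iffD2]])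
  also have "\<dots> \<le> dim {x. c \<bullet> x = 0}"
    using assms(3) by (intro dim_subset) auto
  also have "\<dots> = CARD('n) - 1"
    using dim_hyperplane[OF assms(2)] by simp
  finally show ?thesis
    using zero_less_card_finite[where 'a='n] by linarith
qed

text \<open>A chart straightens \<open>h\<close> to a coordinate, so the hypersurface has one
  parameter less than the ambient space. Restricting the maps \<open>g i\<close> to it, and letting
  the spare parameter run through the free slot \<open>k\<close>, gives a map between spaces of
  equal dimension whose derivative is singular at critical points.\<close>

lemma critical_hypersurface_negligible:
  fixes g :: "'i::{finite,wellorder} \<Rightarrow> real^'i::{finite,wellorder} \<Rightarrow> real"
  assumes g: "\<And>i. i \<noteq> k \<Longrightarrow> analytic_vec_on \<Omega> (g i)" and \<Omega>: "open \<Omega>"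
    and h: "analytic_vec_on \<Omega> h" and x0: "x0 \<in> \<Omega>" "grad h x0 \<noteq> 0"
  shows "\<exists>U. open U \<and> x0 \<in> U \<and> negligible {y. \<exists>x\<in>U. kernel_field g k x = 0 \<and> h x = 0 \<and>
     (\<forall>i. i \<noteq> k \<longrightarrow> y $ i = g i x)}"
proof -
  obtain j where j: "grad h x0 $ j \<noteq> 0"
    using x0(2) by (metis vec_eq_iff zero_index)
  define H where "H x = (\<chi> i. if i = j then h x else x $ i)" for x
  have Hi: "(\<lambda>x. H x $ i) = (if i = j then h else (\<lambda>x. x $ i))" for i
    by (auto simp: H_def)
  have H: "analytic_vec_on \<Omega> (\<lambda>x. H x $ i)" for i
    using h by (auto simp: Hi analytic_vec_on_nth)
  have "det (\<chi> i. grad (\<lambda>x. H x $ i) x0) \<noteq> 0"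
    unfolding det_nonzero_rows
  proof (intro allI impI)
    fix u assume u: "\<forall>i. grad (\<lambda>x. H x $ i) x0 \<bullet> u = 0"
    then have ui: "u $ i = 0" if "i \<noteq> j" for i
      using that grad_coordinate[of i x0 u] spec[OF u, of i] by (simp add: Hi)
    have "grad h x0 \<bullet> u = (\<Sum>i\<in>UNIV. if i = j then grad h x0 $ j * u $ j else 0)"
      unfolding inner_vec_def by (rule sum.cong) (auto simp: ui)
    then have "u $ j = 0"
      using spec[OF u, of j] j by (simp add: Hi)
    with ui show "u = 0" by (metis vec_eq_iff zero_index)
  qed
  then obtain U V \<psi> \<psi>' where UV: "open U" "U \<subseteq> \<Omega>" "x0 \<in> U" "open V" "H x0 \<in> V" "homeomorphism U V H \<psi>"
    and \<psi>': "\<And>y. y \<in> V \<Longrightarrow> (\<psi> has_derivative \<psi>' y) (at y)"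
    by (rule inverse_function_analytic[OF H \<Omega> x0(1)]) blast
  define \<pi> where "\<pi> y = (\<chi> i. if i = j then 0 else y $ i)" for y :: "real^'i::{finite,wellorder}"
  have \<pi>: "linear \<pi>" by (auto simp: \<pi>_def vec_eq_iff algebra_simps intro!: linearI)
  \<comment> \<open>The projection \<pi> sets coordinate \<open>j\<close> to 0, that is,
    \<open>h = 0\<close>. The value \<open>y $ j\<close> thus discarded is reused for slot
    \<open>k\<close>, in which nothing is prescribed.\<close>
  define \<Psi> where "\<Psi> y = (\<chi> i. if i = k then y $ j else g i (\<psi> (\<pi> y)))" for y
  define \<Psi>' where "\<Psi>' y u = (\<chi> i. if i = k then u $ j else grad (g i) (\<psi> (\<pi> y)) \<bullet> \<psi>' (\<pi> y) (\<pi> u))" for y u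
  define A where "A = {y. \<pi> y \<in> V \<and> kernel_field g k (\<psi> (\<pi> y)) = 0}"
  have der: "(\<Psi> has_derivative \<Psi>' y) (at y)" if y: "y \<in> A" for y
  proof (rule has_derivative_vec_componentwise)
    fix i
    have V: "\<pi> y \<in> V" using y by (simp add: A_def)
    then have "\<psi> (\<pi> y) \<in> \<Omega>" using UV(2,6) homeomorphism_image2 by blast
    show "((\<lambda>y. \<Psi> y $ i) has_derivative (\<lambda>u. \<Psi>' y u $ i)) (at y)"
    proof (cases "i = k")
      case True
      then show ?thesis
        by (simp add: \<Psi>_def \<Psi>'_def bounded_linear_imp_has_derivative[OF bounded_linear_vec_nth])
    next
      case False
      have "(\<pi> has_derivative \<pi>) (at y)"
        by (simp add: \<pi> linear_imp_has_derivative)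
      then have "((\<lambda>y. \<psi> (\<pi> y)) has_derivative (\<lambda>u. \<psi>' (\<pi> y) (\<pi> u))) (at y)"
        using \<psi>'[OF V] by (rule has_derivative_compose)
      then have "((\<lambda>y. g i (\<psi> (\<pi> y))) has_derivative (\<lambda>u. grad (g i) (\<psi> (\<pi> y)) \<bullet> \<psi>' (\<pi> y) (\<pi> u))) (at y)"
        using analytic_vec_has_derivative[OF g[OF False] \<Omega> \<open>\<psi> (\<pi> y) \<in> \<Omega>\<close>]
        by (rule has_derivative_compose)
      then show ?thesis using False by (simp add: \<Psi>_def \<Psi>'_def)
    qed
  qed
  have "negligible (\<Psi> ` A)"
  proof (rule baby_Sard[where f' = \<Psi>'])
    fix y assume y: "y \<in> A"
    show "(\<Psi> has_derivative \<Psi>' y) (at y within A)"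
      using der[OF y] by (rule has_derivative_at_withinI)
    obtain c where c: "c \<noteq> 0" "c $ k = 0" "(\<Sum>i\<in>-{k}. c $ i *\<^sub>R grad (g i) (\<psi> (\<pi> y))) = 0"
      using y kernel_field_eq_0_dependent[of g k "\<psi> (\<pi> y)"] by (auto simp: A_def)
    have "c \<bullet> \<Psi>' y u = 0" for u
    proof -
      have "c \<bullet> \<Psi>' y u = (\<Sum>i\<in>-{k}. c $ i * \<Psi>' y u $ i)"
        unfolding inner_vec_def
        by (subst sum.remove[of UNIV k]) (auto simp: Compl_eq_Diff_UNIV c(2))
      also have "\<dots> = (\<Sum>i\<in>-{k}. c $ i *\<^sub>R grad (g i) (\<psi> (\<pi> y))) \<bullet> \<psi>' (\<pi> y) (\<pi> u)"
        unfolding inner_sum_left by (rule sum.cong) (auto simp: \<Psi>'_def)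
      finally show ?thesis using c by simp
    qed
    then show "rank (matrix (\<Psi>' y)) < CARD('i)"
      using rank_less_of_dependent_rows[of "\<Psi>' y" c] c(1) has_derivative_linear[OF der[OF y]] by blast
  qed simp
  moreover have "{y. \<exists>x\<in>U. kernel_field g k x = 0 \<and> h x = 0 \<and> (\<forall>i. i \<noteq> k \<longrightarrow> y $ i = g i x)} \<subseteq> \<Psi> ` A"
  proof safe
    fix y x assume x: "x \<in> U" "kernel_field g k x = 0" "h x = 0" "\<forall>i. i \<noteq> k \<longrightarrow> y $ i = g i x"
    define z where "z = (\<chi> i. if i = j then y $ k else x $ i)"
    have "\<pi> z = H x" using x by (auto simp: \<pi>_def z_def H_def vec_eq_iff)
    moreover have "H x \<in> V" "\<psi> (H x) = x"
      using x(1) UV(6) by (auto simp: homeomorphism_def)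
    ultimately have z: "\<pi> z \<in> V" "\<psi> (\<pi> z) = x" by auto
    then have "z \<in> A" using x by (simp add: A_def)
    moreover have "z $ j = y $ k" by (simp add: z_def)
    then have "\<Psi> z = y" unfolding vec_eq_iff using x(4) by (simp add: \<Psi>_def z(2))
    ultimately show "y \<in> \<Psi> ` A" by blast
  qed
  ultimately have "negligible {y. \<exists>x\<in>U. kernel_field g k x = 0 \<and> h x = 0 \<and>
     (\<forall>i. i \<noteq> k \<longrightarrow> y $ i = g i x)}"
    by (rule negligible_subset)
  then show ?thesis
    using UV(1,3) by (intro exI[of _ U] conjI)
qed

text \<open>A Sard theorem for a map to one dimension less.  The critical set is covered by countably many
  hypersurfaces \<open>h = 0\<close> with \<open>grad h \<noteq> 0\<close>, and on a chart of such a hypersurface the map is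
  equidimensional.\<close>

lemma kernel_field_critical_values_negligible:
  fixes g :: "'i::{finite,wellorder} \<Rightarrow> real^'i::{finite,wellorder} \<Rightarrow> real"
  assumes g: "\<And>i. i \<noteq> k \<Longrightarrow> analytic_vec_on \<Omega> (g i)" and \<Omega>: "open \<Omega>"
    and nv: "\<And>x e. x \<in> \<Omega> \<Longrightarrow> e > 0 \<Longrightarrow> \<exists>y\<in>ball x e. kernel_field g k y \<noteq> 0"
  shows "negligible {y. \<exists>x\<in>\<Omega>. kernel_field g k x = 0 \<and> (\<forall>i. i \<noteq> k \<longrightarrow> y $ i = g i x)}"
proof -
  obtain D :: "(real^'i::{finite,wellorder}) set" where D: "countable D" "\<And>U. open U \<Longrightarrow> U \<noteq> {} \<Longrightarrow> \<exists>d\<in>D. d \<in> U"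
    using countable_dense_setE by blast
  define N where "N S = {y. \<exists>x\<in>S. \<forall>i. i \<noteq> k \<longrightarrow> y $ i = g i x}" for S
  have NU: "N (\<Union>\<F>) = \<Union>(N ` \<F>)" for \<F> by (auto simp: N_def)
  define h where "h j n v = (dir_deriv v ^^ n) (\<lambda>x. kernel_field g k x $ j)" for j n v
  define S where "S = (\<lambda>(j, n, v). {x\<in>\<Omega>. kernel_field g k x = 0 \<and> h j n v x = 0 \<and> grad (h j n v) x \<noteq> 0})"
  have h: "analytic_vec_on \<Omega> (h j n v)" for j n v
    unfolding h_def
    by (induction n) (auto simp: analytic_vec_on_kernel_field g analytic_vec_on_dir_deriv)
  have neg: "negligible (N (S (j, n, v)))" for j n v
  proof (rule negligible_of_locally_negligible[OF _ NU])
    fix x assume "x \<in> S (j, n, v)"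
    then have "x \<in> \<Omega>" "grad (h j n v) x \<noteq> 0" by (auto simp: S_def)
    then obtain U where U: "open U" "x \<in> U" "negligible {y. \<exists>x\<in>U. kernel_field g k x = 0 \<and> h j n v x = 0
         \<and> (\<forall>i. i \<noteq> k \<longrightarrow> y $ i = g i x)}"
      using critical_hypersurface_negligible[of k \<Omega> g "h j n v" x] g \<Omega> h by blast
    then show "\<exists>U. open U \<and> x \<in> U \<and> negligible (N (S (j, n, v) \<inter> U))"
      by (intro exI[of _ U]) (auto simp: N_def S_def elim!: negligible_subset)
  qed
  have cover: "{x\<in>\<Omega>. kernel_field g k x = 0} \<subseteq> \<Union>(S ` (UNIV \<times> UNIV \<times> D))"
  proof safe
    fix x assume x: "x \<in> \<Omega>" "kernel_field g k x = 0"
    obtain e where e: "e > 0" "ball x e \<subseteq> \<Omega>" using \<Omega> x(1) open_contains_ball by blast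
    obtain y j where y: "y \<in> ball x e" "kernel_field g k y $ j \<noteq> 0"
      using nv[OF x(1) e(1)] by (metis vec_eq_iff zero_index)
    let ?f = "\<lambda>x. kernel_field g k x $ j"
    have af: "analytic_vec_on \<Omega> ?f"
      using g by (rule analytic_vec_on_kernel_field)
    have cf: "continuous_on (ball x e) ?f"
      using continuous_on_analytic_vec[OF af] e(2) by (rule continuous_on_subset)
    have "open (ball x e \<inter> ?f -` (-{0}))"
      using continuous_open_preimage[OF cf] by (simp add: open_delete Compl_eq_Diff_UNIV)
    then have "open ((\<lambda>v. x + v) -` (ball x e \<inter> ?f -` (-{0})))"
      by (intro open_vimage continuous_intros)
    moreover have "y - x \<in> (\<lambda>v. x + v) -` (ball x e \<inter> ?f -` (-{0}))" using y by simp
    \<comment> \<open>Non-vanishing at \<open>x + v\<close> is an open condition on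
      \<open>v\<close>, so \<open>v\<close> can be taken from the countable dense set
      \<open>D\<close>; this keeps the cover countable.\<close>
    ultimately obtain v where "v \<in> D" "v \<in> (\<lambda>v. x + v) -` (ball x e \<inter> ?f -` (-{0}))"
      using D(2) by (metis (no_types, lifting) empty_iff)
    then have v: "v \<in> D" "x + v \<in> ball x e" "?f (x + v) \<noteq> 0"
      by auto
    have seg: "x + t *\<^sub>R v \<in> \<Omega>" if "0 \<le> t" "t \<le> 1" for t
    proof -
      have "norm (t *\<^sub>R v) \<le> norm v" using that by (simp add: mult_left_le_one_le)
      then have "x + t *\<^sub>R v \<in> ball x e" using v(2) by (simp add: dist_norm)
      then show ?thesis using e by blast
    qed
    have ex: "\<exists>n. h j n v x \<noteq> 0"
      unfolding h_def
      by (rule analytic_vec_finite_order[OF af seg \<Omega> v(3)])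
    \<comment> \<open>The derivative of order one below the first non-vanishing one is zero at
      \<open>x\<close> while its derivative along \<open>v\<close> is not, so it defines a smooth
      hypersurface through \<open>x\<close>.\<close>
    define n where "n = (LEAST n. h j n v x \<noteq> 0)"
    have n: "h j n v x \<noteq> 0" "\<And>m. m < n \<Longrightarrow> h j m v x = 0"
      unfolding n_def using LeastI_ex[OF ex] not_less_Least by auto
    have "n \<noteq> 0" using n(1) x(2) by (intro notI) (simp add: h_def)
    then obtain m where m: "n = Suc m" using not0_implies_Suc by blast
    have "dir_deriv v (h j m v) x \<noteq> 0" using n(1) by (simp add: m h_def)
    then have "grad (h j m v) x \<noteq> 0"
      using dir_deriv_eq_grad[OF h \<Omega> x(1)] by auto
    then have "x \<in> S (j, m, v)" using x n(2)[of m] by (simp add: S_def m)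
    then show "x \<in> \<Union>(S ` (UNIV \<times> UNIV \<times> D))" using v(1) by blast
  qed
  have "countable ((UNIV :: 'i set) \<times> (UNIV :: nat set) \<times> D)"
    using D(1) by (intro countable_SIGMA) auto
  then have "negligible (\<Union>(N ` (S ` (UNIV \<times> UNIV \<times> D))))"
    by (intro negligible_countable_Union) (use neg in auto)
  then have "negligible (N (\<Union>(S ` (UNIV \<times> UNIV \<times> D))))" unfolding NU .
  then show ?thesis
    by (rule negligible_subset) (unfold N_def, use cover in blast)
qed

text \<open>Near \<open>a\<close> all functions \<open>g i\<close> together form a chart, so their
  values fill an open set, which the negligible set of critical values cannot contain. The chosen
  fibre is regular on all of \<Omega>, far beyond \<open>U\<close>.\<close>

lemma exists_regular_fibre:
  fixes g :: "'i::{finite,wellorder} \<Rightarrow> real^'i::{finite,wellorder} \<Rightarrow> real"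
  assumes g: "\<And>i. i \<noteq> k \<Longrightarrow> analytic_vec_on \<Omega> (g i)" and \<Omega>: "open \<Omega>"
    and nv: "\<And>x e. x \<in> \<Omega> \<Longrightarrow> e > 0 \<Longrightarrow> \<exists>y\<in>ball x e. kernel_field g k y \<noteq> 0"
    and U: "open U" "a \<in> U" "\<And>i. analytic_vec_on U (g i)" "grad_det g a \<noteq> 0"
  obtains p where "p \<in> U"
    "\<And>x. x \<in> \<Omega> \<Longrightarrow> (\<And>i. i \<noteq> k \<Longrightarrow> g i x = g i p) \<Longrightarrow> kernel_field g k x \<noteq> 0"
proof -
  define H where "H x = (\<chi> i. g i x)" for x
  have H: "analytic_vec_on U (\<lambda>x. H x $ i)" for i using U(3) by (simp add: H_def)
  have "det (\<chi> i. grad (\<lambda>x. H x $ i) a) \<noteq> 0"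
    using U(4) by (simp add: H_def grad_det_def)
  then obtain U' V h h' where UV: "open U'" "U' \<subseteq> U" "a \<in> U'" "open V" "H a \<in> V" "homeomorphism U' V H h"
    "\<And>y. y \<in> V \<Longrightarrow> (h has_derivative h' y) (at y)"
    by (rule inverse_function_analytic[OF H U(1,2)]) blast
  let ?N = "{y. \<exists>x\<in>\<Omega>. kernel_field g k x = 0 \<and> (\<forall>i. i \<noteq> k \<longrightarrow> y $ i = g i x)}"
  have "\<not> V \<subseteq> ?N"
    using kernel_field_critical_values_negligible[OF g \<Omega> nv] open_not_negligible[OF UV(4)] UV(5)
      negligible_subset by blast
  then obtain y where y: "y \<in> V" "y \<notin> ?N" by blast
  have "h y \<in> U" "H (h y) = y"
    using y UV by (auto simp: homeomorphism_def)
  moreover have "g i (h y) = y $ i" for i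
    using \<open>H (h y) = y\<close> by (metis H_def vec_lambda_beta)
  ultimately show thesis
    using y(2) by (intro that[of "h y"]) auto
qed

text \<open>The integral curve of the kernel field through \<open>p\<close> stays in the fibre for a
  short time. A finite connected set is a single point, but the curve starts with non-zero
  velocity.\<close>

lemma kernel_field_fibre_infinite:
  fixes g :: "'i::finite \<Rightarrow> real^'i \<Rightarrow> real" and G :: "'s \<Rightarrow> real^'i \<Rightarrow> real"
  assumes g: "\<And>i. i \<noteq> k \<Longrightarrow> analytic_vec_on U (g i)" and U: "open U" "p \<in> U"
    and nz: "kernel_field g k p \<noteq> 0"
    and G: "\<And>s. s \<in> S \<Longrightarrow> analytic_vec_on U (G s)"
    and ker: "\<And>s x. s \<in> S \<Longrightarrow> x \<in> U \<Longrightarrow> grad (G s) x \<bullet> kernel_field g k x = 0"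
  shows "infinite {x. \<forall>s\<in>S. G s x = G s p}"
proof
  assume fin: "finite {x. \<forall>s\<in>S. G s x = G s p}"
  let ?W = "kernel_field g k"
  obtain r where r: "r > 0" "cball p r \<subseteq> U" using U open_contains_cball by blast
  have W: "analytic_vec_on U (\<lambda>x. ?W x $ j)" for j
    using g by (rule analytic_vec_on_kernel_field)
  obtain V L M where "L > 0" "\<And>x y. norm (V x - V y) \<le> L * norm (x - y)" "\<And>x. norm (V x) \<le> M"
     and VW: "\<And>x. x \<in> cball p r \<Longrightarrow> V x = ?W x" and "\<And>x. \<exists>c. V x = c *\<^sub>R ?W x"
    using lipschitz_cutoff[OF U(1) compact_cball _ r(2) analytic_vec_field_C1[OF W U(1)]] r(1)
    by (metis cball_eq_empty less_le_not_le)
  then obtain \<gamma> where \<gamma>0: "\<gamma> 0 = p" and \<gamma>: "\<And>t. (\<gamma> has_vector_derivative V (\<gamma> t)) (at t)"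
    using lipschitz_ode_global_solution[of V L M p] by blast
  have cont: "continuous_on UNIV \<gamma>"
    using \<gamma> has_vector_derivative_continuous continuous_at_imp_continuous_on by metis
  have "open (\<gamma> -` ball p r)" using cont by (simp add: open_vimage)
  moreover have "0 \<in> \<gamma> -` ball p r" using \<gamma>0 r by simp
  ultimately obtain d where d: "d > 0" "ball 0 d \<subseteq> \<gamma> -` ball p r" by (meson open_contains_ball)
  have fibre: "\<gamma> t \<in> {x. \<forall>s\<in>S. G s x = G s p}" if t: "t \<in> ball 0 d" for t
  proof -
    have "G s (\<gamma> t) = G s p" if s: "s \<in> S" for s
    proof -
      have "((\<lambda>t. G s (\<gamma> t)) has_real_derivative 0) (at u within ball 0 d)" if u: "u \<in> ball 0 d" for u
      proof -
        have b: "\<gamma> u \<in> cball p r" using u d by auto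
        then have "\<gamma> u \<in> U" using r by blast
        then show ?thesis
          using has_vector_derivative_grad_compose[OF analytic_vec_has_derivative[OF G[OF s] U(1)] \<gamma>[of u]]
            ker[OF s] VW[OF b] by (auto intro: has_field_derivative_at_within)
      qed
      then obtain c where "\<And>u. u \<in> ball 0 d \<Longrightarrow> G s (\<gamma> u) = c"
        using has_field_derivative_zero_constant[of "ball 0 d"] by (metis convex_ball)
      then show ?thesis using t d(1) \<gamma>0 by (metis centre_in_ball)
    qed
    then show ?thesis by simp
  qed
  have "connected (\<gamma> ` ball 0 d)"
    using cont by (intro connected_continuous_image) (auto intro: continuous_on_subset)
  moreover have "finite (\<gamma> ` ball 0 d)"
    using fin by (rule finite_subset[rotated]) (use fibre in blast)
  ultimately obtain c where c: "\<gamma> ` ball 0 d \<subseteq> {c}"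
    by (metis connected_finite_iff_sing subset_insertI empty_subsetI order_refl)
  have "(\<gamma> has_vector_derivative 0) (at 0)"
    by (rule has_vector_derivative_transform_within_open[of "\<lambda>t. c" _ _ "ball 0 d"])
       (use c d(1) in \<open>auto simp: image_subset_iff\<close>)
  moreover have "(\<gamma> has_vector_derivative ?W p) (at 0)"
    using \<gamma>[of 0] VW[of p] \<gamma>0 r(1) by simp
  ultimately show False
    using nz vector_derivative_unique_at by blast
qed

text \<open>Multiplying the matrix of gradients at \<open>M x\<close> by \<open>M\<close> gives the
  gradients at \<open>x\<close>, and the determinant is multiplicative. The sign of
  \<open>det (matrix M)\<close> thus tells whether a symmetry preserves or reverses the direction of
  the field.\<close>

lemma kernel_field_symmetric:
  fixes g :: "'i::finite \<Rightarrow> real^'i \<Rightarrow> real"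
  assumes M: "linear M"
    and inv: "\<And>i u. i \<noteq> k \<Longrightarrow> grad (g i) (M x) \<bullet> M u = grad (g i) x \<bullet> u"
  shows "det (matrix M) *\<^sub>R kernel_field g k (M x) = M (kernel_field g k x)"
proof (rule vector_eqI_inner)
  fix l :: "real^'i"
  let ?A = "matrix M"
  have Mu: "?A *v u = M u" for u using M by (simp add: matrix_works)
  have row: "grad (g i) (M x) v* ?A = grad (g i) x" if "i \<noteq> k" for i
  proof (rule vector_eqI_inner)
    show "u \<bullet> (grad (g i) (M x) v* ?A) = u \<bullet> grad (g i) x" for u
      using inv[OF that, of u] dot_lmul_matrix[of "grad (g i) (M x)" ?A u] Mu
      by (metis inner_commute)
  qed
  have "l \<bullet> (det ?A *\<^sub>R kernel_field g k (M x)) =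
      det (\<chi> i. if i = k then l else grad (g i) (M x)) * det ?A"
    by (simp add: inner_kernel_field)
  also have "\<dots> = det ((\<chi> i. if i = k then l else grad (g i) (M x)) ** ?A)"
    by (simp add: det_mul)
  also have "(\<chi> i. if i = k then l else grad (g i) (M x)) ** ?A =
      (\<chi> i. if i = k then l v* ?A else grad (g i) x)"
  proof -
    have "((\<chi> i. if i = k then l else grad (g i) (M x)) ** ?A) $ i =
        (if i = k then l else grad (g i) (M x)) v* ?A" for i
      by (simp add: vec_eq_iff matrix_matrix_mult_def vector_matrix_mult_def mult.commute)
    then show ?thesis using row by (auto simp: vec_eq_iff)
  qed
  also have "det \<dots> = (l v* ?A) \<bullet> kernel_field g k x"
    by (simp add: inner_kernel_field)
  also have "\<dots> = l \<bullet> M (kernel_field g k x)"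
    by (simp add: dot_lmul_matrix Mu)
  finally show "l \<bullet> (det ?A *\<^sub>R kernel_field g k (M x)) = l \<bullet> M (kernel_field g k x)" .
qed

lemma grad_symmetric:
  assumes f: "analytic_vec_on \<Omega> f" and \<Omega>: "open \<Omega>" "x \<in> \<Omega>" "M x \<in> \<Omega>" and M: "linear M"
    and inv: "\<And>x. f (M x) = f x"
  shows "grad f (M x) \<bullet> M u = grad f x \<bullet> u"
proof -
  have "(M has_derivative M) (at x)"
    using M by (simp add: linear_imp_has_derivative)
  then have "((\<lambda>x. f (M x)) has_derivative (\<lambda>u. grad f (M x) \<bullet> M u)) (at x)"
    using analytic_vec_has_derivative[OF f \<Omega>(1,3)] by (rule has_derivative_compose)
  then have "(\<lambda>u. grad f (M x) \<bullet> M u) = (\<lambda>u. grad f x \<bullet> u)"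
    using analytic_vec_has_derivative[OF f \<Omega>(1,2)] has_derivative_unique inv by simp
  then show ?thesis by metis
qed

text \<open>The orbit of \<open>p\<close> under the kernel field closes up, so \<open>f\<close> returns to the value \<open>f p\<close> with the
  opposite direction of crossing.  If the return point is the image of \<open>p\<close> under a symmetry \<open>M\<close>, then
  \<open>M\<close> reverses the orbit and therefore fixes a point on it, at which the kernel of the gradients is too big.\<close>

lemma no_symmetric_return:
  fixes G :: "'s \<Rightarrow> real^'i \<Rightarrow> real" and \<sigma> :: "'i::finite \<Rightarrow> 's"
  assumes \<Omega>: "open \<Omega>" and \<sigma>: "\<And>i. i \<noteq> k \<Longrightarrow> \<sigma> i \<in> S"
    and an: "\<And>s. s \<in> S \<Longrightarrow> analytic_vec_on \<Omega> (G s)"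
    and K: "K = {x. \<forall>s\<in>S. G s x = G s p}" "K \<subseteq> \<Omega>" "compact K"
    and W: "W = kernel_field (\<lambda>i. G (\<sigma> i)) k"
    and ker: "\<And>s x. s \<in> S \<Longrightarrow> x \<in> \<Omega> \<Longrightarrow> grad (G s) x \<bullet> W x = 0"
    and nz: "\<And>x. x \<in> K \<Longrightarrow> W x \<noteq> 0"
    and f: "continuous_on UNIV f" "open \<Omega>'" "analytic_vec_on \<Omega>' f" "\<And>x. f x = f p \<Longrightarrow> x \<in> \<Omega>'"
    and trans: "grad f p \<bullet> W p \<noteq> 0"
    and sym: "\<And>q. q \<in> K \<Longrightarrow> f q = f p \<Longrightarrow> \<exists>M. linear M \<and> inj M \<and> M p = q \<and>
       (\<forall>s\<in>S. \<forall>x. G s (M x) = G s x) \<and> (\<forall>x. f (M x) = f x) \<and>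
       (M = id \<or> (\<exists>u v. \<forall>a b. a *\<^sub>R (M u - u) + b *\<^sub>R (M v - v) = 0 \<longrightarrow> a = 0 \<and> b = 0))"
  shows False
proof -
  have an\<sigma>: "analytic_vec_on \<Omega> (G (\<sigma> i))" if "i \<noteq> k" for i using an \<sigma>[OF that] by blast
  have Wj: "analytic_vec_on \<Omega> (\<lambda>x. W x $ j)" for j
    unfolding W using an\<sigma> by (rule analytic_vec_on_kernel_field)
  have pK: "p \<in> K" by (simp add: K(1))
  obtain V L B where L: "L > 0" and lip: "\<And>x y. norm (V x - V y) \<le> L * norm (x - y)"
     and B: "\<And>x. norm (V x) \<le> B"
     and VW: "\<And>x. x \<in> K \<Longrightarrow> V x = W x" and Vc: "\<And>x. \<exists>c. V x = c *\<^sub>R W x"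
    using lipschitz_cutoff[OF \<Omega> K(3) _ K(2) analytic_vec_field_C1[OF Wj \<Omega>]] pK
    by (metis empty_iff)
  have kerV: "grad (G s) x \<bullet> V x = 0" if "s \<in> S" "x \<in> \<Omega>" for s x
    using ker[OF that] Vc[of x] by auto
  have ex: "\<exists>\<gamma>. \<gamma> 0 = q \<and> (\<forall>t. \<gamma> t \<in> K) \<and> (\<forall>t. (\<gamma> has_vector_derivative W (\<gamma> t)) (at t))" if q: "q \<in> K" for q
  proof -
    obtain \<gamma> where \<gamma>0: "\<gamma> 0 = q" and \<gamma>: "\<And>t. (\<gamma> has_vector_derivative V (\<gamma> t)) (at t)"
      using lipschitz_ode_global_solution[OF lip L B, of q] by blast
    have "\<gamma> t \<in> K" for t
    proof (rule flow_stays_in_fibre[where g = G and c = "\<lambda>s. G s p" and G = "\<lambda>s. grad (G s)" and V = V])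
      show "(G s has_derivative (\<bullet>) (grad (G s) x)) (at x)" if "s \<in> S" "x \<in> \<Omega>" for s x
        using analytic_vec_has_derivative[OF an[OF that(1)] \<Omega> that(2)] .
    qed (use \<Omega> K kerV \<gamma> \<gamma>0 q compact_imp_closed in auto)
    then show ?thesis using \<gamma>0 \<gamma> VW by (intro exI[of _ \<gamma>]) metis
  qed
  have uniq: "\<gamma> t = \<eta> t" if "\<And>t. \<gamma> t \<in> K" "\<And>t. \<eta> t \<in> K"
     "\<And>t. (\<gamma> has_vector_derivative W (\<gamma> t)) (at t)"
     "\<And>t. (\<eta> has_vector_derivative W (\<eta> t)) (at t)" "\<gamma> a = \<eta> a" for \<gamma> \<eta> a t
    by (rule lipschitz_ode_unique[of V L \<gamma> \<eta> a t]) (use lip that VW in auto)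
  obtain \<gamma> where \<gamma>0: "\<gamma> 0 = p" and \<gamma>K: "\<And>t. \<gamma> t \<in> K"
    and \<gamma>: "\<And>t. (\<gamma> has_vector_derivative W (\<gamma> t)) (at t)"
    using ex[OF pK] by blast
  have inj: "\<exists>r>0. \<forall>x\<in>K \<inter> ball q r. \<forall>y\<in>K \<inter> ball q r. W q \<bullet> x = W q \<bullet> y \<longrightarrow> x = y"
    if q: "q \<in> K" for q
  proof -
    obtain r where "r > 0" and r: "\<And>x y. x \<in> ball q r \<Longrightarrow> y \<in> ball q r \<Longrightarrow>
       (\<And>i. i \<noteq> k \<Longrightarrow> G (\<sigma> i) x = G (\<sigma> i) y) \<Longrightarrow> W q \<bullet> x = W q \<bullet> y \<Longrightarrow> x = y"
      using kernel_field_locally_injective[of k \<Omega> "\<lambda>i. G (\<sigma> i)" q] an\<sigma> \<Omega> K(2) q nz[OF q]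
      unfolding W by blast
    moreover have "G (\<sigma> i) x = G (\<sigma> i) y" if "x \<in> K" "y \<in> K" "i \<noteq> k" for x y i
      using that \<sigma> by (simp add: K(1))
    ultimately show ?thesis by (intro exI[of _ r]) blast
  qed
  obtain P where P: "P > 0" "\<And>t. \<gamma> (t + P) = \<gamma> t"
  proof -
    have "\<exists>P>0. \<forall>t. \<gamma> (t + P) = \<gamma> t"
      by (rule periodic_orbit_of_locally_injective[of K W]) (fact K(3) ex uniq inj nz \<gamma>K \<gamma>)+
    then show thesis using that by blast
  qed
  have c\<gamma>: "continuous_on UNIV \<gamma>"
    using \<gamma> has_vector_derivative_continuous continuous_at_imp_continuous_on by metis
  have derf: "((\<lambda>t. f (\<gamma> t)) has_real_derivative grad f (\<gamma> t) \<bullet> W (\<gamma> t)) (at t)" if "f (\<gamma> t) = f p" for t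
    using has_vector_derivative_grad_compose[OF analytic_vec_has_derivative[OF f(3,2) f(4)[OF that]] \<gamma>] .
  define c where "c = grad f p \<bullet> W p"
  have "continuous_on UNIV (\<lambda>t. f (\<gamma> t))"
    using continuous_on_compose2[OF f(1) c\<gamma>] by simp
  moreover have "((\<lambda>t. f (\<gamma> t)) has_real_derivative c) (at 0)"
    using derf[of 0] \<gamma>0 by (simp add: c_def)
  moreover have c: "c \<noteq> 0" using trans by (simp add: c_def)
  ultimately obtain t0 where "f (\<gamma> t0) = f (\<gamma> 0)"
      "\<And>d. ((\<lambda>t. f (\<gamma> t)) has_real_derivative d) (at t0) \<Longrightarrow> c * d \<le> 0"
    using periodic_function_first_return[of "\<lambda>t. f (\<gamma> t)" P c] P by metis
  then have t0: "f (\<gamma> t0) = f p" "c * (grad f (\<gamma> t0) \<bullet> W (\<gamma> t0)) \<le> 0"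
    using derf[of t0] \<gamma>0 by auto
  obtain M where M: "linear M" "inj M" "M p = \<gamma> t0"
      and MG: "\<And>s x. s \<in> S \<Longrightarrow> G s (M x) = G s x" and Mf: "\<And>x. f (M x) = f x"
      and Mid: "M = id \<or> (\<exists>u v. \<forall>a b. a *\<^sub>R (M u - u) + b *\<^sub>R (M v - v) = 0 \<longrightarrow> a = 0 \<and> b = 0)"
    using sym[OF \<gamma>K t0(1)] by blast
  have MK: "M x \<in> K" if "x \<in> K" for x using that MG by (simp add: K(1))
  \<comment> \<open>\<open>M\<close> carries \<open>W\<close> to \<open>d\<close> times
    \<open>W\<close>, so the crossing speed of \<open>f\<close> at the return point is
    \<open>c / d\<close>. The return has \<open>c * (c / d) \<le> 0\<close>, which forces
    \<open>d < 0\<close>.\<close>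
  define d where "d = det (matrix M)"
  have "d \<noteq> 0"
    unfolding d_def using M(1,2) det_nz_iff_inj by blast
  have MW: "d *\<^sub>R W (M x) = M (W x)" if x: "x \<in> K" for x
    unfolding W d_def
  proof (rule kernel_field_symmetric[OF M(1)])
    show "grad (G (\<sigma> i)) (M x) \<bullet> M u = grad (G (\<sigma> i)) x \<bullet> u" if "i \<noteq> k" for i u
      by (rule grad_symmetric[OF an\<sigma>[OF that] \<Omega>]) (use x MK K(2) M(1) MG[OF \<sigma>[OF that]] in auto)
  qed
  have "grad f (M p) \<bullet> M (W p) = c"
    unfolding c_def using f(4)[of p] f(4)[of "M p"] Mf M(1)
    by (intro grad_symmetric[OF f(3,2)]) auto
  then have "d * (grad f (\<gamma> t0) \<bullet> W (\<gamma> t0)) = c"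
    using MW[OF pK] M(3) by (metis inner_scaleR_right)
  then have "grad f (\<gamma> t0) \<bullet> W (\<gamma> t0) = c / d" using \<open>d \<noteq> 0\<close> by (simp add: field_simps)
  then have "d < 0"
    using t0(2) c \<open>d \<noteq> 0\<close> by (simp add: divide_le_0_iff flip: power2_eq_square)
  then have "M \<noteq> id" by (auto simp: d_def matrix_id_mat_1)
  then obtain u v where uv: "\<And>a b. a *\<^sub>R (M u - u) + b *\<^sub>R (M v - v) = 0 \<Longrightarrow> a = 0 \<and> b = 0"
    using Mid by blast
  \<comment> \<open>Both sides solve the equation of \<open>W\<close> and start at
    \<open>M p = \<gamma> t0\<close>; slowing time by \<open>1 / d\<close> compensates the factor
    \<open>d\<close>.\<close>
  have "M (\<gamma> (1 / d * s + 0)) = \<gamma> (1 * s + t0)" for s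
  proof (rule uniq[of "\<lambda>s. M (\<gamma> (1 / d * s + 0))" "\<lambda>s. \<gamma> (1 * s + t0)" 0])
    fix t
    show "((\<lambda>s. \<gamma> (1 * s + t0)) has_vector_derivative W (\<gamma> (1 * t + t0))) (at t)"
      using has_vector_derivative_affine_reparam[of \<gamma> W 1 t0 t] \<gamma> by simp
    have "((\<lambda>s. \<gamma> (1 / d * s + 0)) has_vector_derivative (1 / d) *\<^sub>R W (\<gamma> (1 / d * t + 0))) (at t)"
      using has_vector_derivative_affine_reparam[of \<gamma> W "1 / d" 0 t] \<gamma> by simp
    then have "((\<lambda>s. M (\<gamma> (1 / d * s + 0))) has_vector_derivative M ((1 / d) *\<^sub>R W (\<gamma> (1 / d * t + 0)))) (at t)"
      using bounded_linear.has_vector_derivative[of M] M(1) by (simp add: linear_conv_bounded_linear)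
    moreover have "M ((1 / d) *\<^sub>R W (\<gamma> (1 / d * t + 0))) = W (M (\<gamma> (1 / d * t + 0)))"
      unfolding linear_scale[OF M(1)] MW[OF \<gamma>K, symmetric] using \<open>d \<noteq> 0\<close> by simp
    ultimately show "((\<lambda>s. M (\<gamma> (1 / d * s + 0))) has_vector_derivative W (M (\<gamma> (1 / d * t + 0)))) (at t)"
      by simp
  qed (use \<gamma>K MK M(3) \<gamma>0 in auto)
  \<comment> \<open>This parameter solves \<open>s / d = s + t0\<close>, so both sides speak of the
    same point of the orbit. The denominator is negative because \<open>d < 0\<close>.\<close>
  from this[of "t0 / (1 / d - 1)"]
  have "M (\<gamma> (1 / d * (t0 / (1 / d - 1)))) = \<gamma> (t0 / (1 / d - 1) + t0)" by simp
  moreover have "t0 / (1 / d - 1) + t0 = 1 / d * (t0 / (1 / d - 1))"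
    using \<open>d < 0\<close> by (simp add: field_simps)
  ultimately obtain x where x: "x \<in> K" "M x = x" using \<gamma>K by metis
  \<comment> \<open>Differentiating the invariance under \<open>M\<close> at a fixed point: every
    displacement \<open>M w - w\<close> lies in the kernel of the gradients, which is the line
    spanned by \<open>W x\<close>.\<close>
  have orth: "grad (G (\<sigma> i)) x \<bullet> (M w - w) = 0" if "i \<noteq> k" for i w
  proof -
    have "grad (G (\<sigma> i)) (M x) \<bullet> M w = grad (G (\<sigma> i)) x \<bullet> w"
      by (rule grad_symmetric[OF an\<sigma>[OF that] \<Omega>]) (use x MK K(2) M(1) MG[OF \<sigma>[OF that]] in auto)
    then show ?thesis using x by (simp add: inner_diff_right)
  qed
  have zero: "w = 0" if w: "\<And>i. i \<noteq> k \<Longrightarrow> grad (G (\<sigma> i)) x \<bullet> w = 0" "W x \<bullet> w = 0" for w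
  proof -
    have "det (\<chi> i. if i = k then W x else grad (G (\<sigma> i)) x) = W x \<bullet> W x"
      unfolding W by (simp add: inner_kernel_field)
    then have "det (\<chi> i. if i = k then W x else grad (G (\<sigma> i)) x) \<noteq> 0"
      using nz[OF x(1)] by simp
    then show ?thesis unfolding det_nonzero_rows using w by auto
  qed
  \<comment> \<open>The coefficients make the combination of the two displacements orthogonal to
    \<open>W x\<close> as well, hence zero, against their independence.\<close>
  let ?a = "W x \<bullet> (M v - v)" and ?b = "- (W x \<bullet> (M u - u))"
  have "?a *\<^sub>R (M u - u) + ?b *\<^sub>R (M v - v) = 0"
  proof (rule zero)
    show "grad (G (\<sigma> i)) x \<bullet> (?a *\<^sub>R (M u - u) + ?b *\<^sub>R (M v - v)) = 0" if "i \<noteq> k" for i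
      by (simp only: inner_add_right inner_scaleR_right orth[OF that] mult_zero_right add_0)
    show "W x \<bullet> (?a *\<^sub>R (M u - u) + ?b *\<^sub>R (M v - v)) = 0"
      unfolding inner_add_right inner_scaleR_right by simp
  qed
  then have "?a = 0" "?b = 0" using uv by blast+
  then have "M u - u = 0" using orth by (intro zero) auto
  then show False using uv[of 1 0] by simp
qed

section \<open>Analyticity of distances\<close>

lemma line_holomorphic_sum:
  assumes "\<And>k. k \<in> A \<Longrightarrow> line_holomorphic U (F k)"
  shows "line_holomorphic U (\<lambda>z. \<Sum>k\<in>A. F k z)"
  using assms by (induction A rule: infinite_finite_induct)
     (auto intro: line_holomorphic_const line_holomorphic_add)

lemma line_holomorphic_prod:
  assumes "\<And>k. k \<in> A \<Longrightarrow> line_holomorphic U (F k)"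
  shows "line_holomorphic U (\<lambda>z. \<Prod>k\<in>A. F k z)"
  using assms by (induction A rule: infinite_finite_induct)
     (auto intro: line_holomorphic_const line_holomorphic_mult)

lemma line_holomorphic_power:
  assumes "line_holomorphic U F"
  shows "line_holomorphic U (\<lambda>z. F z ^ n)"
  by (induction n) (auto intro: line_holomorphic_const line_holomorphic_mult assms)

lemma line_holomorphic_uniform_limit:
  fixes f :: "'n \<Rightarrow> complex^'i \<Rightarrow> complex"
  assumes f: "\<And>n. line_holomorphic U (f n)" and U: "open U"
    and lim: "uniform_limit U f g F" and F: "F \<noteq> bot"
  shows "line_holomorphic U g"
  unfolding line_holomorphic_def
proof (intro conjI ballI allI)
  show "continuous_on U g"
    by (rule uniform_limit_theorem[OF _ lim F]) (use f in \<open>auto simp: line_holomorphic_def\<close>)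
  fix z u assume z: "z \<in> U"
  have "open {w. z + w *s u \<in> U}" "0 \<in> {w. z + w *s u \<in> U}"
    using open_line_preimage[OF U] z by auto
  then obtain e where e: "e > 0" "cball 0 e \<subseteq> {w. z + w *s u \<in> U}"
    by (meson open_contains_cball)
  have hol: "(\<lambda>w. f n (z + w *s u)) holomorphic_on cball 0 e" for n
    by (rule line_holomorphic_imp_holomorphic[OF f]) (use e in auto)
  have "uniform_limit (cball 0 e) (\<lambda>n w. f n (z + w *s u)) (\<lambda>w. g (z + w *s u)) F"
    using uniform_limit_compose'[OF lim, of "\<lambda>w. z + w *s u" "cball 0 e"] e by auto
  then have "(\<lambda>w. g (z + w *s u)) holomorphic_on ball 0 e"
    by (rule holomorphic_uniform_limit[rotated, OF _ F])
       (use hol in \<open>auto intro!: always_eventually holomorphic_on_imp_continuous_on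
          intro: holomorphic_on_subset[OF hol]\<close>)
  then show "(\<lambda>w. g (z + w *s u)) field_differentiable at 0"
    using e(1) by (meson centre_in_ball holomorphic_on_imp_differentiable_at open_ball)
qed

lemma line_holomorphic_local:
  assumes "\<And>z. z \<in> U \<Longrightarrow> \<exists>V. open V \<and> z \<in> V \<and> line_holomorphic V F"
  shows "line_holomorphic U F"
  unfolding line_holomorphic_def
proof (intro conjI ballI allI)
  show "continuous_on U F"
  proof (rule continuous_at_imp_continuous_on, rule ballI)
    fix z assume "z \<in> U"
    then obtain V where "open V" "z \<in> V" "continuous_on V F"
      using assms unfolding line_holomorphic_def by blast
    then show "isCont F z" by (simp add: continuous_on_eq_continuous_at)
  qed
  show "(\<lambda>w. F (z + w *s u)) field_differentiable at 0" if "z \<in> U" for z u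
    using assms[OF that] unfolding line_holomorphic_def by blast
qed

text \<open>Unconditional convergence over the reals is absolute. At the point with all coordinates
  \<open>s < r\<close> it dominates the complex series on the polydisc of radius \<open>s\<close>,
  and the Weierstrass test gives uniform convergence there.\<close>

lemma line_holomorphic_power_series:
  fixes \<tau> :: "'b \<Rightarrow> complex^'i \<Rightarrow> complex" and c :: "('b \<Rightarrow> nat) \<Rightarrow> real"
  assumes B: "finite B" and r: "r > 0"
    and c: "\<And>t. (\<forall>b\<in>B. \<bar>t b\<bar> < r) \<Longrightarrow> (\<lambda>\<alpha>. c \<alpha> * (\<Prod>b\<in>B. t b ^ \<alpha> b)) summable_on A"
    and \<tau>: "\<And>b. line_holomorphic UNIV (\<tau> b)"
  shows "line_holomorphic {z. \<forall>b\<in>B. norm (\<tau> b z) < r}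
    (\<lambda>z. \<Sum>\<^sub>\<infinity>\<alpha>\<in>A. of_real (c \<alpha>) * (\<Prod>b\<in>B. \<tau> b z ^ \<alpha> b))"
proof (rule line_holomorphic_local)
  fix z assume "z \<in> {z. \<forall>b\<in>B. norm (\<tau> b z) < r}"
  then have z: "\<And>b. b \<in> B \<Longrightarrow> norm (\<tau> b z) < r" by auto
  have "\<exists>s. 0 < s \<and> s < r \<and> (\<forall>b\<in>B. norm (\<tau> b z) < s)"
    using B z
  proof (induction B)
    case empty
    then show ?case using r dense by auto
  next
    case (insert b B)
    then obtain s where "0 < s" "s < r" "\<forall>b\<in>B. norm (\<tau> b z) < s" by auto
    moreover obtain s' where "norm (\<tau> b z) < s'" "s' < r" using insert.prems[of b] dense[of "norm (\<tau> b z)" r] by blast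
    ultimately show ?case by (intro exI[of _ "max s s'"]) (auto simp: less_max_iff_disj)
  qed
  then obtain s where s: "0 < s" "s < r" "\<And>b. b \<in> B \<Longrightarrow> norm (\<tau> b z) < s" by blast
  let ?V = "{z. \<forall>b\<in>B. norm (\<tau> b z) < s}"
  have cont: "continuous_on UNIV (\<tau> b)" for b using \<tau> by (simp add: line_holomorphic_def)
  have "open (\<Inter>b\<in>B. {z. norm (\<tau> b z) < s})"
    using B cont by (intro open_INT ballI open_Collect_less) (auto intro!: continuous_intros)
  then have V: "open ?V" by (simp add: Collect_ball_eq)
  have "(\<lambda>\<alpha>. c \<alpha> * (\<Prod>b\<in>B. s ^ \<alpha> b)) summable_on A"
    using c[of "\<lambda>_. s"] s by auto
  then have sm: "(\<lambda>\<alpha>. norm (c \<alpha> * (\<Prod>b\<in>B. s ^ \<alpha> b))) summable_on A"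
    by (rule summable_on_iff_abs_summable_on_real[THEN iffD1])
  have bd: "norm (of_real (c \<alpha>) * (\<Prod>b\<in>B. \<tau> b y ^ \<alpha> b)) \<le> norm (c \<alpha> * (\<Prod>b\<in>B. s ^ \<alpha> b))"
    if "y \<in> ?V" for \<alpha> y
  proof -
    have "(\<Prod>b\<in>B. norm (\<tau> b y) ^ \<alpha> b) \<le> (\<Prod>b\<in>B. s ^ \<alpha> b)"
      using that by (intro prod_mono conjI power_mono) (auto simp: less_imp_le)
    then show ?thesis
      using s(1) by (simp add: norm_mult prod_norm[symmetric] norm_power mult_left_mono abs_mult
          abs_prod prod_nonneg)
  qed
  have "uniform_limit ?V (\<lambda>X y. \<Sum>\<alpha>\<in>X. of_real (c \<alpha>) * (\<Prod>b\<in>B. \<tau> b y ^ \<alpha> b))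
      (\<lambda>y. \<Sum>\<^sub>\<infinity>\<alpha>\<in>A. of_real (c \<alpha>) * (\<Prod>b\<in>B. \<tau> b y ^ \<alpha> b)) (finite_subsets_at_top A)"
    using bd sm by (intro Weierstrass_m_test_general) auto
  then have "line_holomorphic ?V (\<lambda>y. \<Sum>\<^sub>\<infinity>\<alpha>\<in>A. of_real (c \<alpha>) * (\<Prod>b\<in>B. \<tau> b y ^ \<alpha> b))"
  proof (rule line_holomorphic_uniform_limit[rotated 2])
    show "line_holomorphic ?V (\<lambda>y. \<Sum>\<alpha>\<in>X. of_real (c \<alpha>) * (\<Prod>b\<in>B. \<tau> b y ^ \<alpha> b))" for X
      by (intro line_holomorphic_sum line_holomorphic_mult line_holomorphic_const
          line_holomorphic_prod line_holomorphic_power line_holomorphic_subset[OF \<tau>] subset_UNIV)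
  qed (use V in auto)
  then show "\<exists>V. open V \<and> z \<in> V \<and>
      line_holomorphic V (\<lambda>z. \<Sum>\<^sub>\<infinity>\<alpha>\<in>A. of_real (c \<alpha>) * (\<Prod>b\<in>B. \<tau> b z ^ \<alpha> b))"
    using V s(3) by (intro exI[of _ ?V]) auto
qed

lemma negligible_linear_kernel:
  fixes L :: "'n::euclidean_space \<Rightarrow> 'b::real_normed_vector"
  assumes "linear L" "L y \<noteq> 0"
  shows "negligible {x. L x = 0}"
proof (rule negligible_lowdim)
  have sub: "subspace {x. L x = 0}" using assms(1) by (rule linear_subspace_kernel)
  have "span {x. L x = 0} \<noteq> UNIV"
    using assms(2) sub span_eq_iff[of "{x. L x = 0}"] by (metis UNIV_I mem_Collect_eq)
  then show "dim {x. L x = 0} < DIM('n)"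
    using dim_eq_full[of "{x. L x = 0}"] dim_subset_UNIV[of "{x. L x = 0}"] by linarith
qed

text \<open>The space X is only a normed vector type, so configurations are moved to
  \<open>real^'i\<close>, where measure and differentiation theory are available;
  \<open>\<iota>\<close> numbers the pairs of basis vector and vertex. The sort
  \<open>wellorder\<close> is the one that the Sard theorem asks of its index type.\<close>

locale framework_coordinates =
  fixes B :: "'a::real_normed_vector set" and \<iota> :: "'a \<times> 'v::finite \<Rightarrow> 'i::{finite,wellorder}"
  assumes finite_B: "finite B" and independent_B: "independent B" and span_B: "span B = UNIV"
    and bij_\<iota>: "bij_betw \<iota> (B \<times> UNIV) UNIV"
    and norm_power_series: "\<And>a. a \<noteq> 0 \<Longrightarrow> \<exists>r>0. \<exists>c :: ('a \<Rightarrow> nat) \<Rightarrow> real.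
        \<forall>t :: 'a \<Rightarrow> real. (\<forall>b\<in>B. \<bar>t b\<bar> < r) \<longrightarrow>
          ((\<lambda>\<alpha>. c \<alpha> * (\<Prod>b\<in>B. t b ^ \<alpha> b)) has_sum norm (a + (\<Sum>b\<in>B. t b *\<^sub>R b)))
            (B \<rightarrow>\<^sub>E UNIV)"
    and card_B: "card B \<ge> 2" and card_V: "CARD('v) \<ge> 2"
begin

section \<open>Linear coordinates on the space of configurations\<close>

definition place :: "real^'i::{finite,wellorder} \<Rightarrow> 'a^'v" where
  "place x = (\<chi> v. \<Sum>b\<in>B. x $ \<iota> (b, v) *\<^sub>R b)"

definition coord :: "'a^'v \<Rightarrow> real^'i::{finite,wellorder}" where
  "coord y = (\<chi> i. representation B (y $ snd (inv_into (B \<times> UNIV) \<iota> i)) (fst (inv_into (B \<times> UNIV) \<iota> i)))"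

definition edge_length :: "'v \<times> 'v \<Rightarrow> real^'i::{finite,wellorder} \<Rightarrow> real" where
  "edge_length e x = norm (place x $ fst e - place x $ snd e)"

lemma linear_place: "linear place"
  by (rule linearI) (simp_all add: place_def vec_eq_iff scaleR_left_distrib sum.distrib scaleR_sum_right)

lemma inv_\<iota>: "b \<in> B \<Longrightarrow> inv_into (B \<times> UNIV) \<iota> (\<iota> (b, v)) = (b, v)"
  using bij_\<iota> by (simp add: bij_betw_def inv_into_f_f)

lemma place_coord [simp]: "place (coord y) = y"
proof -
  have "(\<Sum>b\<in>B. coord y $ \<iota> (b, v) *\<^sub>R b) = (\<Sum>b\<in>B. representation B (y $ v) b *\<^sub>R b)" for v
    by (rule sum.cong) (simp_all add: coord_def inv_\<iota>)
  then show ?thesis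
    using sum_representation_eq[OF independent_B _ finite_B] span_B
    by (simp add: place_def vec_eq_iff)
qed

lemma inj_place: "inj place"
proof (subst linear_injective_0[OF linear_place], intro allI impI)
  fix x assume x: "place x = 0"
  have "x $ i = 0" for i
  proof -
    have "i \<in> \<iota> ` (B \<times> UNIV)" using bij_\<iota> by (simp add: bij_betw_def)
    then obtain b v where b: "b \<in> B" "i = \<iota> (b, v)" by auto
    have "(\<Sum>b\<in>B. x $ \<iota> (b, v) *\<^sub>R b) = 0"
      using arg_cong[OF x, of "\<lambda>y. y $ v"] by (simp add: place_def)
    then show ?thesis
      using independentD[OF independent_B finite_B order_refl, of "\<lambda>b. x $ \<iota> (b, v)" b] b by simp
  qed
  then show "x = 0" by (simp add: vec_eq_iff)
qed

lemma coord_place [simp]: "coord (place x) = x"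
  using inj_place place_coord by (metis injD)

lemma linear_coord: "linear coord"
proof (rule linearI)
  show "coord (x + y) = coord x + coord y" for x y
    by (rule injD[OF inj_place]) (simp add: linear_add[OF linear_place])
  show "coord (r *\<^sub>R x) = r *\<^sub>R coord x" for r x
    by (rule injD[OF inj_place]) (simp add: linear_scale[OF linear_place])
qed

lemma continuous_place: "continuous_on S place"
  using linear_place by (simp add: linear_conv_bounded_linear linear_continuous_on)

lemma continuous_edge_length: "continuous_on S (edge_length e)"
  unfolding edge_length_def
  by (intro continuous_intros continuous_place)

lemma edge_length_sym: "edge_length (w, v) = edge_length (v, w)"
  by (simp add: edge_length_def fun_eq_iff norm_minus_commute)

lemma place_diff: "place x $ v - place x $ w = (\<Sum>b\<in>B. (x $ \<iota> (b, v) - x $ \<iota> (b, w)) *\<^sub>R b)"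
  by (simp add: place_def sum_subtractf scaleR_diff_left)

text \<open>In the power series of the norm at the edge vector \<open>a\<close> of
  \<open>x0\<close>, the variables are replaced by the affine complex functions
  \<open>\<tau> b\<close>, the increments of the coordinates of the edge vector. This provides the
  holomorphic extension.\<close>

lemma analytic_edge_length:
  "analytic_vec_on {x. place x $ v \<noteq> place x $ w} (edge_length (v, w))"
  unfolding analytic_vec_on_def
proof
  fix x0 assume x0: "x0 \<in> {x. place x $ v \<noteq> place x $ w}"
  define a where "a = place x0 $ v - place x0 $ w"
  have "a \<noteq> 0" using x0 by (simp add: a_def)
  then obtain r and c :: "('a \<Rightarrow> nat) \<Rightarrow> real" where r: "r > 0" and c: "\<And>t. (\<forall>b\<in>B. \<bar>t b\<bar> < r) \<Longrightarrow>
      ((\<lambda>\<alpha>. c \<alpha> * (\<Prod>b\<in>B. t b ^ \<alpha> b)) has_sum norm (a + (\<Sum>b\<in>B. t b *\<^sub>R b))) (B \<rightarrow>\<^sub>E UNIV)"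
    using norm_power_series[of a] by blast
  define k where "k b = x0 $ \<iota> (b, v) - x0 $ \<iota> (b, w)" for b
  define \<tau> where "\<tau> b z = z $ \<iota> (b, v) + (-1) * z $ \<iota> (b, w) + of_real (- k b)"
    for b and z :: "complex^'i::{finite,wellorder}"
  have \<tau>: "line_holomorphic UNIV (\<tau> b)" for b
    unfolding \<tau>_def by (intro line_holomorphic_add line_holomorphic_mult line_holomorphic_const line_holomorphic_nth)
  let ?F = "\<lambda>z. \<Sum>\<^sub>\<infinity>\<alpha>\<in>B \<rightarrow>\<^sub>E UNIV. of_real (c \<alpha>) * (\<Prod>b\<in>B. \<tau> b z ^ \<alpha> b)"
  let ?U = "{z. \<forall>b\<in>B. norm (\<tau> b z) < r}"
  have F: "line_holomorphic ?U ?F"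
    by (rule line_holomorphic_power_series[OF finite_B r _ \<tau>]) (use c summable_on_def in blast)
  have "open (\<Inter>b\<in>B. {z. norm (\<tau> b z) < r})"
    using finite_B \<tau> by (intro open_INT ballI open_Collect_less)
      (auto simp: line_holomorphic_def intro!: continuous_intros)
  then have U: "open ?U" by (simp add: Collect_ball_eq)
  have \<tau>r: "\<tau> b (complex_vec x) = of_real ((x $ \<iota> (b, v) - x $ \<iota> (b, w)) - k b)" for b x
    by (simp add: \<tau>_def complex_vec_def)
  have "?F (complex_vec x) = of_real (edge_length (v, w) x)" if x: "complex_vec x \<in> ?U" for x
  proof -
    define t where "t b = (x $ \<iota> (b, v) - x $ \<iota> (b, w)) - k b" for b
    have "\<forall>b\<in>B. \<bar>t b\<bar> < r" using x unfolding mem_Collect_eq \<tau>r t_def norm_of_real by simp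
    from c[OF this] have "((\<lambda>\<alpha>. of_real (c \<alpha> * (\<Prod>b\<in>B. t b ^ \<alpha> b))) has_sum
        complex_of_real (norm (a + (\<Sum>b\<in>B. t b *\<^sub>R b)))) (B \<rightarrow>\<^sub>E UNIV)"
      by (rule has_sum_bounded_linear[OF bounded_linear_of_real])
    then have "?F (complex_vec x) = of_real (norm (a + (\<Sum>b\<in>B. t b *\<^sub>R b)))"
      by (intro infsumI) (simp add: \<tau>r t_def)
    also have "a + (\<Sum>b\<in>B. t b *\<^sub>R b) = place x $ v - place x $ w"
      by (simp add: a_def t_def k_def place_diff scaleR_diff_left sum_subtractf)
    finally show ?thesis by (simp add: edge_length_def)
  qed
  moreover have "complex_vec x0 \<in> ?U" using r unfolding mem_Collect_eq \<tau>r k_def by simp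
  ultimately show "\<exists>U F. open U \<and> complex_vec x0 \<in> U \<and> line_holomorphic U F \<and>
      (\<forall>x. complex_vec x \<in> U \<longrightarrow> F (complex_vec x) = of_real (edge_length (v, w) x))"
    using U F by (intro exI[of _ ?U] exI[of _ ?F] conjI allI impI)
qed

lemma open_nondegenerate: "open {x. place x $ v \<noteq> place x $ w}"
  by (intro open_Collect_neq continuous_intros continuous_place)

section \<open>Support functionals and isometries\<close>

definition single :: "'v \<Rightarrow> 'a \<Rightarrow> 'a^'v" where
  "single v y = (\<chi> w. if w = v then y else 0)"

lemma linear_single: "linear (single v)"
  by (rule linearI) (auto simp: single_def vec_eq_iff)

lemma obtain_distinct_vertices:
  obtains v w :: 'v where "v \<noteq> w"
  using card_V by (metis card_2_iff' ex_card UNIV_I subset_UNIV)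

lemma norm_has_directional_derivative:
  assumes "place x $ v \<noteq> place x $ w"
  shows "((\<lambda>t. norm ((place x $ v - place x $ w) + t *\<^sub>R (place y $ v - place y $ w)))
     has_real_derivative grad (edge_length (v, w)) x \<bullet> y) (at 0)"
proof -
  have eq: "edge_length (v, w) (x + t *\<^sub>R y) =
      norm ((place x $ v - place x $ w) + t *\<^sub>R (place y $ v - place y $ w))" for t
    by (simp add: edge_length_def linear_add[OF linear_place] linear_scale[OF linear_place] algebra_simps)
  have "((\<lambda>t. edge_length (v, w) (x + t *\<^sub>R y)) has_real_derivative
      dir_deriv y (edge_length (v, w)) x) (at 0)"
    using analytic_vec_has_real_derivative_0[OF analytic_edge_length] assms by simp
  also have "dir_deriv y (edge_length (v, w)) x = grad (edge_length (v, w)) x \<bullet> y"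
    using dir_deriv_eq_grad[OF analytic_edge_length open_nondegenerate] assms by simp
  finally show ?thesis by (simp add: eq)
qed

text \<open>With d the edge vector, the function
  \<open>norm d * norm (d + t u) - f (d + t u)\<close> is non-negative and vanishes at
  \<open>t = 0\<close>, so its derivative there is 0.\<close>

lemma support_functional_eq_grad:
  assumes ne: "place x $ v \<noteq> place x $ w" and f: "support_functional (place x $ v - place x $ w) f"
  shows "blinfun_apply f (place y $ v - place y $ w) =
     norm (place x $ v - place x $ w) * (grad (edge_length (v, w)) x \<bullet> y)"
proof -
  let ?d = "place x $ v - place x $ w" and ?u = "place y $ v - place y $ w"
  let ?h = "\<lambda>t. norm ?d * norm (?d + t *\<^sub>R ?u) - (blinfun_apply f ?d + t * blinfun_apply f ?u)"
  have "(?h has_real_derivative norm ?d * (grad (edge_length (v, w)) x \<bullet> y) - blinfun_apply f ?u) (at 0)"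
    using norm_has_directional_derivative[OF ne, of y] by (auto intro!: derivative_eq_intros)
  then have "norm ?d * (grad (edge_length (v, w)) x \<bullet> y) - blinfun_apply f ?u = 0"
  proof (rule DERIV_local_min[OF _ zero_less_one], intro allI impI)
    fix t
    have "blinfun_apply f (?d + t *\<^sub>R ?u) \<le> norm f * norm (?d + t *\<^sub>R ?u)"
      using norm_blinfun[of f "?d + t *\<^sub>R ?u"] by simp
    then have "0 \<le> ?h t"
      using f by (simp add: support_functional_def blinfun.add_right blinfun.scaleR_right)
    moreover have "?h 0 = 0" using f by (simp add: support_functional_def power2_eq_square)
    ultimately show "?h 0 \<le> ?h t" by linarith
  qed
  then show ?thesis by simp
qed

text \<open>The derivative \<open>G\<close> of the norm at \<open>d\<close>, times
  \<open>norm d\<close>, is a support functional: the triangle inequality bounds it, and moving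
  along \<open>d\<close> itself gives its value at \<open>d\<close>. Uniqueness is the previous
  lemma. Two distinct vertices serve to realise \<open>d\<close> as an edge vector.\<close>

lemma smooth_point_nonzero:
  fixes d :: 'a
  assumes d: "d \<noteq> 0"
  shows "smooth_point d"
proof -
  obtain v w :: 'v where vw: "v \<noteq> w" by (rule obtain_distinct_vertices)
  define x where "x = coord (single v d)"
  have ps: "place (coord (single v u)) $ v - place (coord (single v u)) $ w = u" for u
    using vw by (simp add: single_def)
  have x: "place x $ v - place x $ w = d" "place x $ v \<noteq> place x $ w"
    using ps[of d] d by (auto simp: x_def)
  define G where "G u = grad (edge_length (v, w)) x \<bullet> coord (single v u)" for u
  have der: "((\<lambda>t. norm (d + t *\<^sub>R u)) has_real_derivative G u) (at 0)" for u
    using norm_has_directional_derivative[OF x(2), of "coord (single v u)"]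
    unfolding x(1) ps G_def .
  have lin: "linear G"
    unfolding G_def
    by (rule linearI) (simp_all add: linear_add[OF linear_single] linear_scale[OF linear_single]
        linear_add[OF linear_coord] linear_scale[OF linear_coord] inner_add_right)
  have bd: "\<bar>G u\<bar> \<le> norm u" for u
  proof -
    have "((\<lambda>t. \<bar>(norm (d + t *\<^sub>R u) - norm d) / t\<bar>) \<longlongrightarrow> \<bar>G u\<bar>) (at 0)"
      using der[of u] by (intro tendsto_rabs) (simp add: DERIV_def)
    moreover have "\<forall>\<^sub>F t in at 0. \<bar>(norm (d + t *\<^sub>R u) - norm d) / t\<bar> \<le> norm u"
    proof (rule eventually_at_topological[THEN iffD2], intro exI[of _ UNIV] conjI ballI impI)
      fix t :: real assume "t \<noteq> 0"
      have "\<bar>norm (d + t *\<^sub>R u) - norm d\<bar> \<le> \<bar>t\<bar> * norm u"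
        using norm_triangle_ineq3[of "d + t *\<^sub>R u" d] by simp
      then show "\<bar>(norm (d + t *\<^sub>R u) - norm d) / t\<bar> \<le> norm u"
        using \<open>t \<noteq> 0\<close> by (simp add: abs_divide field_simps)
    qed auto
    ultimately show ?thesis by (rule tendsto_upperbound) simp
  qed
  have Gd: "G d = norm d"
  proof (rule DERIV_unique[OF der])
    have "((\<lambda>t. (1 + t) * norm d) has_real_derivative norm d) (at 0)"
      by (auto intro!: derivative_eq_intros)
    then show "((\<lambda>t. norm (d + t *\<^sub>R d)) has_real_derivative norm d) (at 0)"
    proof (rule has_field_derivative_transform_within_open[of _ _ _ "{-1<..<1}"])
      fix t :: real assume "t \<in> {-1<..<1}"
      then have "norm ((1 + t) *\<^sub>R d) = (1 + t) * norm d" by simp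
      then show "(1 + t) * norm d = norm (d + t *\<^sub>R d)" by (simp add: algebra_simps)
    qed auto
  qed
  have bl: "bounded_linear (\<lambda>u. norm d * G u)"
  proof (rule bounded_linear_intro[where K = "norm d"])
    show "norm (norm d * G u) \<le> norm u * norm d" for u
      using mult_left_mono[OF bd[of u] norm_ge_zero[of d]] by (simp add: abs_mult mult.commute)
  qed (use lin in \<open>auto simp: linear_add linear_scale algebra_simps\<close>)
  define f where "f = Blinfun (\<lambda>u. norm d * G u)"
  have f: "blinfun_apply f u = norm d * G u" for u
    using bl by (simp add: f_def bounded_linear_Blinfun_apply)
  have "norm f \<le> norm d"
    by (rule norm_blinfun_bound) (use mult_left_mono[OF bd norm_ge_zero[of d]] in \<open>auto simp: f abs_mult\<close>)
  moreover have "norm d * norm d \<le> norm f * norm d"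
    using norm_blinfun[of f d] by (simp add: f Gd)
  ultimately have "norm f = norm d" using d by (simp add: mult_le_cancel_right)
  then have "support_functional d f"
    by (simp add: support_functional_def f Gd power2_eq_square)
  moreover have "f' = f" if "support_functional d f'" for f'
  proof (rule blinfun_eqI)
    show "blinfun_apply f' u = blinfun_apply f u" for u
      using support_functional_eq_grad[OF x(2), of f' "coord (single v u)"] that
      unfolding x(1) ps by (simp add: f G_def)
  qed
  ultimately show ?thesis
    using d unfolding smooth_point_def by blast
qed

lemma the_support_functional_eq_grad:
  assumes "place x $ v \<noteq> place x $ w"
  shows "blinfun_apply (the_support_functional (place x $ v - place x $ w)) (place y $ v - place y $ w) =
     norm (place x $ v - place x $ w) * (grad (edge_length (v, w)) x \<bullet> y)"
proof (rule support_functional_eq_grad[OF assms])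
  have "\<exists>!f. support_functional (place x $ v - place x $ w) f"
    using smooth_point_nonzero[of "place x $ v - place x $ w"] assms by (simp add: smooth_point_def)
  then show "support_functional (place x $ v - place x $ w) (the_support_functional (place x $ v - place x $ w))"
    unfolding the_support_functional_def by (rule theI')
qed

text \<open>If the unit sphere contained a segment, the norm would by analyticity be constant along the
  whole line through it.\<close>

lemma norm_strictly_convex:
  fixes p q :: 'a
  assumes pq: "norm p = D" "norm q = D" and t: "0 < t" "t < 1" and m: "norm (q + t *\<^sub>R (p - q)) = D"
  shows "p = q"
proof (rule ccontr)
  assume "p \<noteq> q"
  define e where "e = p - q"
  define m where "m = q + t *\<^sub>R e"
  have e: "norm e > 0" using \<open>p \<noteq> q\<close> by (simp add: e_def)
  have le: "norm (q + s *\<^sub>R e) \<le> D" if "0 \<le> s" "s \<le> 1" for s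
  proof -
    have "q + s *\<^sub>R e = (1 - s) *\<^sub>R q + s *\<^sub>R p" by (simp add: e_def algebra_simps)
    then have "norm (q + s *\<^sub>R e) \<le> (1 - s) * norm q + s * norm p"
      using norm_triangle_ineq[of "(1 - s) *\<^sub>R q" "s *\<^sub>R p"] that by simp
    then show ?thesis using pq by (simp add: algebra_simps)
  qed
  define \<delta> where "\<delta> = min t (1 - t)"
  have \<delta>: "\<delta> > 0" using t by (simp add: \<delta>_def)
  \<comment> \<open>The points at parameters \<open>t + h\<close> and \<open>t - h\<close> have sum
    \<open>2 m\<close>, of norm \<open>2 D\<close>, while each has norm at most \<open>D\<close>; so
    both have norm exactly \<open>D\<close>.\<close>
  have const: "norm (m + h *\<^sub>R e) = D" if h: "\<bar>h\<bar> < \<delta>" for h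
  proof -
    have h': "0 \<le> t + h" "t + h \<le> 1" "0 \<le> t - h" "t - h \<le> 1"
      using h by (auto simp: \<delta>_def abs_less_iff)
    have "(q + (t + h) *\<^sub>R e) + (q + (t - h) *\<^sub>R e) = 2 *\<^sub>R m"
      unfolding m_def by (simp only: scaleR_add_left scaleR_diff_left scaleR_2) simp
    moreover have "norm (2 *\<^sub>R m) = 2 * D" using m by (simp add: m_def e_def)
    ultimately have "2 * D \<le> norm (q + (t + h) *\<^sub>R e) + norm (q + (t - h) *\<^sub>R e)"
      using norm_triangle_ineq[of "q + (t + h) *\<^sub>R e" "q + (t - h) *\<^sub>R e"] by simp
    then have "norm (q + (t + h) *\<^sub>R e) = D" using le[of "t + h"] le[of "t - h"] h' by linarith
    then show ?thesis by (simp add: m_def algebra_simps)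
  qed
  \<comment> \<open>The line must avoid 0, where analyticity fails. On a line through 0 the norm is
    a multiple of the absolute value of the parameter shifted by \<open>s\<close>, and this cannot
    agree at three distinct parameters.\<close>
  have nz: "m + s *\<^sub>R e \<noteq> 0" for s
  proof
    assume "m + s *\<^sub>R e = 0"
    then have "m + h *\<^sub>R e = (h - s) *\<^sub>R e" for h by (simp add: algebra_simps add_eq_0_iff)
    then have abs: "\<bar>h - s\<bar> * norm e = D" if "\<bar>h\<bar> < \<delta>" for h using const[OF that] by simp
    have "\<bar>0 - s\<bar> * norm e = \<bar>\<delta> / 2 - s\<bar> * norm e" "\<bar>0 - s\<bar> * norm e = \<bar>- \<delta> / 2 - s\<bar> * norm e"
      using abs[of 0] abs[of "\<delta> / 2"] abs[of "- \<delta> / 2"] \<delta> by auto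
    then have "\<bar>0 - s\<bar> = \<bar>\<delta> / 2 - s\<bar>" "\<bar>0 - s\<bar> = \<bar>- \<delta> / 2 - s\<bar>" using e by auto
    then show False using \<delta> by argo
  qed
  obtain v w :: 'v where vw: "v \<noteq> w" by (rule obtain_distinct_vertices)
  \<comment> \<open>Moving by \<open>R\<close> changes the point by a vector of norm
    \<open>2 D + 1\<close>, so the new norm is at least \<open>D + 1\<close>.\<close>
  define R where "R = (2 * D + 1) / norm e"
  have D: "D \<ge> 0" using pq by auto
  have R: "R > 0" using D e by (simp add: R_def)
  let ?x = "coord (single v m)" and ?y = "R *\<^sub>R coord (single v e)"
  have pl: "place (?x + h *\<^sub>R ?y) $ v - place (?x + h *\<^sub>R ?y) $ w = m + (h * R) *\<^sub>R e" for h
    using vw by (simp add: linear_add[OF linear_place] linear_scale[OF linear_place] single_def)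
  have an: "analytic_vec_on {x. place x $ v \<noteq> place x $ w} (\<lambda>x. edge_length (v, w) x + (- D))"
    by (intro analytic_vec_on_add analytic_edge_length analytic_vec_on_const)
  have "edge_length (v, w) (?x + ?y) + (- D) = 0"
  proof (rule analytic_vec_zero_on_segment[OF an, where e = "\<delta> / R"])
    show "?x + h *\<^sub>R ?y \<in> {x. place x $ v \<noteq> place x $ w}" for h
      using pl[of h] nz[of "h * R"] by auto
    show "edge_length (v, w) (?x + h *\<^sub>R ?y) + (- D) = 0" if "\<bar>h\<bar> < \<delta> / R" for h
      using const[of "h * R"] that R unfolding edge_length_def fst_conv snd_conv pl
      by (simp add: abs_mult field_simps)
  qed (use \<delta> R in simp)
  then have "norm (m + R *\<^sub>R e) = D"
    using pl[of 1] by (simp add: edge_length_def)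
  moreover have "norm (R *\<^sub>R e) = 2 * D + 1" using e D by (simp add: R_def)
  moreover have "norm m = D" using m by (simp add: m_def e_def)
  ultimately show False
    using norm_triangle_ineq2[of "R *\<^sub>R e" "- m"] by (simp add: add.commute)
qed

text \<open>The vectors \<open>z / t\<close> and \<open>(x - z) / (1 - t)\<close> both have norm
  \<open>norm x\<close>, and \<open>x\<close> is a proper convex combination of them; strict
  convexity identifies them.\<close>

lemma unique_between_point:
  fixes x z :: 'a
  assumes "norm z = t * norm x" "norm (x - z) = (1 - t) * norm x" "0 < t" "t < 1"
  shows "z = t *\<^sub>R x"
proof -
  have "(1 / t) *\<^sub>R z = (1 / (1 - t)) *\<^sub>R (x - z)"
  proof (rule norm_strictly_convex[where D = "norm x" and t = t])
    have "(1 / (1 - t)) *\<^sub>R (x - z) + t *\<^sub>R ((1 / t) *\<^sub>R z - (1 / (1 - t)) *\<^sub>R (x - z)) =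
        ((1 - t) * (1 / (1 - t))) *\<^sub>R (x - z) + (t * (1 / t)) *\<^sub>R z"
      by (simp only: scaleR_diff_right scaleR_scaleR left_diff_distrib scaleR_diff_left) simp
    also have "\<dots> = x" using assms(3,4) by simp
    finally show "norm ((1 / (1 - t)) *\<^sub>R (x - z) + t *\<^sub>R ((1 / t) *\<^sub>R z - (1 / (1 - t)) *\<^sub>R (x - z))) = norm x"
      by simp
  qed (use assms in auto)
  then have "(t * (1 - t)) *\<^sub>R ((1 / t) *\<^sub>R z) = (t * (1 - t)) *\<^sub>R ((1 / (1 - t)) *\<^sub>R (x - z))"
    by simp
  then have "(1 - t) *\<^sub>R z = t *\<^sub>R (x - z)" using assms(3,4) by simp
  then show ?thesis by (simp add: algebra_simps)
qed

text \<open>Distances determine where points between 0 and \<open>x\<close>, and midpoints, are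
  sent, by strict convexity. This gives additivity and homogeneity for factors in (0, 1), from which
  all other factors follow.\<close>

lemma isometry_linear_part:
  fixes g :: "'a \<Rightarrow> 'a"
  assumes g: "isometry g"
  shows "linear (\<lambda>x. g x - g 0)" "isometry (\<lambda>x. g x - g 0)"
proof -
  define T where "T x = g x - g 0" for x
  have d: "norm (T x - T y) = norm (x - y)" for x y
    using g by (simp add: isometry_def T_def dist_norm)
  have T0: "T 0 = 0" by (simp add: T_def)
  have n: "norm (T x) = norm x" for x using d[of x 0] T0 by simp
  have sc1: "T (t *\<^sub>R x) = t *\<^sub>R T x" if t: "0 < t" "t < 1" for t x
  proof (rule unique_between_point[OF _ _ t])
    show "norm (T (t *\<^sub>R x)) = t * norm (T x)" using t by (simp add: n)
    have "x - t *\<^sub>R x = (1 - t) *\<^sub>R x" by (simp add: algebra_simps)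
    then show "norm (T x - T (t *\<^sub>R x)) = (1 - t) * norm (T x)" using t by (simp add: d n)
  qed
  have mid: "T ((1/2) *\<^sub>R (x + y)) = (1/2) *\<^sub>R (T x + T y)" for x y
  proof -
    have "T ((1/2) *\<^sub>R (x + y)) - T y = (1/2) *\<^sub>R (T x - T y)"
    proof (rule unique_between_point)
      have "(1/2) *\<^sub>R (x + y) - y = (1/2) *\<^sub>R (x - y)" "x - (1/2) *\<^sub>R (x + y) = (1/2) *\<^sub>R (x - y)"
        by (simp_all add: algebra_simps flip: scaleR_add_left)
      then show "norm (T ((1/2) *\<^sub>R (x + y)) - T y) = 1/2 * norm (T x - T y)"
        "norm (T x - T y - (T ((1/2) *\<^sub>R (x + y)) - T y)) = (1 - 1/2) * norm (T x - T y)"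
        by (simp_all add: d)
    qed auto
    then have "T ((1/2) *\<^sub>R (x + y)) = (1/2) *\<^sub>R (T x - T y) + (1/2 + 1/2) *\<^sub>R T y"
      by (simp add: algebra_simps)
    then show ?thesis by (simp only: scaleR_add_left scaleR_diff_right scaleR_add_right) simp
  qed
  have add: "T (x + y) = T x + T y" for x y
  proof -
    have "(1/2) *\<^sub>R T (x + y) = (1/2) *\<^sub>R (T x + T y)" using sc1[of "1/2" "x + y"] mid[of x y] by simp
    then show ?thesis by simp
  qed
  have sc: "T (r *\<^sub>R x) = r *\<^sub>R T x" if "r > 0" for r x
  proof -
    consider "r < 1" | "r = 1" | "r > 1" by linarith
    then show ?thesis
    proof cases
      case 3
      have "T ((1 / r) *\<^sub>R (r *\<^sub>R x)) = (1 / r) *\<^sub>R T (r *\<^sub>R x)" using 3 by (intro sc1) auto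
      then have "r *\<^sub>R T x = r *\<^sub>R ((1 / r) *\<^sub>R T (r *\<^sub>R x))" using 3 by simp
      then show ?thesis using 3 by simp
    qed (use sc1 that in auto)
  qed
  have neg: "T (- x) = - T x" for x
    using add[of x "- x"] T0 by (simp add: minus_unique)
  have "T (r *\<^sub>R x) = r *\<^sub>R T x" for r x
  proof -
    consider "r > 0" | "r = 0" | "- r > 0" by linarith
    then show ?thesis
    proof cases
      case 3
      then have "T (- r *\<^sub>R x) = - r *\<^sub>R T x" by (rule sc)
      then show ?thesis using neg[of "r *\<^sub>R x"] by simp
    qed (use sc T0 in auto)
  qed
  with add have "linear T" by (intro linearI)
  then show "linear (\<lambda>x. g x - g 0)" unfolding T_def .
  show "isometry (\<lambda>x. g x - g 0)"
    using g by (simp add: isometry_def dist_norm)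
qed

lemma congruent_frameworks_linear:
  fixes p q :: "'a^'v"
  assumes "congruent_frameworks p q"
  obtains T where "linear T" "isometry T" "\<And>v w. q $ v - q $ w = T (p $ v - p $ w)"
proof -
  obtain g where g: "isometry g" "\<And>v. q $ v = g (p $ v)"
    using assms unfolding congruent_frameworks_def by blast
  note T = isometry_linear_part[OF g(1)]
  show thesis
    by (rule that[OF T]) (simp add: g(2) linear_diff[OF T(1)])
qed

lemma isometry_norm:
  fixes T :: "'a \<Rightarrow> 'a"
  assumes "linear T" "isometry T"
  shows "norm (T x) = norm x"
  using assms unfolding isometry_def dist_norm by (metis diff_zero linear_0)

section \<open>Systems of edge lengths and pinned coordinates\<close>

definition nondegenerate :: "'v set set \<Rightarrow> (real^'i::{finite,wellorder}) set" where
  "nondegenerate E = {x. \<forall>v w. {v, w} \<in> E \<longrightarrow> place x $ v \<noteq> place x $ w}"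

text \<open>\<open>Inl i\<close> stands for the coordinate \<open>x $ i\<close>, and \<open>Inr (v, w)\<close> for the length of the edge \<open>vw\<close>.
  Pinning the vertex \<open>v0\<close> removes the translations.\<close>

definition measurement :: "'i + 'v \<times> 'v \<Rightarrow> real^'i::{finite,wellorder} \<Rightarrow> real" where
  "measurement s = (case s of Inl i \<Rightarrow> (\<lambda>x. x $ i) | Inr e \<Rightarrow> edge_length e)"

definition measurements :: "'v \<Rightarrow> 'v set set \<Rightarrow> ('i + 'v \<times> 'v) set" where
  "measurements v0 E = (\<lambda>b. Inl (\<iota> (b, v0))) ` B \<union> {Inr (v, w) | v w. {v, w} \<in> E}"

lemma measurement_simps [simp]:
  "measurement (Inl i) = (\<lambda>x. x $ i)" "measurement (Inr e) = edge_length e"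
  by (simp_all add: measurement_def)

lemma open_nondegenerate_graph: "open (nondegenerate E)"
proof -
  have "nondegenerate E = (\<Inter>(v, w)\<in>{(v, w). {v, w} \<in> E}. {x. place x $ v \<noteq> place x $ w})"
    by (auto simp: nondegenerate_def)
  also have "open \<dots>"
    by (intro open_INT) (auto simp: open_nondegenerate)
  finally show ?thesis .
qed

lemma nondegenerate_mono: "E \<subseteq> F \<Longrightarrow> nondegenerate F \<subseteq> nondegenerate E"
  by (auto simp: nondegenerate_def)

lemma analytic_measurement:
  assumes "s \<in> range Inl \<union> measurements v0 E"
  shows "analytic_vec_on (nondegenerate E) (measurement s)"
proof -
  consider i where "s = Inl i" | v w where "s = Inr (v, w)" "{v, w} \<in> E"
    using assms by (auto simp: measurements_def)
  then show ?thesis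
  proof cases
    case (2 v w)
    then show ?thesis
      by (auto simp: nondegenerate_def intro: analytic_vec_on_subset[OF analytic_edge_length])
  qed (simp add: analytic_vec_on_nth)
qed

lemma continuous_measurement: "continuous_on A (measurement s)"
  by (cases s) (auto intro: continuous_intros continuous_edge_length)

lemma coordinates_eq_iff: "place x $ v = place y $ w \<longleftrightarrow> (\<forall>b\<in>B. x $ \<iota> (b, v) = y $ \<iota> (b, w))"
proof
  assume "place x $ v = place y $ w"
  then have "(\<Sum>b\<in>B. (x $ \<iota> (b, v) - y $ \<iota> (b, w)) *\<^sub>R b) = 0"
    by (simp add: place_def sum_subtractf scaleR_diff_left)
  then show "\<forall>b\<in>B. x $ \<iota> (b, v) = y $ \<iota> (b, w)"
    using independentD[OF independent_B finite_B order_refl, of "\<lambda>b. x $ \<iota> (b, v) - y $ \<iota> (b, w)"] by auto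
qed (simp add: place_def)

lemma place_eq_0_iff: "place x $ v = 0 \<longleftrightarrow> (\<forall>b\<in>B. x $ \<iota> (b, v) = 0)"
  using coordinates_eq_iff[of x v 0 v] by (simp add: linear_0[OF linear_place])

lemma grad_edge_length_eq_0:
  assumes "place x $ v \<noteq> place x $ w" "place y $ v = place y $ w"
  shows "grad (edge_length (v, w)) x \<bullet> y = 0"
  using the_support_functional_eq_grad[OF assms(1), of y] assms by (simp add: blinfun.zero_right)

text \<open>The degenerate configurations form finitely many subspaces of codimension at least 2, so almost
  every segment ending in \<open>b\<close> avoids them.\<close>

lemma nondegenerate_identity:
  assumes f: "analytic_vec_on (nondegenerate E) f" and b: "b \<in> nondegenerate E"
    and U: "open U" "U \<noteq> {}" and z: "\<And>x. x \<in> U \<Longrightarrow> f x = 0"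
  shows "f b = 0"
proof -
  have ex: "\<exists>l. l \<noteq> 0 \<and> l \<bullet> b = 0 \<and> (\<forall>x. place x $ v = place x $ w \<longrightarrow> l \<bullet> x = 0)"
    if "{v, w} \<in> E" for v w
  proof -
    have ne: "place b $ v \<noteq> place b $ w" using b that by (simp add: nondegenerate_def)
    define d where "d c = b $ \<iota> (c, v) - b $ \<iota> (c, w)" for c
    obtain c1 where c1: "c1 \<in> B" "d c1 \<noteq> 0"
      using ne coordinates_eq_iff[of b v b w] by (auto simp: d_def)
    have "\<not> B \<subseteq> {c1}" using card_B card_mono[of "{c1}" B] by auto
    then obtain c2 where c2: "c2 \<in> B" "c2 \<noteq> c1" by blast
    \<comment> \<open>\<open>l \<bullet> x\<close> is the 2x2 minor formed from two coordinates of
      the edge vectors of \<open>b\<close> and \<open>x\<close>. It vanishes at \<open>b\<close> and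
      on the degenerate subspace; a second basis vector is needed to form it.\<close>
    define l :: "real^'i::{finite,wellorder}"
      where "l = d c2 *\<^sub>R (axis (\<iota> (c1, v)) 1 - axis (\<iota> (c1, w)) 1) -
                 d c1 *\<^sub>R (axis (\<iota> (c2, v)) 1 - axis (\<iota> (c2, w)) 1)"
    have lx: "l \<bullet> x = d c2 * (x $ \<iota> (c1, v) - x $ \<iota> (c1, w)) - d c1 * (x $ \<iota> (c2, v) - x $ \<iota> (c2, w))" for x
      by (simp add: l_def inner_diff_left inner_axis')
    have inj: "inj_on \<iota> (B \<times> UNIV)" using bij_\<iota> by (simp add: bij_betw_def)
    have "v \<noteq> w" using ne by auto
    then have "l \<bullet> axis (\<iota> (c2, v)) 1 = - d c1"
      using c1 c2 inj_on_eq_iff[OF inj] by (simp add: lx axis_def)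
    then have "l \<noteq> 0" using c1 by auto
    moreover have "l \<bullet> b = 0" by (simp add: lx d_def)
    moreover have "l \<bullet> x = 0" if "place x $ v = place x $ w" for x
      using that c1 c2 coordinates_eq_iff[of x v x w] by (simp add: lx)
    ultimately show ?thesis by blast
  qed
  define A where "A = {(v, w). {v, w} \<in> E}"
  have "\<forall>e\<in>A. \<exists>l. l \<noteq> 0 \<and> l \<bullet> b = 0 \<and> (\<forall>x. place x $ fst e = place x $ snd e \<longrightarrow> l \<bullet> x = 0)"
    using ex by (auto simp: A_def)
  then obtain l where l: "\<And>e. e \<in> A \<Longrightarrow> l e \<noteq> 0" "\<And>e. e \<in> A \<Longrightarrow> l e \<bullet> b = 0"
      "\<And>e x. e \<in> A \<Longrightarrow> place x $ fst e = place x $ snd e \<Longrightarrow> l e \<bullet> x = 0" by metis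
  have "negligible (\<Union>e\<in>A. {x. l e \<bullet> x = 0})"
    using l(1) by (intro negligible_Union) (auto intro: negligible_hyperplane)
  then have "\<not> U \<subseteq> (\<Union>e\<in>A. {x. l e \<bullet> x = 0})"
    using open_not_negligible[OF U] negligible_subset by blast
  \<comment> \<open>On the segment from \<open>a\<close> to \<open>b\<close> the functional
    \<open>l e\<close> equals \<open>(1 - t) * (l e \<bullet> a)\<close>, so only the end
    \<open>b\<close> meets the hyperplanes, and \<open>b\<close> is itself non-degenerate.\<close>
  then obtain a where a: "a \<in> U" "\<And>e. e \<in> A \<Longrightarrow> l e \<bullet> a \<noteq> 0" by blast
  have "open ((\<lambda>t. a + t *\<^sub>R (b - a)) -` U)" by (intro open_vimage U continuous_intros)
  moreover have "0 \<in> (\<lambda>t. a + t *\<^sub>R (b - a)) -` U" using a by simp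
  ultimately obtain e where e: "e > 0" "ball 0 e \<subseteq> (\<lambda>t. a + t *\<^sub>R (b - a)) -` U"
    by (meson open_contains_ball)
  have "f (a + (b - a)) = 0"
  proof (rule analytic_vec_zero_on_segment[OF f _ e(1)])
    fix t :: real
    show "f (a + t *\<^sub>R (b - a)) = 0" if "\<bar>t\<bar> < e"
      using z e(2) that by (auto simp: subset_iff)
    show "a + t *\<^sub>R (b - a) \<in> nondegenerate E" if t: "0 \<le> t" "t \<le> 1"
      unfolding nondegenerate_def
    proof (intro CollectI allI impI notI)
      fix v w assume E: "{v, w} \<in> E"
        and eq: "place (a + t *\<^sub>R (b - a)) $ v = place (a + t *\<^sub>R (b - a)) $ w"
      then have vw: "(v, w) \<in> A" by (simp add: A_def)
      have "l (v, w) \<bullet> (a + t *\<^sub>R (b - a)) = 0" using l(3)[OF vw] eq by simp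
      then have "(1 - t) * (l (v, w) \<bullet> a) = 0"
        using l(2)[OF vw] by (simp add: inner_add_right inner_diff_right algebra_simps)
      then have "t = 1" using a(2)[OF vw] by simp
      then show False using eq b E by (simp add: nondegenerate_def)
    qed
  qed
  then show ?thesis by simp
qed

abbreviation system :: "('i \<Rightarrow> 'i + 'v \<times> 'v) \<Rightarrow> 'i \<Rightarrow> real^'i::{finite,wellorder} \<Rightarrow> real" where
  "system \<sigma> i \<equiv> measurement (\<sigma> i)"

lemma system_upd: "system (\<sigma>(k := s)) = (system \<sigma>)(k := measurement s)"
  by auto

lemma grad_measurement_kernel_field:
  "grad (measurement s) x \<bullet> kernel_field (system \<sigma>) k x = grad_det (system (\<sigma>(k := s))) x"
  unfolding system_upd grad_inner_kernel_field ..

lemma kernel_field_nonzero: "grad_det (system \<sigma>) x \<noteq> 0 \<Longrightarrow> kernel_field (system \<sigma>) k x \<noteq> 0"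
  using grad_measurement_kernel_field[of "\<sigma> k" x \<sigma> k] by auto

text \<open>Among the square systems with non-zero determinant somewhere in \<open>U\<close>, take
  one with as many rows from \<open>S\<close> as possible. Either all rows are in \<open>S\<close>,
  or replacing a row \<open>k\<close> outside \<open>S\<close> by any member of \<open>S\<close>
  must kill the determinant; in that case all of \<open>S\<close> is constant along the kernel field
  of the remaining rows.\<close>

lemma measurement_dichotomy:
  assumes S: "S \<subseteq> measurements v0 E" and U: "open U" "U \<noteq> {}" "U \<subseteq> nondegenerate E"
  obtains
    (rigid) \<sigma> U' where "open U'" "U' \<noteq> {}" "U' \<subseteq> U" "\<And>i. \<sigma> i \<in> S" "\<And>x. x \<in> U' \<Longrightarrow> grad_det (system \<sigma>) x \<noteq> 0"
  | (flexible) \<sigma> k U' where "open U'" "U' \<noteq> {}" "U' \<subseteq> U" "\<And>i. \<sigma> i \<in> range Inl \<union> measurements v0 E"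
      "\<And>x. x \<in> U' \<Longrightarrow> grad_det (system \<sigma>) x \<noteq> 0"
      "\<And>x s. x \<in> U' \<Longrightarrow> s \<in> S \<Longrightarrow> grad_det (system (\<sigma>(k := s))) x = 0"
proof -
  define Q where "Q p \<longleftrightarrow> snd p \<in> U \<and> (\<forall>i. fst p i \<in> range Inl \<union> S) \<and> grad_det (system (fst p)) (snd p) \<noteq> 0"
    for p :: "('i \<Rightarrow> 'i + 'v \<times> 'v) \<times> (real^'i::{finite,wellorder})"
  define N where "N p = card {i. fst p i \<in> S}"
    for p :: "('i \<Rightarrow> 'i + 'v \<times> 'v) \<times> (real^'i::{finite,wellorder})"
  obtain x0 where x0: "x0 \<in> U" using U(2) by blast
  \<comment> \<open>The plain coordinates have the identity as Jacobian and provide the starting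
    system of the maximisation.\<close>
  have "grad_det (system Inl) x0 \<noteq> 0"
    unfolding grad_det_def det_nonzero_rows by (simp add: grad_coordinate vec_eq_iff)
  then have "Q (Inl, x0)" using x0 by (simp add: Q_def)
  moreover have "\<forall>p. Q p \<longrightarrow> N p < Suc CARD('i)"
    by (auto simp: N_def less_Suc_eq_le intro: card_mono)
  ultimately obtain p where p: "Q p" "\<And>p'. Q p' \<Longrightarrow> N p' \<le> N p"
    using ex_has_greatest_nat[of Q "(Inl, x0)" N "Suc CARD('i)"] by blast
  define \<sigma> where "\<sigma> = fst p"
  define U' where "U' = U \<inter> {x. grad_det (system \<sigma>) x \<noteq> 0}"
  have \<sigma>: "\<sigma> i \<in> range Inl \<union> measurements v0 E" for i
    using p(1) S by (auto simp: Q_def \<sigma>_def)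
  have "analytic_vec_on (nondegenerate E) (grad_det (system \<sigma>))"
    by (intro analytic_vec_on_grad_det analytic_measurement[OF \<sigma>])
  then have "continuous_on U (grad_det (system \<sigma>))"
    using U(3) continuous_on_analytic_vec continuous_on_subset by blast
  then have "open (U \<inter> grad_det (system \<sigma>) -` (-{0}))"
    by (intro continuous_open_preimage U) auto
  then have U'1: "open U'" by (simp add: U'_def vimage_def)
  have U'2: "U' \<noteq> {}" "U' \<subseteq> U" using p(1) by (auto simp: U'_def Q_def \<sigma>_def)
  have nz: "grad_det (system \<sigma>) x \<noteq> 0" if "x \<in> U'" for x using that by (simp add: U'_def)
  show thesis
  proof (cases "\<forall>i. \<sigma> i \<in> S")
    case True
    then show thesis using rigid[OF U'1 U'2, of \<sigma>] nz by blast
  next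
    case False
    then obtain k where k: "\<sigma> k \<notin> S" by blast
    have "grad_det (system (\<sigma>(k := s))) x = 0" if x: "x \<in> U'" and s: "s \<in> S" for x s
    proof (rule ccontr)
      assume ne: "grad_det (system (\<sigma>(k := s))) x \<noteq> 0"
      have "\<sigma> i \<in> range Inl \<union> S" for i using p(1) by (auto simp: Q_def \<sigma>_def)
      then have "Q (\<sigma>(k := s), x)" using ne x s by (auto simp: Q_def U'_def)
      moreover have "{i. \<sigma> i \<in> S} \<subset> {i. (\<sigma>(k := s)) i \<in> S}" using k s by auto
      then have "N p < N (\<sigma>(k := s), x)"
        by (simp add: N_def \<sigma>_def psubset_card_mono)
      ultimately show False using p(2) by fastforce
    qed
    then show thesis using flexible[OF U'1 U'2 \<sigma> nz] by blast
  qed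
qed

text \<open>Subtracting the velocity of \<open>v0\<close> makes a flex orthogonal to a full set of
  independent gradients. Hence it is a translation, that is, trivial with linear part 0.\<close>

lemma infinitesimally_rigid_of_grad_det:
  assumes x: "x \<in> nondegenerate E" and \<sigma>: "\<And>i. \<sigma> i \<in> measurements v0 E"
    and nz: "grad_det (system \<sigma>) x \<noteq> 0"
  shows "infinitesimally_rigid E (place x)"
  unfolding infinitesimally_rigid_def
proof (intro allI impI)
  fix u assume u: "infinitesimal_flex E (place x) u"
  define y where "y = coord (\<chi> v. u $ v - u $ v0)"
  have "grad (system \<sigma> i) x \<bullet> y = 0" for i
  proof -
    consider b where "b \<in> B" "\<sigma> i = Inl (\<iota> (b, v0))" | v w where "{v, w} \<in> E" "\<sigma> i = Inr (v, w)"
      using \<sigma>[of i] by (auto simp: measurements_def)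
    then show ?thesis
    proof cases
      case 1
      moreover have "place y $ v0 = 0" by (simp add: y_def)
      ultimately show ?thesis by (simp add: grad_coordinate place_eq_0_iff)
    next
      case 2
      then have ne: "place x $ v \<noteq> place x $ w" using x by (simp add: nondegenerate_def)
      have "blinfun_apply (the_support_functional (place x $ v - place x $ w)) (place y $ v - place y $ w) = 0"
        using u 2 by (simp add: infinitesimal_flex_def y_def)
      then show ?thesis
        using the_support_functional_eq_grad[OF ne, of y] ne 2 by simp
    qed
  qed
  then have "y = 0" using nz unfolding grad_det_def det_nonzero_rows by blast
  then have "place y = 0" by (simp add: linear_0[OF linear_place])
  then have "u $ v = u $ v0" for v
    by (simp add: y_def vec_eq_iff)
  then show "trivial_flex (place x) u"
    unfolding trivial_flex_def
    by (intro exI[of _ "\<lambda>x. 0"] exI[of _ "u $ v0"]) (auto simp: linear_iff blinfun.zero_right)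
qed

section \<open>Redundant rigidity\<close>

lemma edge_length_eq_imp_equivalent:
  assumes "\<And>v w. {v, w} \<in> E \<Longrightarrow> edge_length (v, w) y = edge_length (v, w) x"
  shows "equivalent_frameworks E (place x) (place y)"
  using assms by (simp add: equivalent_frameworks_def edge_length_def)

lemma pinned_eq:
  assumes "\<And>s. s \<in> measurements v0 E \<Longrightarrow> measurement s y = measurement s x"
  shows "place y $ v0 = place x $ v0"
proof -
  have "y $ \<iota> (b, v0) = x $ \<iota> (b, v0)" if "b \<in> B" for b
    using assms[of "Inl (\<iota> (b, v0))"] that by (simp add: measurements_def)
  then show ?thesis by (simp add: coordinates_eq_iff)
qed

text \<open>A congruent framework with the same pinned vertex is determined by the linear part of
  the isometry.\<close>

lemma globally_rigid_fibre_finite: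
  assumes fin: "finite {T :: 'a \<Rightarrow> 'a. linear T \<and> isometry T}"
    and rigid: "globally_rigid_framework E (place x)"
  shows "finite {y. \<forall>s\<in>measurements v0 E. measurement s y = measurement s x}"
proof (rule finite_subset)
  let ?C = "\<lambda>T. coord (\<chi> v. place x $ v0 + T (place x $ v - place x $ v0))"
  show "finite (?C ` {T. linear T \<and> isometry T})" using fin by simp
  show "{y. \<forall>s\<in>measurements v0 E. measurement s y = measurement s x} \<subseteq> ?C ` {T. linear T \<and> isometry T}"
  proof
    fix y assume "y \<in> {y. \<forall>s\<in>measurements v0 E. measurement s y = measurement s x}"
    then have y: "\<And>s. s \<in> measurements v0 E \<Longrightarrow> measurement s y = measurement s x" by blast
    have "edge_length (v, w) y = edge_length (v, w) x" if "{v, w} \<in> E" for v w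
      using y[of "Inr (v, w)"] that by (auto simp: measurements_def)
    then have "congruent_frameworks (place x) (place y)"
      using rigid edge_length_eq_imp_equivalent unfolding globally_rigid_framework_def by blast
    then obtain T where T: "linear T" "isometry T" "\<And>v w. place y $ v - place y $ w = T (place x $ v - place x $ w)"
      using congruent_frameworks_linear by blast
    have "place y $ v = place x $ v0 + T (place x $ v - place x $ v0)" for v
      using T(3)[of v v0] pinned_eq[OF y] by (simp add: algebra_simps)
    then have "place y = (\<chi> v. place x $ v0 + T (place x $ v - place x $ v0))"
      by (simp add: vec_eq_iff)
    then have "y = ?C T" by (metis coord_place)
    then show "y \<in> ?C ` {T. linear T \<and> isometry T}" using T by blast
  qed
qed

lemma obtain_two_basis_vectors:
  obtains b c where "b \<in> B" "c \<in> B" "b \<noteq> c"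
proof -
  obtain b where b: "b \<in> B" using card_B by fastforce
  have "\<not> B \<subseteq> {b}" using card_B card_mono[of "{b}" B] by auto
  then show thesis using that b by blast
qed

lemma basis_combination_eq_0:
  assumes "b \<in> B" "c \<in> B" "b \<noteq> c" "\<alpha> *\<^sub>R b + \<beta> *\<^sub>R c = 0"
  shows "\<alpha> = 0 \<and> \<beta> = 0"
proof -
  have "(\<Sum>x\<in>{b, c}. (if x = b then \<alpha> else \<beta>) *\<^sub>R x) = 0" using assms(3,4) by simp
  moreover have "{b, c} \<subseteq> B" using assms by simp
  ultimately have "(if x = b then \<alpha> else \<beta>) = 0" if "x \<in> {b, c}" for x
    using independentD[OF independent_B, of "{b, c}" "\<lambda>x. if x = b then \<alpha> else \<beta>" x] that by blast
  from this[of b] this[of c] show ?thesis using assms(3) by simp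
qed

text \<open>A part of the graph without edges to the component of \<open>v0\<close> could be
  translated in two independent directions without changing any row other than \<open>k\<close>, but
  these rows have a one-dimensional kernel. Connectivity is what makes fibres bounded.\<close>

lemma connected_of_one_dimensional_kernel:
  assumes x: "x \<in> nondegenerate E" and \<sigma>: "\<And>i. i \<noteq> k \<Longrightarrow> \<sigma> i \<in> measurements v0 E"
    and nz: "grad_det (system \<sigma>) x \<noteq> 0"
  shows "(v0, v) \<in> {(x, y). {x, y} \<in> E}\<^sup>*"
proof (rule ccontr)
  assume v: "(v0, v) \<notin> {(x, y). {x, y} \<in> E}\<^sup>*"
  define C where "C = {w. (v0, w) \<notin> {(x, y). {x, y} \<in> E}\<^sup>*}"
  have C: "v \<in> C" "v0 \<notin> C" using v by (auto simp: C_def)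
  have step: "w' \<in> C \<longleftrightarrow> w \<in> C" if "{w, w'} \<in> E" for w w'
  proof -
    have "(w, w') \<in> {(x, y). {x, y} \<in> E}" "(w', w) \<in> {(x, y). {x, y} \<in> E}"
      using that by (auto simp: insert_commute)
    then show ?thesis unfolding C_def by (meson mem_Collect_eq rtrancl.rtrancl_into_rtrancl)
  qed
  define u where "u z = coord (\<chi> w. if w \<in> C then z else 0)" for z :: 'a
  have pu: "place (u z) $ w = (if w \<in> C then z else 0)" for z w by (simp add: u_def)
  have kill: "grad (system \<sigma> i) x \<bullet> u z = 0" if i: "i \<noteq> k" for i z
  proof -
    consider b where "b \<in> B" "\<sigma> i = Inl (\<iota> (b, v0))" | v w where "{v, w} \<in> E" "\<sigma> i = Inr (v, w)"
      using \<sigma>[OF i] by (auto simp: measurements_def)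
    then show ?thesis
    proof cases
      case 1
      then show ?thesis using pu[of z v0] C(2) by (simp add: grad_coordinate place_eq_0_iff)
    next
      case 2
      then show ?thesis
        using x pu[of z] step[of v w] by (auto simp: nondegenerate_def intro!: grad_edge_length_eq_0)
    qed
  qed
  have zero: "y = 0" if "\<And>i. grad (system \<sigma> i) x \<bullet> y = 0" for y
    using nz that unfolding grad_det_def det_nonzero_rows by blast
  obtain b c where bc: "b \<in> B" "c \<in> B" "b \<noteq> c" by (rule obtain_two_basis_vectors)
  \<comment> \<open>The coefficients are chosen so that row \<open>k\<close> vanishes on the
    combination as well.\<close>
  define \<alpha> where "\<alpha> = grad (system \<sigma> k) x \<bullet> u c"
  define \<beta> where "\<beta> = - (grad (system \<sigma> k) x \<bullet> u b)"
  have "\<alpha> *\<^sub>R u b + \<beta> *\<^sub>R u c = 0"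
  proof (rule zero)
    show "grad (system \<sigma> i) x \<bullet> (\<alpha> *\<^sub>R u b + \<beta> *\<^sub>R u c) = 0" for i
      using kill[of i] by (cases "i = k") (simp_all add: inner_diff_right inner_add_right \<alpha>_def \<beta>_def)
  qed
  then have "place (\<alpha> *\<^sub>R u b + \<beta> *\<^sub>R u c) $ v = 0" by (simp add: linear_0[OF linear_place])
  then have "\<alpha> *\<^sub>R b + \<beta> *\<^sub>R c = 0"
    using C(1) by (simp add: linear_add[OF linear_place] linear_scale[OF linear_place] pu)
  then have "\<beta> = 0" using basis_combination_eq_0[OF bc] by blast
  then have "u b = 0"
    using kill by (intro zero) (metis \<beta>_def neg_equal_0_iff_equal)
  then have "b = 0" using pu[of b v] C(1) by (simp add: linear_0[OF linear_place])
  then show False using bc(1) independent_B dependent_zero by blast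
qed

lemma place_bounded_below:
  obtains m where "m > 0" "\<And>x. m * norm x \<le> norm (place x)"
proof -
  let ?S = "sphere (0 :: real^'i::{finite,wellorder}) 1"
  have "compact ?S" "?S \<noteq> {}" by (auto simp: compact_sphere)
  moreover have "continuous_on ?S (\<lambda>x. norm (place x))"
    by (intro continuous_intros continuous_place)
  ultimately obtain x0 where x0: "x0 \<in> ?S" "\<And>x. x \<in> ?S \<Longrightarrow> norm (place x0) \<le> norm (place x)"
    using continuous_attains_inf[of ?S "\<lambda>x. norm (place x)"] by blast
  have "x0 \<noteq> 0" using x0(1) by auto
  then have "norm (place x0) > 0"
    using linear_injective_0[OF linear_place] inj_place by auto
  moreover have "norm (place x0) * norm x \<le> norm (place x)" for x
  proof (cases "x = 0")
    case False
    have "norm (place x0) \<le> norm (place ((1 / norm x) *\<^sub>R x))" using False by (intro x0(2)) simp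
    also have "\<dots> = norm (place x) / norm x" by (simp add: linear_scale[OF linear_place])
    finally show ?thesis using False by (simp add: field_simps)
  qed simp
  ultimately show thesis by (rule that)
qed

text \<open>Along a path from the pinned vertex each edge adds a prescribed length, which bounds
  every position on the fibre.\<close>

lemma compact_fibre:
  assumes conn: "\<And>v. (v0, v) \<in> {(x, y). {x, y} \<in> E}\<^sup>*"
  shows "compact {x. \<forall>s\<in>measurements v0 E. measurement s x = measurement s p}" (is "compact ?K")
proof -
  have "closed (\<Inter>s\<in>measurements v0 E. {x. measurement s x = measurement s p})"
    by (intro closed_INT ballI closed_Collect_eq continuous_measurement continuous_intros)
  then have closed: "closed ?K" by (simp add: Collect_ball_eq)
  have "\<exists>M. \<forall>x\<in>?K. norm (place x $ v) \<le> M" for v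
    using conn[of v]
  proof (induction rule: rtrancl_induct)
    case base
    have "norm (place x $ v0) \<le> norm (place p $ v0)" if "x \<in> ?K" for x
      using that pinned_eq[of v0 E x p] by simp
    then show ?case by blast
  next
    case (step v w)
    then obtain M where M: "\<And>x. x \<in> ?K \<Longrightarrow> norm (place x $ v) \<le> M" by blast
    have "norm (place x $ w) \<le> M + edge_length (v, w) p" if x: "x \<in> ?K" for x
    proof -
      have "Inr (v, w) \<in> measurements v0 E" using step.hyps by (auto simp: measurements_def)
      then have "edge_length (v, w) x = edge_length (v, w) p" using x by force
      then have "norm (place x $ v - place x $ w) = edge_length (v, w) p"
        by (simp add: edge_length_def)
      then show ?thesis
        using M[OF x] norm_triangle_ineq2[of "place x $ w" "place x $ v"] by (simp add: norm_minus_commute)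
    qed
    then show ?case by blast
  qed
  then have "\<exists>M. \<forall>v. \<forall>x\<in>?K. norm (place x $ v) \<le> M v" by (intro choice allI)
  then obtain M where M: "\<And>v x. x \<in> ?K \<Longrightarrow> norm (place x $ v) \<le> M v" by blast
  obtain m where m: "m > 0" "\<And>x. m * norm x \<le> norm (place x)" using place_bounded_below by blast
  have "norm x \<le> (\<Sum>v\<in>UNIV. M v) / m" if x: "x \<in> ?K" for x
  proof -
    have "norm (place x) \<le> (\<Sum>v\<in>UNIV. norm (place x $ v))"
      unfolding norm_vec_def by (rule L2_set_le_sum) simp
    also have "\<dots> \<le> (\<Sum>v\<in>UNIV. M v)" by (intro sum_mono M[OF x])
    finally show ?thesis using m(2)[of x] m(1) by (simp add: field_simps)
  qed
  then have "bounded ?K" unfolding bounded_iff by blast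
  then show ?thesis using closed compact_eq_bounded_closed by blast
qed

text \<open>The isometry acts on all configurations at once, rotating each about its vertex
  \<open>v0\<close>. If it is not the identity, it moves configurations supported at two further
  vertices by independent vectors; this is where three vertices enter.\<close>

lemma pinned_isometry:
  assumes T: "linear T" "isometry T" and card: "CARD('v) \<ge> 3"
    and q: "\<And>v. place q $ v = place p $ v0 + T (place p $ v - place p $ v0)"
  shows "\<exists>M. linear M \<and> inj M \<and> M p = q \<and>
     (\<forall>s\<in>measurements v0 E. \<forall>x. measurement s (M x) = measurement s x) \<and>
     (\<forall>v w x. edge_length (v, w) (M x) = edge_length (v, w) x) \<and>
     (M = id \<or> (\<exists>u v. \<forall>a b. a *\<^sub>R (M u - u) + b *\<^sub>R (M v - v) = 0 \<longrightarrow> a = 0 \<and> b = 0))"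
proof -
  define M where "M x = coord (\<chi> v. place x $ v0 + T (place x $ v - place x $ v0))" for x
  have pM: "place (M x) $ v = place x $ v0 + T (place x $ v - place x $ v0)" for x v
    by (simp add: M_def)
  have T0: "T 0 = 0" using T(1) by (rule linear_0)
  have lin: "linear M"
  proof (rule linearI)
    fix x y :: "real^'i::{finite,wellorder}" and r :: real
    have T1: "T (x + y) = T x + T y" "T (x - y) = T x - T y" "T (r *\<^sub>R x) = r *\<^sub>R T x" for x y r
      using T(1) by (simp_all add: linear_add linear_diff linear_scale)
    show "M (x + y) = M x + M y"
      by (rule injD[OF inj_place])
         (simp add: vec_eq_iff pM linear_add[OF linear_place] T1)
    show "M (r *\<^sub>R x) = r *\<^sub>R M x"
      by (rule injD[OF inj_place])
         (simp add: vec_eq_iff pM linear_scale[OF linear_place] T1 algebra_simps)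
  qed
  have dM: "place (M x) $ v - place (M x) $ w = T (place x $ v - place x $ w)" for x v w
    using T(1) by (simp add: pM linear_diff)
  have el: "edge_length (v, w) (M x) = edge_length (v, w) x" for v w x
    by (simp add: edge_length_def dM isometry_norm[OF T])
  have pin: "place (M x) $ v0 = place x $ v0" for x by (simp add: pM T0)
  have inj: "inj M"
    unfolding linear_injective_0[OF lin]
  proof (intro allI impI)
    fix x assume "M x = 0"
    then have p0: "place (M x) $ v = 0" for v by (simp add: linear_0[OF linear_place])
    then have x0: "place x $ v0 = 0" using pin by metis
    have "place x $ v = 0" for v
      using p0[of v] isometry_norm[OF T, of "place x $ v"] by (simp add: pM x0)
    then have "place x = place 0" by (simp add: vec_eq_iff linear_0[OF linear_place])
    then show "x = 0" by (rule injD[OF inj_place])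
  qed
  have Mp: "M p = q" by (rule injD[OF inj_place]) (simp add: vec_eq_iff pM q)
  have meas: "measurement s (M x) = measurement s x" if "s \<in> measurements v0 E" for s x
    using that pin[of x] by (auto simp: measurements_def el coordinates_eq_iff)
  have "M = id \<or> (\<exists>u v. \<forall>a b. a *\<^sub>R (M u - u) + b *\<^sub>R (M v - v) = 0 \<longrightarrow> a = 0 \<and> b = 0)"
  proof (cases "\<forall>y. T y = y")
    case True
    then have "M x = x" for x by (intro injD[OF inj_place]) (simp add: vec_eq_iff pM)
    then show ?thesis by auto
  next
    case False
    then obtain y where y: "T y \<noteq> y" by blast
    have "\<not> UNIV \<subseteq> {v0}" using card card_mono[of "{v0}" UNIV] by auto
    then obtain v1 where v1: "v1 \<noteq> v0" by blast
    have "card {v0, v1} \<le> 2" by (simp add: card_insert_if)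
    then have "\<not> UNIV \<subseteq> {v0, v1}" using card card_mono[of "{v0, v1}" UNIV] by auto
    then obtain v2 where v2: "v2 \<noteq> v0" "v2 \<noteq> v1" by blast
    \<comment> \<open>The displacement of each of these configurations is \<open>T y - y\<close>,
      concentrated at a single vertex.\<close>
    let ?u = "coord (single v1 y)" and ?v = "coord (single v2 y)"
    have d: "place (M (coord (single w y)) - coord (single w y)) $ v = (if v = w then T y - y else 0)"
      if "w \<noteq> v0" for v w
      using that by (simp add: linear_diff[OF linear_place] pM single_def T0)
    have "a = 0 \<and> b = 0" if ab: "a *\<^sub>R (M ?u - ?u) + b *\<^sub>R (M ?v - ?v) = 0" for a b
    proof -
      have "place (a *\<^sub>R (M ?u - ?u) + b *\<^sub>R (M ?v - ?v)) $ v = 0" for v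
        unfolding ab by (simp add: linear_0[OF linear_place])
      then have "a *\<^sub>R (if v = v1 then T y - y else 0) + b *\<^sub>R (if v = v2 then T y - y else 0) = 0" for v
        unfolding linear_add[OF linear_place] linear_scale[OF linear_place]
          vector_add_component vector_scaleR_component d[OF v1] d[OF v2(1)] .
      from this[of v1] this[of v2] show ?thesis using v2 y by simp
    qed
    then show ?thesis by blast
  qed
  then show ?thesis using lin inj Mp meas el by blast
qed

text \<open>The return argument is applied with the length of \<open>e\<close> as \<open>f\<close>
  and all other measurements as \<open>S\<close>. Global rigidity turns the return point into an
  image of \<open>p\<close> under an isometry.\<close>

lemma not_globally_rigid_of_flexible_edge_deletion:
  assumes E: "e \<in> E" and card: "CARD('v) \<ge> 3"
    and U: "open U" "U \<noteq> {}" "U \<subseteq> nondegenerate E"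
    and rigid: "\<And>x. x \<in> U \<Longrightarrow> globally_rigid_framework E (place x)"
    and \<sigma>: "\<And>i. \<sigma> i \<in> measurements v0 E" and det: "\<And>x. x \<in> U \<Longrightarrow> grad_det (system \<sigma>) x \<noteq> 0"
    and flex: "\<And>x. x \<in> U \<Longrightarrow> \<exists>u. u \<noteq> 0 \<and> (\<forall>s\<in>measurements v0 (E - {e}). grad (measurement s) x \<bullet> u = 0)"
  shows False
proof -
  let ?S = "measurements v0 (E - {e})" and ?\<Omega> = "nondegenerate (E - {e})"
  have sub: "nondegenerate E \<subseteq> ?\<Omega>" by (rule nondegenerate_mono) blast
  obtain a where a: "a \<in> U" using U(2) by blast
  obtain u where u: "u \<noteq> 0" "\<And>s. s \<in> ?S \<Longrightarrow> grad (measurement s) a \<bullet> u = 0" using flex[OF a] by blast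
  \<comment> \<open>The common kernel vector of the measurements of \<open>G - e\<close> is detected
    by some row, and such a row can only be the length of \<open>e\<close>.\<close>
  obtain k where k: "grad (system \<sigma> k) a \<bullet> u \<noteq> 0"
    using det[OF a] u(1) unfolding grad_det_def det_nonzero_rows by blast
  have in_S: "s \<in> ?S \<or> (\<exists>v w. s = Inr (v, w) \<and> {v, w} = e)" if "s \<in> measurements v0 E" for s
    using that by (auto simp: measurements_def)
  have "\<sigma> k \<notin> ?S" using k u(2) by blast
  then obtain v1 v2 where v: "\<sigma> k = Inr (v1, v2)" "{v1, v2} = e" using in_S[OF \<sigma>[of k]] by blast
  \<comment> \<open>No second row can measure \<open>e\<close>, in either orientation, since equal
    rows would make the determinant vanish.\<close>
  have \<sigma>S: "\<sigma> i \<in> ?S" if i: "i \<noteq> k" for i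
  proof (rule ccontr)
    assume "\<sigma> i \<notin> ?S"
    then obtain w1 w2 where w: "\<sigma> i = Inr (w1, w2)" "{w1, w2} = e" using in_S[OF \<sigma>[of i]] by blast
    then have "(w1 = v1 \<and> w2 = v2) \<or> (w1 = v2 \<and> w2 = v1)" using v(2) by (auto simp: doubleton_eq_iff)
    then have "system \<sigma> i = system \<sigma> k" using w v edge_length_sym[of v2 v1] by auto
    then have "grad_det (system \<sigma>) a = 0"
      unfolding grad_det_def by (intro det_identical_rows[of i k]) (use i in \<open>auto simp: row_def\<close>)
    then show False using det[OF a] by blast
  qed
  define W where "W = kernel_field (system \<sigma>) k"
  have anS: "analytic_vec_on ?\<Omega> (measurement s)" if "s \<in> ?S" for s
    using that by (intro analytic_measurement) auto
  have anW: "analytic_vec_on ?\<Omega> (\<lambda>x. W x $ j)" for j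
    unfolding W_def by (intro analytic_vec_on_kernel_field anS \<sigma>S)
  \<comment> \<open>With \<open>s\<close> in place of row \<open>k\<close> all rows belong to
    \<open>G - e\<close> and share a non-zero kernel vector, so the determinant is 0.\<close>
  have kerU: "grad (measurement s) x \<bullet> W x = 0" if s: "s \<in> ?S" and x: "x \<in> U" for s x
  proof (rule ccontr)
    assume "grad (measurement s) x \<bullet> W x \<noteq> 0"
    then have "grad_det (system (\<sigma>(k := s))) x \<noteq> 0"
      unfolding W_def grad_measurement_kernel_field .
    moreover obtain u where "u \<noteq> 0" "\<And>s. s \<in> ?S \<Longrightarrow> grad (measurement s) x \<bullet> u = 0" using flex[OF x] by blast
    moreover have "(\<sigma>(k := s)) i \<in> ?S" for i using s \<sigma>S by simp
    ultimately show False unfolding grad_det_def det_nonzero_rows by blast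
  qed
  \<comment> \<open>Tangency is known on \<open>U\<close> only; since the fibre through a point of
    \<open>U\<close> may leave \<open>U\<close>, it is extended to all non-degenerate configurations
    of \<open>G - e\<close>.\<close>
  have ker: "grad (measurement s) x \<bullet> W x = 0" if s: "s \<in> ?S" and x: "x \<in> ?\<Omega>" for s x
  proof (rule nondegenerate_identity[OF _ x U(1,2)])
    have "analytic_vec_on ?\<Omega> (system (\<sigma>(k := s)) i)" for i using s \<sigma>S by (auto intro: anS)
    then have "analytic_vec_on ?\<Omega> (grad_det (system (\<sigma>(k := s))))" by (rule analytic_vec_on_grad_det)
    then show "analytic_vec_on ?\<Omega> (\<lambda>x. grad (measurement s) x \<bullet> W x)"
      unfolding W_def grad_measurement_kernel_field .
  qed (rule kerU[OF s])
  have Wa: "W a \<noteq> 0" unfolding W_def by (rule kernel_field_nonzero[OF det[OF a]])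
  \<comment> \<open>The same identity theorem, contrapositively: vanishing on a ball would give
    \<open>W a = 0\<close>. This is the density hypothesis of the Sard argument.\<close>
  have nv: "\<exists>y\<in>ball x r. kernel_field (system \<sigma>) k y \<noteq> 0" if "r > 0" for x r
  proof (rule ccontr)
    assume "\<not> ?thesis"
    then have "W y $ j = 0" if "y \<in> ball x r" for y j using that by (auto simp: W_def)
    then have "W a $ j = 0" for j
      using nondegenerate_identity[OF anW _ open_ball, of a x r j] a U(3) sub \<open>r > 0\<close> by auto
    then show False using Wa by (simp add: vec_eq_iff)
  qed
  have anU: "analytic_vec_on U (system \<sigma> i)" for i
    by (rule analytic_vec_on_subset[OF analytic_measurement U(3)]) (use \<sigma> in auto)
  have "\<exists>p\<in>U. \<forall>x\<in>?\<Omega>. (\<forall>i. i \<noteq> k \<longrightarrow> system \<sigma> i x = system \<sigma> i p) \<longrightarrow> W x \<noteq> 0"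
  proof (rule exists_regular_fibre[of k ?\<Omega> "system \<sigma>" U a])
    show "analytic_vec_on ?\<Omega> (system \<sigma> i)" if "i \<noteq> k" for i by (rule anS[OF \<sigma>S[OF that]])
    show "\<exists>y\<in>ball x r. kernel_field (system \<sigma>) k y \<noteq> 0" if "r > 0" for x r by (rule nv[OF that])
    show "grad_det (system \<sigma>) a \<noteq> 0" by (rule det[OF a])
    fix p assume "p \<in> U" and p: "\<And>x. x \<in> ?\<Omega> \<Longrightarrow>
      (\<And>i. i \<noteq> k \<Longrightarrow> system \<sigma> i x = system \<sigma> i p) \<Longrightarrow> kernel_field (system \<sigma>) k x \<noteq> 0"
    show ?thesis
      unfolding W_def by (intro bexI[OF _ \<open>p \<in> U\<close>] ballI impI, rule p) blast+
  qed (fact open_nondegenerate_graph U(1) a anU)+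
  then obtain p where p: "p \<in> U"
    and reg: "\<And>x. x \<in> ?\<Omega> \<Longrightarrow> (\<And>i. i \<noteq> k \<Longrightarrow> system \<sigma> i x = system \<sigma> i p) \<Longrightarrow> W x \<noteq> 0"
    by blast
  have pE: "place p $ v \<noteq> place p $ w" if "{v, w} \<in> E" for v w
    using p U(3) that by (auto simp: nondegenerate_def)
  define K where "K = {x. \<forall>s\<in>?S. measurement s x = measurement s p}"
  \<comment> \<open>On the fibre the edges of \<open>G - e\<close> have the non-zero lengths that
    they have in \<open>p\<close>, so the fibre avoids the degenerate configurations.\<close>
  have K\<Omega>: "K \<subseteq> ?\<Omega>"
  proof
    fix x assume x: "x \<in> K"
    show "x \<in> ?\<Omega>"
      unfolding nondegenerate_def
    proof (intro CollectI allI impI)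
      fix v w assume vw: "{v, w} \<in> E - {e}"
      then have "Inr (v, w) \<in> ?S" by (auto simp: measurements_def)
      then have "edge_length (v, w) x = edge_length (v, w) p" using x by (force simp: K_def)
      then show "place x $ v \<noteq> place x $ w" using pE[of v w] vw by (auto simp: edge_length_def)
    qed
  qed
  have "compact K"
    unfolding K_def
    by (rule compact_fibre, rule connected_of_one_dimensional_kernel[of a _ k \<sigma>])
       (use a U(3) sub \<sigma>S det[OF a] in auto)
  have v12: "{v1, v2} \<in> E" using v E by simp
  have eq_imp_nondeg: "place x $ v1 \<noteq> place x $ v2" if "edge_length (v1, v2) x = edge_length (v1, v2) p" for x
    using that pE[OF v12] by (auto simp: edge_length_def)
  show False
  proof (rule no_symmetric_return[where G = measurement and \<sigma> = \<sigma> and k = k and S = ?S and \<Omega> = ?\<Omega>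
        and K = K and p = p and W = W and f = "edge_length (v1, v2)"
        and \<Omega>' = "{x. place x $ v1 \<noteq> place x $ v2}"])
    show "W x \<noteq> 0" if "x \<in> K" for x
      using that K\<Omega> \<sigma>S by (intro reg) (auto simp: K_def)
    show "grad (edge_length (v1, v2)) p \<bullet> W p \<noteq> 0"
      using grad_measurement_kernel_field[of "\<sigma> k" p \<sigma> k, unfolded fun_upd_triv] det[OF p] v(1)
      by (simp add: W_def)
    fix q assume q: "q \<in> K" "edge_length (v1, v2) q = edge_length (v1, v2) p"
    have eqE: "edge_length (v, w) q = edge_length (v, w) p" if "{v, w} \<in> E" for v w
    proof (cases "{v, w} = e")
      case True
      then have "(v = v1 \<and> w = v2) \<or> (v = v2 \<and> w = v1)" using v(2) by (auto simp: doubleton_eq_iff)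
      then show ?thesis using q(2) edge_length_sym[of v1 v2] by auto
    next
      case False
      then have "Inr (v, w) \<in> ?S" using that by (auto simp: measurements_def)
      then show ?thesis using q(1) by (force simp: K_def)
    qed
    then have "congruent_frameworks (place p) (place q)"
      using rigid[OF p] edge_length_eq_imp_equivalent unfolding globally_rigid_framework_def by blast
    then obtain T where T: "linear T" "isometry T" "\<And>v w. place q $ v - place q $ w = T (place p $ v - place p $ w)"
      using congruent_frameworks_linear by blast
    have "place q $ v0 = place p $ v0"
      using q(1) by (intro pinned_eq[of v0 "E - {e}"]) (simp add: K_def)
    then have "place q $ v = place p $ v0 + T (place p $ v - place p $ v0)" for v
      using T(3)[of v v0] by (simp add: algebra_simps)
    from pinned_isometry[OF T(1,2) card this, of "E - {e}"]
    show "\<exists>M. linear M \<and> inj M \<and> M p = q \<and>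
       (\<forall>s\<in>?S. \<forall>x. measurement s (M x) = measurement s x) \<and>
       (\<forall>x. edge_length (v1, v2) (M x) = edge_length (v1, v2) x) \<and>
       (M = id \<or> (\<exists>u v. \<forall>a b. a *\<^sub>R (M u - u) + b *\<^sub>R (M v - v) = 0 \<longrightarrow> a = 0 \<and> b = 0))"
      by blast
  qed (use \<sigma>S anS K_def K\<Omega> \<open>compact K\<close> W_def ker open_nondegenerate_graph continuous_edge_length
        open_nondegenerate analytic_edge_length eq_imp_nondeg in auto)
qed

lemma nondegenerate_complement_negligible:
  assumes "simple_graph E"
  shows "negligible (- nondegenerate E)"
proof -
  have "- nondegenerate E = (\<Union>(v, w)\<in>{(v, w). {v, w} \<in> E}. {x. place x $ v - place x $ w = 0})"
    by (auto simp: nondegenerate_def)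
  also have "negligible \<dots>"
  proof (intro negligible_Union)
    fix A assume "A \<in> (\<lambda>(v, w). {x. place x $ v - place x $ w = 0}) ` {(v, w). {v, w} \<in> E}"
    then obtain v w where vw: "{v, w} \<in> E" "A = {x. place x $ v - place x $ w = 0}" by auto
    have "v \<noteq> w" using vw(1) assms by (auto simp: simple_graph_def)
    obtain b where b: "b \<in> B" using card_B by fastforce
    then have "b \<noteq> 0" using independent_B dependent_zero by blast
    then have "place (coord (single v b)) $ v - place (coord (single v b)) $ w \<noteq> 0"
      using \<open>v \<noteq> w\<close> by (simp add: single_def)
    moreover have "linear (\<lambda>x. place x $ v - place x $ w)"
      by (rule linearI) (simp_all add: linear_add[OF linear_place] linear_scale[OF linear_place] algebra_simps)
    ultimately show "negligible A"
      unfolding vw(2) by (intro negligible_linear_kernel)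
  qed auto
  finally show ?thesis .
qed

theorem redundantly_rigid_of_globally_rigid:
  fixes E :: "'v set set"
  assumes fin: "finite {T :: 'a \<Rightarrow> 'a. linear T \<and> isometry T}"
    and simple: "simple_graph E" and card: "CARD('v) \<ge> 3"
    and rigid: "globally_rigid TYPE('a) E"
  shows "redundantly_rigid TYPE('a) E"
proof (rule ccontr)
  assume not_red: "\<not> redundantly_rigid TYPE('a) E"
  obtain v0 :: 'v where True by simp
  define G where "G = place -` interior {p. globally_rigid_framework E p}"
  have "open G" unfolding G_def by (intro open_vimage open_interior continuous_place)
  moreover have "G \<noteq> {}"
  proof -
    obtain y where "y \<in> interior {p :: 'a^'v. globally_rigid_framework E p}"
      using rigid unfolding globally_rigid_def by blast
    then have "coord y \<in> G" by (simp add: G_def)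
    then show ?thesis by blast
  qed
  ultimately have "\<not> G \<subseteq> - nondegenerate E"
    using open_not_negligible nondegenerate_complement_negligible[OF simple] negligible_subset by blast
  define U where "U = G \<inter> nondegenerate E"
  have U: "open U" "U \<noteq> {}" "U \<subseteq> nondegenerate E"
    using \<open>open G\<close> open_nondegenerate_graph \<open>\<not> G \<subseteq> - nondegenerate E\<close> by (auto simp: U_def)
  have gr: "globally_rigid_framework E (place x)" if "x \<in> U" for x
    using that interior_subset by (auto simp: U_def G_def)
  have sub: "measurements v0 (E - {e}) \<subseteq> measurements v0 E" for e by (auto simp: measurements_def)
  \<comment> \<open>If \<open>G\<close> itself is flexible on some open part of \<open>V\<close>, a
    flow gives an infinite fibre against finitely many isometries; otherwise \<open>G\<close> is
    rigid there and \<open>G - e\<close> flexible, which the previous argument excludes.\<close>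
  have flexible_case: False if "e \<in> E" and V: "open V" "V \<noteq> {}" "V \<subseteq> U"
    and \<tau>: "\<And>x. x \<in> V \<Longrightarrow> grad_det (system \<tau>) x \<noteq> 0"
      "\<And>x s. x \<in> V \<Longrightarrow> s \<in> measurements v0 (E - {e}) \<Longrightarrow> grad_det (system (\<tau>(k := s))) x = 0"
    for e V \<tau> k
  proof -
    have VE: "V \<subseteq> nondegenerate E" using V(3) U(3) by blast
    show False
    proof (rule measurement_dichotomy[OF order_refl V(1,2) VE])
      fix \<sigma> V' assume V': "open V'" "V' \<noteq> {}" "V' \<subseteq> V" "\<And>i. \<sigma> i \<in> measurements v0 E"
        "\<And>x. x \<in> V' \<Longrightarrow> grad_det (system \<sigma>) x \<noteq> 0"
      show False
      proof (rule not_globally_rigid_of_flexible_edge_deletion[OF \<open>e \<in> E\<close> card V'(1,2) _ _ V'(4,5)])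
        show "V' \<subseteq> nondegenerate E" using V'(3) VE by blast
        show "globally_rigid_framework E (place x)" if "x \<in> V'" for x using that V'(3) V(3) gr by blast
        fix x assume "x \<in> V'"
        then have x: "x \<in> V" using V'(3) by blast
        show "\<exists>u. u \<noteq> 0 \<and> (\<forall>s\<in>measurements v0 (E - {e}). grad (measurement s) x \<bullet> u = 0)"
          using kernel_field_nonzero[OF \<tau>(1)[OF x]] \<tau>(2)[OF x] grad_measurement_kernel_field
          by (intro exI[of _ "kernel_field (system \<tau>) k x"]) simp
      qed
    next
      fix \<sigma> l V' assume V': "open V'" "V' \<noteq> {}" "V' \<subseteq> V" "\<And>i. \<sigma> i \<in> range Inl \<union> measurements v0 E"
        "\<And>x. x \<in> V' \<Longrightarrow> grad_det (system \<sigma>) x \<noteq> 0"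
        "\<And>x s. x \<in> V' \<Longrightarrow> s \<in> measurements v0 E \<Longrightarrow> grad_det (system (\<sigma>(l := s))) x = 0"
      obtain x where x: "x \<in> V'" using V'(2) by blast
      have V'E: "V' \<subseteq> nondegenerate E" using V'(3) VE by blast
      have an: "analytic_vec_on V' (measurement s)" if "s \<in> range Inl \<union> measurements v0 E" for s
        by (rule analytic_vec_on_subset[OF analytic_measurement[OF that] V'E])
      have "infinite {y. \<forall>s\<in>measurements v0 E. measurement s y = measurement s x}"
      proof (rule kernel_field_fibre_infinite[of l V' "system \<sigma>" x])
        show "kernel_field (system \<sigma>) l x \<noteq> 0" by (rule kernel_field_nonzero[OF V'(5)[OF x]])
        show "grad (measurement s) y \<bullet> kernel_field (system \<sigma>) l y = 0"
          if "s \<in> measurements v0 E" "y \<in> V'" for s y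
          unfolding grad_measurement_kernel_field using V'(6) that by blast
      qed (use an V'(1,4) x in auto)
      moreover have "globally_rigid_framework E (place x)" using x V'(3) V(3) gr by blast
      ultimately show False using globally_rigid_fibre_finite[OF fin] by blast
    qed
  qed
  \<comment> \<open>One framework must serve all deleted edges, so the open set is shrunk edge by
    edge.\<close>
  have "\<exists>V. open V \<and> V \<noteq> {} \<and> V \<subseteq> U \<and>
     (\<forall>e\<in>D. \<exists>\<sigma>. (\<forall>i. \<sigma> i \<in> measurements v0 (E - {e})) \<and> (\<forall>x\<in>V. grad_det (system \<sigma>) x \<noteq> 0))"
    if "finite D" "D \<subseteq> E" for D
    using that
  proof (induction D)
    case empty
    then show ?case using U by (intro exI[of _ U]) auto
  next
    case (insert e D)
    then obtain V where V: "open V" "V \<noteq> {}" "V \<subseteq> U"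
      and VD: "\<forall>e\<in>D. \<exists>\<sigma>. (\<forall>i. \<sigma> i \<in> measurements v0 (E - {e})) \<and> (\<forall>x\<in>V. grad_det (system \<sigma>) x \<noteq> 0)"
      by auto
    have VE: "V \<subseteq> nondegenerate E" using V(3) U(3) by blast
    show ?case
    proof (rule measurement_dichotomy[OF sub[of e] V(1,2) VE])
      fix \<sigma> V' assume V': "open V'" "V' \<noteq> {}" "V' \<subseteq> V" "\<And>i. \<sigma> i \<in> measurements v0 (E - {e})"
        "\<And>x. x \<in> V' \<Longrightarrow> grad_det (system \<sigma>) x \<noteq> 0"
      have "\<exists>\<sigma>. (\<forall>i. \<sigma> i \<in> measurements v0 (E - {e'})) \<and> (\<forall>x\<in>V'. grad_det (system \<sigma>) x \<noteq> 0)"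
        if "e' \<in> insert e D" for e'
      proof (cases "e' = e")
        case True
        then show ?thesis using V'(4,5) by blast
      next
        case False
        then show ?thesis using that VD V'(3) by (meson insertE subsetD)
      qed
      then show ?case using V'(1-3) V(3) by (intro exI[of _ V']) blast
    next
      fix \<tau> k V' assume V': "open V'" "V' \<noteq> {}" "V' \<subseteq> V" "\<And>i. \<tau> i \<in> range Inl \<union> measurements v0 E"
        "\<And>x. x \<in> V' \<Longrightarrow> grad_det (system \<tau>) x \<noteq> 0"
        "\<And>x s. x \<in> V' \<Longrightarrow> s \<in> measurements v0 (E - {e}) \<Longrightarrow> grad_det (system (\<tau>(k := s))) x = 0"
      have False
        by (rule flexible_case[of e V' \<tau> k]) (use insert.prems V' V(3) in auto)
      then show ?case ..
    qed
  qed
  from this[of E] obtain V where V: "V \<noteq> {}" "V \<subseteq> U"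
    and VD: "\<And>e. e \<in> E \<Longrightarrow> \<exists>\<sigma>. (\<forall>i. \<sigma> i \<in> measurements v0 (E - {e})) \<and> (\<forall>x\<in>V. grad_det (system \<sigma>) x \<noteq> 0)"
    by auto
  obtain x where x: "x \<in> V" using V(1) by blast
  have xE: "x \<in> nondegenerate E" using x V(2) U(3) by blast
  have "well_positioned E (place x)"
    unfolding well_positioned_def
    using xE by (auto simp: nondegenerate_def intro!: smooth_point_nonzero)
  moreover have "infinitesimally_rigid (E - {e}) (place x)" if "e \<in> E" for e
  proof -
    have "x \<in> nondegenerate (E - {e})" using xE nondegenerate_mono[of "E - {e}" E] by blast
    then show ?thesis using VD[OF that] x infinitesimally_rigid_of_grad_det by blast
  qed
  ultimately show False using not_red unfolding redundantly_rigid_def by blast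
qed

section \<open>Connectivity\<close>

lemma isometry_id: "linear (\<lambda>x :: 'a. x)" "isometry (\<lambda>x :: 'a. x)"
  by (simp_all add: linear_iff isometry_def)

lemma isometry_uminus: "linear (\<lambda>x :: 'a. - x)" "isometry (\<lambda>x :: 'a. - x)"
  by (simp_all add: linear_iff isometry_def dist_minus)

text \<open>Agreement of two different linear isometries on the difference of two positions is a
  proper subspace of configurations. There are finitely many such subspaces, too small to cover an
  open set of globally rigid frameworks.\<close>

lemma exists_generic_globally_rigid:
  fixes E :: "'v set set"
  assumes fin: "finite {T :: 'a \<Rightarrow> 'a. linear T \<and> isometry T}" and rigid: "globally_rigid TYPE('a) E"
  obtains p :: "'a^'v" where "globally_rigid_framework E p"
    "\<And>T T' v w. linear T \<Longrightarrow> isometry T \<Longrightarrow> linear T' \<Longrightarrow> isometry T' \<Longrightarrow> v \<noteq> w \<Longrightarrow>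
       T (p $ v - p $ w) = T' (p $ v - p $ w) \<Longrightarrow> T = T'"
proof -
  define G where "G = place -` interior {p. globally_rigid_framework E p}"
  have G: "open G" unfolding G_def by (intro open_vimage open_interior continuous_place)
  obtain y where "y \<in> interior {p :: 'a^'v. globally_rigid_framework E p}"
    using rigid unfolding globally_rigid_def by blast
  then have "coord y \<in> G" by (simp add: G_def)
  then have "G \<noteq> {}" by blast
  let ?\<Gamma> = "{T :: 'a \<Rightarrow> 'a. linear T \<and> isometry T}"
  define A where "A = {(T :: 'a \<Rightarrow> 'a, T' :: 'a \<Rightarrow> 'a, v :: 'v, w :: 'v). T \<in> ?\<Gamma> \<and> T' \<in> ?\<Gamma> \<and> T \<noteq> T' \<and> v \<noteq> w}"
  define L where "L = (\<lambda>(T :: 'a \<Rightarrow> 'a, T' :: 'a \<Rightarrow> 'a, v :: 'v, w :: 'v) x. T (place x $ v - place x $ w) - T' (place x $ v - place x $ w))"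
  have "A \<subseteq> ?\<Gamma> \<times> ?\<Gamma> \<times> UNIV \<times> UNIV" by (auto simp: A_def)
  then have "finite A" by (rule finite_subset) (intro finite_cartesian_product fin finite)
  have "negligible (\<Union>a\<in>A. {x. L a x = 0})"
  proof (intro negligible_Union)
    show "finite ((\<lambda>a. {x. L a x = 0}) ` A)" using \<open>finite A\<close> by simp
    fix N assume "N \<in> (\<lambda>a. {x. L a x = 0}) ` A"
    then obtain T T' v w where N: "(T, T', v, w) \<in> A" "N = {x. L (T, T', v, w) x = 0}" by auto
    then have T: "linear T" "linear T'" "T \<noteq> T'" "v \<noteq> w" by (auto simp: A_def)
    then obtain z where z: "T z \<noteq> T' z" by auto
    have "L (T, T', v, w) (coord (single v z)) \<noteq> 0"
      using T z by (simp add: L_def single_def)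
    moreover have "linear (L (T, T', v, w))"
    proof (rule linearI)
      fix x y :: "real^'i::{finite,wellorder}" and r :: real
      have a: "place (x + y) $ v - place (x + y) $ w = (place x $ v - place x $ w) + (place y $ v - place y $ w)"
        by (simp add: linear_add[OF linear_place])
      show "L (T, T', v, w) (x + y) = L (T, T', v, w) x + L (T, T', v, w) y"
        unfolding L_def split a linear_add[OF T(1)] linear_add[OF T(2)] by simp
      have s: "place (r *\<^sub>R x) $ v - place (r *\<^sub>R x) $ w = r *\<^sub>R (place x $ v - place x $ w)"
        by (simp add: linear_scale[OF linear_place] algebra_simps)
      show "L (T, T', v, w) (r *\<^sub>R x) = r *\<^sub>R L (T, T', v, w) x"
        unfolding L_def split s linear_scale[OF T(1)] linear_scale[OF T(2)]
        by (rule scaleR_diff_right[symmetric])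
    qed
    ultimately show "negligible N" unfolding N(2) by (intro negligible_linear_kernel)
  qed
  then have "\<not> G \<subseteq> (\<Union>a\<in>A. {x. L a x = 0})"
    using open_not_negligible[OF G \<open>G \<noteq> {}\<close>] negligible_subset by blast
  then obtain x where x: "x \<in> G" "\<And>a. a \<in> A \<Longrightarrow> L a x \<noteq> 0" by blast
  show thesis
  proof (rule that[of "place x"])
    show "globally_rigid_framework E (place x)" using x(1) interior_subset by (auto simp: G_def)
    show "T = T'" if "linear T" "isometry T" "linear T'" "isometry T'" "v \<noteq> w"
      "T (place x $ v - place x $ w) = T' (place x $ v - place x $ w)" for T T' v w
      using x(2)[of "(T, T', v, w)"] that by (auto simp: A_def L_def)
  qed
qed

text \<open>In dimension at least 2 there is a line through \<open>d\<close> that misses 0; its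
  points lie on different rays, and rescaling them to norm \<open>norm d\<close> gives distinct
  points.\<close>

lemma sphere_infinite:
  fixes d :: 'a
  assumes "d \<noteq> 0"
  shows "infinite {z :: 'a. norm z = norm d}"
proof -
  have "\<not> B \<subseteq> span {d}"
    using independent_span_bound[of "{d}" B] independent_B card_B by auto
  then obtain y where y: "y \<notin> span {d}" by blast
  have nz: "d + t *\<^sub>R y \<noteq> 0" for t
  proof
    assume "d + t *\<^sub>R y = 0"
    then have d: "d = (- t) *\<^sub>R y" by (simp add: add_eq_0_iff2)
    then have "t \<noteq> 0" using assms by auto
    then have "y = (- 1 / t) *\<^sub>R d" unfolding d by simp
    then show False using y by (metis insertI1 span_base span_scale)
  qed
  define z where "z t = (norm d / norm (d + t *\<^sub>R y)) *\<^sub>R (d + t *\<^sub>R y)" for t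
  have "norm (z t) = norm d" for t using nz[of t] by (simp add: z_def)
  then have "range z \<subseteq> {z :: 'a. norm z = norm d}" by auto
  moreover have "inj z"
  proof (rule injI)
    fix s t assume st: "z s = z t"
    define a where "a = norm d / norm (d + s *\<^sub>R y)"
    define b where "b = norm d / norm (d + t *\<^sub>R y)"
    have ab: "a > 0" "b > 0" using assms nz by (auto simp: a_def b_def)
    have "a *\<^sub>R (d + s *\<^sub>R y) = b *\<^sub>R (d + t *\<^sub>R y)" using st by (simp add: z_def a_def b_def)
    then have eq: "(a * s - b * t) *\<^sub>R y = (b - a) *\<^sub>R d" by (simp add: algebra_simps)
    have "a * s - b * t = 0"
    proof (rule ccontr)
      assume "a * s - b * t \<noteq> 0"
      then have "y = (1 / (a * s - b * t)) *\<^sub>R ((a * s - b * t) *\<^sub>R y)" by simp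
      then have "y = (1 / (a * s - b * t)) *\<^sub>R ((b - a) *\<^sub>R d)" unfolding eq .
      then have "y \<in> span {d}" by (metis insertI1 span_base span_scale)
      then show False using y by simp
    qed
    moreover from this have "b - a = 0" using eq assms by simp
    ultimately show "s = t" using ab by simp
  qed
  then have "infinite (range z)"
    using infinite_UNIV_char_0[where 'a = real] finite_imageD by blast
  ultimately show ?thesis by (rule infinite_super)
qed

theorem k_connected_of_globally_rigid:
  fixes E :: "'v set set"
  assumes fin: "finite {T :: 'a \<Rightarrow> 'a. linear T \<and> isometry T}"
    and simple: "simple_graph E" and rigid: "globally_rigid TYPE('a) E"
  shows "k_connected 2 E"
proof -
  obtain p :: "'a^'v" where p: "globally_rigid_framework E p"
    and gen: "\<And>T T' v w. linear T \<Longrightarrow> isometry T \<Longrightarrow> linear T' \<Longrightarrow> isometry T' \<Longrightarrow> v \<noteq> w \<Longrightarrow>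
       T (p $ v - p $ w) = T' (p $ v - p $ w) \<Longrightarrow> T = T'"
    using exists_generic_globally_rigid[OF fin rigid] by blast
  obtain b where "b \<in> B" using card_B by fastforce
  then have b: "b \<noteq> 0" using independent_B dependent_zero by blast
  \<comment> \<open>The identity and the negation are different isometries that agree at 0, so
    genericity keeps all positions apart.\<close>
  have pne: "p $ v \<noteq> p $ w" if "v \<noteq> w" for v w
  proof
    assume "p $ v = p $ w"
    then have "(\<lambda>x :: 'a. x) = (\<lambda>x. - x)"
      using gen[OF isometry_id isometry_uminus that] by simp
    then have "b = - b" by metis
    then have "2 *\<^sub>R b = 0" unfolding scaleR_2 by (metis add.left_inverse)
    then show False using b by simp
  qed
  have congr: "\<exists>T. linear T \<and> isometry T \<and> (\<forall>v w. q $ v - q $ w = T (p $ v - p $ w))"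
    if "equivalent_frameworks E p q" for q
  proof -
    have "congruent_frameworks p q" using p that unfolding globally_rigid_framework_def by blast
    then show ?thesis using congruent_frameworks_linear by metis
  qed
  \<comment> \<open>An equivalent framework that agrees with \<open>p\<close> on the difference of
    one pair of vertices has the identity as linear part, hence is a translate of
    \<open>p\<close>.\<close>
  have translate: "q $ v - q $ w = p $ v - p $ w"
    if q: "equivalent_frameworks E p q" and xy: "x \<noteq> y" "q $ x - q $ y = p $ x - p $ y" for q v w x y
  proof -
    obtain T where T: "linear T" "isometry T" "\<And>v w. q $ v - q $ w = T (p $ v - p $ w)"
      using congr[OF q] by blast
    have "T = (\<lambda>x. x)"
      by (rule gen[OF T(1,2) isometry_id xy(1)]) (use T(3) xy(2) in metis)
    then show ?thesis using T(3) by simp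
  qed
  \<comment> \<open>With two vertices the second can be placed anywhere on a sphere around the
    first, which yields more frameworks than there are linear isometries.\<close>
  have card3: "CARD('v) > 2"
  proof (rule ccontr)
    assume "\<not> CARD('v) > 2"
    then have "CARD('v) = 2" using card_V by simp
    then obtain v w :: 'v where vw: "v \<noteq> w" "UNIV = {v, w}" by (meson card_2_iff)
    define d where "d = p $ w - p $ v"
    have d: "d \<noteq> 0" using pne[of w v] vw(1) by (simp add: d_def)
    have "{z :: 'a. norm z = norm d} \<subseteq> (\<lambda>T. T d) ` {T. linear T \<and> isometry T}"
    proof
      fix z :: 'a assume z: "z \<in> {z. norm z = norm d}"
      define q where "q = (\<chi> x. if x = w then p $ v + z else p $ v)"
      have "norm (p $ x - p $ y) = norm (q $ x - q $ y)" if "{x, y} \<in> E" for x y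
      proof -
        have "x \<noteq> y" using that simple by (auto simp: simple_graph_def)
        moreover have "x \<in> {v, w}" "y \<in> {v, w}" unfolding vw(2)[symmetric] by simp_all
        ultimately have "(x = v \<and> y = w) \<or> (x = w \<and> y = v)" by blast
        then show ?thesis using z vw(1) by (auto simp: q_def d_def norm_minus_commute)
      qed
      then have "equivalent_frameworks E p q" by (simp add: equivalent_frameworks_def)
      then obtain T where T: "linear T" "isometry T" "\<And>v w. q $ v - q $ w = T (p $ v - p $ w)"
        using congr by blast
      have "z = T d" using T(3)[of w v] vw(1) by (simp add: q_def d_def)
      then show "z \<in> (\<lambda>T. T d) ` {T. linear T \<and> isometry T}" using T(1,2) by blast
    qed
    then show False using sphere_infinite[OF d] fin finite_subset by blast
  qed
  have "connected_on E (- S)" if S: "card S < 2" for S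
    unfolding connected_on_def
  proof (intro conjI ballI)
    have "\<not> UNIV \<subseteq> S" using card3 S card_mono[of S UNIV] by auto
    then show "- S \<noteq> {}" by blast
    fix v w assume v: "v \<in> - S" and w: "w \<in> - S"
    let ?R = "{(x, y). x \<in> - S \<and> y \<in> - S \<and> {x, y} \<in> E}"
    show "(v, w) \<in> ?R\<^sup>*"
    proof (rule ccontr)
      assume nvw: "(v, w) \<notin> ?R\<^sup>*"
      define A where "A = {x. (v, x) \<in> ?R\<^sup>*}"
      have vA: "v \<in> A" and wA: "w \<notin> A" using nvw by (auto simp: A_def)
      have AS: "A \<subseteq> - S"
      proof
        fix x assume "x \<in> A"
        then have "(v, x) \<in> ?R\<^sup>*" by (simp add: A_def)
        then show "x \<in> - S" by (cases rule: rtranclE) (use v in auto)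
      qed
      have cross: "y \<in> S" if "x \<in> A" "y \<notin> A" "{x, y} \<in> E" for x y
      proof (rule ccontr)
        assume "y \<notin> S"
        then have "(x, y) \<in> ?R" using that AS by auto
        then show False using that by (auto simp: A_def intro: rtrancl.rtrancl_into_rtrancl)
      qed
      consider "S = {}" | s where "S = {s}"
        using S by (metis One_nat_def card_1_singletonE card_0_eq finite less_2_cases)
      then show False
      proof cases
        case 1
        \<comment> \<open>Translating the component \<open>A\<close> keeps all lengths. A third
          vertex is on the same side as \<open>v\<close> or as \<open>w\<close>, and this pair shows
          that \<open>q\<close> would be a translate of \<open>p\<close>, although \<open>v\<close>
          and \<open>w\<close> moved differently.\<close>
        define q where "q = (\<chi> x. if x \<in> A then p $ x + b else p $ x)"
        have "norm (p $ x - p $ y) = norm (q $ x - q $ y)" if "{x, y} \<in> E" for x y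
          using cross[of x y] cross[of y x] that 1 by (auto simp: q_def insert_commute)
        then have q: "equivalent_frameworks E p q" by (simp add: equivalent_frameworks_def)
        have "card {v, w} \<le> 2" by (simp add: card_insert_if)
        then have "\<not> UNIV \<subseteq> {v, w}" using card3 card_mono[of "{v, w}" UNIV] by auto
        then obtain x where x: "x \<noteq> v" "x \<noteq> w" by blast
        have "q $ v - q $ w = p $ v - p $ w"
        proof (cases "x \<in> A")
          case True
          show ?thesis by (rule translate[OF q x(1)]) (use True vA in \<open>simp add: q_def\<close>)
        next
          case False
          show ?thesis by (rule translate[OF q x(2)]) (use False wA in \<open>simp add: q_def\<close>)
        qed
        then show False using vA wA b by (simp add: q_def)
      next
        case (2 s)
        have sA: "s \<notin> A" using 2 AS by auto
        \<comment> \<open>Reflection of \<open>A\<close> in the position of the cut vertex is an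
          isometry fixing \<open>s\<close>, so all lengths survive. As \<open>w\<close> and
          \<open>s\<close> stay in place, \<open>q\<close> would be a translate of \<open>p\<close>,
          and then the reflection would fix \<open>v\<close>, putting it on top of
          \<open>s\<close>.\<close>
        define q where "q = (\<chi> x. if x \<in> A then 2 *\<^sub>R p $ s - p $ x else p $ x)"
        have "norm (p $ x - p $ y) = norm (q $ x - q $ y)" if xy: "{x, y} \<in> E" for x y
        proof -
          have "{y, x} \<in> E" using xy by (simp add: insert_commute)
          then have "x \<in> A \<Longrightarrow> y \<notin> A \<Longrightarrow> y = s" "y \<in> A \<Longrightarrow> x \<notin> A \<Longrightarrow> x = s"
            using cross[of x y] cross[of y x] xy 2 by simp_all
          then consider "x \<in> A" "y \<in> A" | "x \<notin> A" "y \<notin> A" | "x \<in> A" "y = s" | "x = s" "y \<in> A"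
            by blast
          then show ?thesis
            using sA by cases (simp_all add: q_def norm_minus_commute scaleR_2)
        qed
        then have q: "equivalent_frameworks E p q" by (simp add: equivalent_frameworks_def)
        have ws: "w \<noteq> s" and vs: "v \<noteq> s" using v w 2 by auto
        have "q $ v - q $ s = p $ v - p $ s"
          by (rule translate[OF q ws]) (use wA sA in \<open>simp add: q_def\<close>)
        then have "2 *\<^sub>R p $ v = 2 *\<^sub>R p $ s"
          using vA sA by (simp add: q_def scaleR_2 algebra_simps)
        then show False using pne[OF vs] by simp
      qed
    qed
  qed
  then show ?thesis using card3 by (simp add: k_connected_def)
qed

end

section \<open>The index type\<close>

text \<open>A finite well-ordered type with \<open>dim X * |V|\<close> elements; the maximum only makes it non-empty.\<close>

typedef (overloaded) ('a::real_normed_vector, 'v::finite) frame_index =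
  "{i :: nat. i < max 1 (dim (UNIV :: 'a set) * CARD('v))}"
  by (rule exI[of _ 0]) simp

lemma card_frame_index:
  "card (UNIV :: ('a::real_normed_vector, 'v::finite) frame_index set) = max 1 (dim (UNIV :: 'a set) * CARD('v))"
  by (simp add: type_definition.card[OF type_definition_frame_index])

instance frame_index :: (real_normed_vector, finite) finite
proof
  show "finite (UNIV :: ('a, 'b) frame_index set)"
    by (rule card_ge_0_finite) (simp add: card_frame_index)
qed

instantiation frame_index :: (real_normed_vector, finite) wellorder
begin

definition "i \<le> j \<longleftrightarrow> Rep_frame_index i \<le> Rep_frame_index j"
definition "i < j \<longleftrightarrow> Rep_frame_index i < Rep_frame_index j"

instance
proof
  fix P :: "('a, 'b) frame_index \<Rightarrow> bool" and a
  assume step: "\<And>x. (\<And>y. y < x \<Longrightarrow> P y) \<Longrightarrow> P x"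
  show "P a"
  proof (induction a rule: measure_induct_rule[of Rep_frame_index])
    case (less x)
    show ?case by (rule step, rule less) (simp add: less_frame_index_def)
  qed
qed (auto simp: less_eq_frame_index_def less_frame_index_def Rep_frame_index_inject)

end

text \<open>In dimension at most 1 the norm is a multiple of the absolute value, for which the
  parallelogram law holds. Hence a non-Euclidean space has dimension at least 2.\<close>

lemma euclidean_norm_of_small_basis:
  fixes B :: "'a::real_normed_vector set"
  assumes "finite B" "span B = UNIV" "card B < 2"
  shows "euclidean_norm TYPE('a)"
proof -
  obtain b :: 'a where "B \<subseteq> {b}"
  proof (cases "B = {}")
    case False
    then obtain b where "b \<in> B" by blast
    moreover have "\<forall>x\<in>B. \<forall>y\<in>B. x = y" using assms(1,3) card_le_Suc0_iff_eq[of B] by simp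
    ultimately show thesis using that by blast
  qed (use that in blast)
  then have "span {b} = UNIV" using assms(2) span_mono[of B "{b}"] by auto
  then have b: "\<exists>r. x = r *\<^sub>R b" for x using span_singleton[of b] by (metis UNIV_I rangeE)
  have "(norm (x + y))\<^sup>2 + (norm (x - y))\<^sup>2 = 2 * (norm x)\<^sup>2 + 2 * (norm y)\<^sup>2" for x y :: 'a
  proof -
    obtain r s where "x = r *\<^sub>R b" "y = s *\<^sub>R b" using b by blast
    then have "x + y = (r + s) *\<^sub>R b" "x - y = (r - s) *\<^sub>R b" "x = r *\<^sub>R b" "y = s *\<^sub>R b"
      by (simp_all add: algebra_simps)
    then show ?thesis
      by (simp only: norm_scaleR power_mult_distrib power2_abs) (simp add: power2_eq_square algebra_simps)
  qed
  then show ?thesis by (simp add: euclidean_norm_def)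
qed

theorem theorem3p8:
  fixes E :: "'v::finite set set"
  assumes "analytic_normed_space TYPE('a::real_normed_vector)"
    and "finite {T :: 'a \<Rightarrow> 'a. linear T \<and> isometry T}"
    and "simple_graph E"
    and "CARD('v) \<ge> 2"
    and "globally_rigid TYPE('a) E"
  shows "redundantly_rigid TYPE('a) E \<and> k_connected 2 E"
proof -
  have "real_analytic_on (norm :: 'a \<Rightarrow> real) (- {0})"
    using assms(1) by (simp add: analytic_normed_space_def)
  then obtain B :: "'a set" where B: "finite B" "independent B" "span B = UNIV"
    and ps: "\<forall>a\<in>-{0}. \<exists>r>0. \<exists>c :: ('a \<Rightarrow> nat) \<Rightarrow> real.
        \<forall>t :: 'a \<Rightarrow> real. (\<forall>b\<in>B. \<bar>t b\<bar> < r) \<longrightarrow>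
          ((\<lambda>\<alpha>. c \<alpha> * (\<Prod>b\<in>B. t b ^ \<alpha> b)) has_sum norm (a + (\<Sum>b\<in>B. t b *\<^sub>R b)))
            (B \<rightarrow>\<^sub>E UNIV)"
    unfolding real_analytic_on_def by (elim exE conjE) (rule that)
  have card_B: "card B \<ge> 2"
    using euclidean_norm_of_small_basis[OF B(1,3)] assms(1) by (fastforce simp: analytic_normed_space_def)
  have dim: "dim (UNIV :: 'a set) = card B"
    using dim_span_eq_card_independent[OF B(2)] B(3) by simp
  have "card (UNIV :: ('a, 'v) frame_index set) = card (B \<times> (UNIV :: 'v set))"
    using card_B assms(4) by (simp add: card_frame_index dim card_cartesian_product)
  then obtain \<iota> :: "'a \<times> 'v \<Rightarrow> ('a, 'v) frame_index" where \<iota>: "bij_betw \<iota> (B \<times> UNIV) UNIV"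
    using B(1) by (metis finite finite_cartesian_product finite_same_card_bij)
  interpret framework_coordinates B \<iota>
  proof
    show "\<exists>r>0. \<exists>c :: ('a \<Rightarrow> nat) \<Rightarrow> real.
        \<forall>t :: 'a \<Rightarrow> real. (\<forall>b\<in>B. \<bar>t b\<bar> < r) \<longrightarrow>
          ((\<lambda>\<alpha>. c \<alpha> * (\<Prod>b\<in>B. t b ^ \<alpha> b)) has_sum norm (a + (\<Sum>b\<in>B. t b *\<^sub>R b)))
            (B \<rightarrow>\<^sub>E UNIV)"
      if "a \<noteq> 0" for a :: 'a
      using ps that by simp
  qed (fact B \<iota> card_B assms(4))+
  \<comment> \<open>Connectivity comes first, since it provides the three vertices that the proof of
    redundant rigidity uses.\<close>
  have conn: "k_connected 2 E"
    using k_connected_of_globally_rigid assms by blast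
  then have "CARD('v) \<ge> 3" by (simp add: k_connected_def)
  then show ?thesis
    using conn redundantly_rigid_of_globally_rigid assms by blast
qed

end
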